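(* Let $\bullet$ be either $*$ or $\rho$. The category ${}^{\bullet}\mathbf{EucOp}$ is a concrete site equipped with the coverage consisting of open covers. Moreover, there is a faithful functor $i\colon\mathbf{EucOp}\to{}^{\bullet}\mathbf{EucOp}$ that preserves covering families.
   Context: Numbers. $\mathbb N$ is the set of nonnegative integers, $\mathcal U$ a fixed free ultrafilter on $\mathbb N$; "$P(n)$ a.e." means $\{n: P(n)\}\in\mathcal U$. ${}^*\mathbb R=\mathbb R^{\mathbb N}/\{(x_n): x_n=0\text{ a.e.}\}$ ordered by $[a_n]\le[b_n]$ iff $a_n\le b_n$ a.e.; ${}^*\mathbb N$ is the image of $\mathbb N^{\mathbb N}$; $\rho=[1/n]$. ${}^{\rho}\mathbf M({}^*\mathbb R)=\{x:\exists c\in{}^*\mathbb N,\ |x|\le\rho^{-c}\}$, ${}^{\rho}\mathbf N({}^*\mathbb R)=\{x:\forall d\in{}^*\mathbb N,\ |x|\le\rho^{d}\}$, ${}^{\rho}\mathbb R={}^{\rho}\mathbf M({}^*\mathbb R)/{}^{\rho}\mathbf N({}^*\mathbb R)$. ${}^{*}\mathbf M(\mathbb R^{\mathbb N})=\mathbb R^{\mathbb N}$ and ${}^{\rho}\mathbf M(\mathbb R^{\mathbb N})=\{(x_n):\exists (c_n)\in\mathbb N^{\mathbb N},\ |x_n|\le n^{c_n}\text{ a.e.}\}$. $[x_n]$ denotes the class of a net. Topology. ${}^{\bullet}\mathbb R^k$ has the topology with basis the sets $[V_n]=\{[x_n]:(x_n)\in\prod_nV_n\cap{}^{\bullet}\mathbf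 M(\mathbb R^{\mathbb N})^k\}$, $V_n\subset\mathbb R^k$ open. Calculus. Case $*$: for $U\subset{}^*\mathbb R^k$ open, ${}^*C^\infty(U,{}^*\mathbb R)$ is the set of $f\colon U\to{}^*\mathbb R$ such that each $x\in U$ has a neighbourhood $V=[V_n]\subset U$ ($V_n$ open) and $C^\infty$ functions $g_n\colon V_n\to\mathbb R$ with $f([y_n])=[g_n(y_n)]$ for all $[y_n]\in V$, $y_n\in V_n$; $\partial_if([x_n])=[\partial_ig_n(x_n)]$. Case $\rho$: let $q\colon{}^{\rho}\mathbf M({}^*\mathbb R)\to{}^{\rho}\mathbb R$ be the projection; for $U\subset{}^{\rho}\mathbb R^k$ open put $U'=(q^k)^{-1}(U)$, define ${}^*C^\infty(U',{}^*\mathbb R)$ and $\partial_i$ in the same way (with nets in ${}^{\rho}\mathbf M(\mathbb R^{\mathbb N})^k$), for $\mathbf L=\mathbf M,\mathbf N$ let ${}^{\rho}\mathbf L({}^*C^\infty(U',{}^*\mathbb R))$ be the set of $\phi$ with $D^\alpha\phi(y)\in{}^{\rho}\mathbf L({}^*\mathbb R)$ for all $\alpha\in\mathbb N^k$, $y\in U'$, and put ${}^{\rho}C^\infty(U,{}^{\rho}\mathbb R)={}^{\rho}\mathbf M({}^*C^\infty(U',{}^*\mathbb R))/{}^{\rho}\mathbf N({}^*C^\infty(U',{}^*\mathbb R))$, whose elements are regarded as functions $U\to{}^{\rho}\mathbb R$, $x\mapsto[\phi(y)]$ with $q^k(y)=x$. Sites. For open $U\subset{}^{\bullet}\mathbb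 R^k$, $V\subset{}^{\bullet}\mathbb R^l$, ${}^{\bullet}C^\infty(U,V)$ is the set of maps $U\to V$ whose components lie in ${}^{\bullet}C^\infty(U,{}^{\bullet}\mathbb R)$. ${}^{\bullet}\mathbf{EucOp}$ is the category whose objects are the open subsets of the spaces ${}^{\bullet}\mathbb R^k$ ($k\ge0$) and whose morphisms are the elements of ${}^{\bullet}C^\infty(U,V)$. $\mathbf{EucOp}$ is the site of open subsets of the $\mathbb R^k$, smooth maps, and open covers. "Concrete site" has its usual meaning (a site with terminal object $1$, subcanonical coverage, $\hom(1,-)$ faithful, and covering families jointly surjective on points). *)

theory Defs
  imports "HOL-Analysis.Analysis"
begin

section \<open>Concrete sites\<close>

text \<open>
  Hom-sets and composition are indexed by objects, so hom-sets need not be disjoint: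
  \<open>Cmp C a b c g f\<close> is the composite of \<open>f : a \<rightarrow> b\<close> and \<open>g : b \<rightarrow> c\<close>.
  A covering family of \<open>d\<close> is given as the set of its pairs \<open>(e, f)\<close> with \<open>f : e \<rightarrow> d\<close>.
\<close>

record ('o, 'a) precategory =
  Obj :: "'o set"
  Hom :: "'o \<Rightarrow> 'o \<Rightarrow> 'a set"
  Ident :: "'o \<Rightarrow> 'a"
  Cmp :: "'o \<Rightarrow> 'o \<Rightarrow> 'o \<Rightarrow> 'a \<Rightarrow> 'a \<Rightarrow> 'a"

record ('o, 'a) presite = "('o, 'a) precategory" +
  Cov :: "'o \<Rightarrow> ('o \<times> 'a) set set"

locale category =
  fixes C :: "('o, 'a, 'm) precategory_scheme"
  assumes Ident_in: "a \<in> Obj C \<Longrightarrow> Ident C a \<in> Hom C a a"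
    and Cmp_in: "\<lbrakk>a \<in> Obj C; b \<in> Obj C; c \<in> Obj C; f \<in> Hom C a b; g \<in> Hom C b c\<rbrakk>
      \<Longrightarrow> Cmp C a b c g f \<in> Hom C a c"
    and Cmp_Ident_right: "\<lbrakk>a \<in> Obj C; b \<in> Obj C; f \<in> Hom C a b\<rbrakk>
      \<Longrightarrow> Cmp C a a b f (Ident C a) = f"
    and Cmp_Ident_left: "\<lbrakk>a \<in> Obj C; b \<in> Obj C; f \<in> Hom C a b\<rbrakk>
      \<Longrightarrow> Cmp C a b b (Ident C b) f = f"
    and Cmp_assoc: "\<lbrakk>a \<in> Obj C; b \<in> Obj C; c \<in> Obj C; d \<in> Obj C;
        f \<in> Hom C a b; g \<in> Hom C b c; h \<in> Hom C c d\<rbrakk>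
      \<Longrightarrow> Cmp C a b d (Cmp C b c d h g) f = Cmp C a c d h (Cmp C a b c g f)"

text \<open>A site is a category with a coverage, i.e. covering families satisfy the weak
  pullback condition \<open>coverage\<close> (no Grothendieck topology axioms beyond it).\<close>

locale site = category C for C :: "('o, 'a, 'm) presite_scheme" +
  assumes Cov_arrows: "\<lbrakk>d \<in> Obj C; S \<in> Cov C d; (e, f) \<in> S\<rbrakk>
      \<Longrightarrow> e \<in> Obj C \<and> f \<in> Hom C e d"
    and coverage: "\<lbrakk>d \<in> Obj C; S \<in> Cov C d; c \<in> Obj C; g \<in> Hom C c d\<rbrakk>
      \<Longrightarrow> \<exists>T\<in>Cov C c. \<forall>(b, h)\<in>T. \<exists>(e, f)\<in>S. \<exists>k\<in>Hom C b e.
            Cmp C b c d g h = Cmp C b e d f k"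

text \<open>A presheaf is given by its sets \<open>P d\<close> and its restriction maps
  \<open>R e d f : P d \<rightarrow> P e\<close> for \<open>f : e \<rightarrow> d\<close>.\<close>

definition compatible_family ::
  "('o, 'a, 'm) presite_scheme \<Rightarrow> ('o \<Rightarrow> 'x set) \<Rightarrow> ('o \<Rightarrow> 'o \<Rightarrow> 'a \<Rightarrow> 'x \<Rightarrow> 'x) \<Rightarrow>
    'o \<Rightarrow> ('o \<times> 'a) set \<Rightarrow> ('o \<times> 'a \<Rightarrow> 'x) \<Rightarrow> bool" where
  "compatible_family C P R d S \<phi> \<longleftrightarrow>
     (\<forall>(e, f)\<in>S. \<phi> (e, f) \<in> P e) \<and>
     (\<forall>(e, f)\<in>S. \<forall>(e', f')\<in>S. \<forall>c\<in>Obj C. \<forall>g\<in>Hom C c e. \<forall>g'\<in>Hom C c e'.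
        Cmp C c e d f g = Cmp C c e' d f' g' \<longrightarrow>
        R c e g (\<phi> (e, f)) = R c e' g' (\<phi> (e', f')))"

definition is_sheaf ::
  "('o, 'a, 'm) presite_scheme \<Rightarrow> ('o \<Rightarrow> 'x set) \<Rightarrow> ('o \<Rightarrow> 'o \<Rightarrow> 'a \<Rightarrow> 'x \<Rightarrow> 'x) \<Rightarrow> bool" where
  "is_sheaf C P R \<longleftrightarrow>
     (\<forall>d\<in>Obj C. \<forall>S\<in>Cov C d. \<forall>\<phi>. compatible_family C P R d S \<phi> \<longrightarrow>
        (\<exists>!s. s \<in> P d \<and> (\<forall>(e, f)\<in>S. R e d f s = \<phi> (e, f))))"

definition subcanonical :: "('o, 'a, 'm) presite_scheme \<Rightarrow> bool" where
  "subcanonical C \<longleftrightarrow>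
     (\<forall>x\<in>Obj C. is_sheaf C (\<lambda>d. Hom C d x) (\<lambda>e d f h. Cmp C e d x h f))"

definition terminal_object :: "('o, 'a, 'm) precategory_scheme \<Rightarrow> 'o \<Rightarrow> bool" where
  "terminal_object C t \<longleftrightarrow> t \<in> Obj C \<and> (\<forall>a\<in>Obj C. \<exists>!f. f \<in> Hom C a t)"

definition concrete_site :: "('o, 'a, 'm) presite_scheme \<Rightarrow> bool" where
  "concrete_site C \<longleftrightarrow> site C \<and> subcanonical C \<and>
     (\<exists>t. terminal_object C t \<and>
        (\<forall>a\<in>Obj C. \<forall>b\<in>Obj C. \<forall>f\<in>Hom C a b. \<forall>g\<in>Hom C a b.
           (\<forall>p\<in>Hom C t a. Cmp C t a b f p = Cmp C t a b g p) \<longrightarrow> f = g) \<and>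
        (\<forall>d\<in>Obj C. \<forall>S\<in>Cov C d. (\<Union>(e, f)\<in>S. Cmp C t e d f ` Hom C t e) = Hom C t d))"

locale category_functor = source: category C + target: category D
  for C :: "('o, 'a, 'm) precategory_scheme" and D :: "('p, 'b, 'n) precategory_scheme" +
  fixes FO :: "'o \<Rightarrow> 'p" and FA :: "'o \<Rightarrow> 'o \<Rightarrow> 'a \<Rightarrow> 'b"
  assumes FO_in: "a \<in> Obj C \<Longrightarrow> FO a \<in> Obj D"
    and FA_in: "\<lbrakk>a \<in> Obj C; b \<in> Obj C; f \<in> Hom C a b\<rbrakk> \<Longrightarrow> FA a b f \<in> Hom D (FO a) (FO b)"
    and FA_Ident: "a \<in> Obj C \<Longrightarrow> FA a a (Ident C a) = Ident D (FO a)"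
    and FA_Cmp: "\<lbrakk>a \<in> Obj C; b \<in> Obj C; c \<in> Obj C; f \<in> Hom C a b; g \<in> Hom C b c\<rbrakk>
      \<Longrightarrow> FA a c (Cmp C a b c g f) = Cmp D (FO a) (FO b) (FO c) (FA b c g) (FA a b f)"

definition faithful_functor ::
  "('o, 'a, 'm) precategory_scheme \<Rightarrow> ('p, 'b, 'n) precategory_scheme \<Rightarrow>
    ('o \<Rightarrow> 'p) \<Rightarrow> ('o \<Rightarrow> 'o \<Rightarrow> 'a \<Rightarrow> 'b) \<Rightarrow> bool" where
  "faithful_functor C D FO FA \<longleftrightarrow>
     category_functor C D FO FA \<and> (\<forall>a\<in>Obj C. \<forall>b\<in>Obj C. inj_on (FA a b) (Hom C a b))"

definition preserves_coverings ::
  "('o, 'a, 'm) presite_scheme \<Rightarrow> ('p, 'b, 'n) presite_scheme \<Rightarrow>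
    ('o \<Rightarrow> 'p) \<Rightarrow> ('o \<Rightarrow> 'o \<Rightarrow> 'a \<Rightarrow> 'b) \<Rightarrow> bool" where
  "preserves_coverings C D FO FA \<longleftrightarrow>
     (\<forall>d\<in>Obj C. \<forall>S\<in>Cov C d. (\<lambda>(e, f). (FO e, FA e d f)) ` S \<in> Cov D (FO d))"


section \<open>Sites of open subsets\<close>

text \<open>
  Given a topology \<open>T k\<close> on the \<open>k\<close>-dimensional space for each \<open>k\<close>, and for each open \<open>A\<close>
  a set \<open>F k A\<close> of scalar functions on \<open>A\<close>, the following is the site whose
  objects are the open subsets of all \<open>T k\<close> (tagged with the dimension \<open>k\<close>), whose arrows are
  the maps with components in \<open>F\<close>, and whose covering families are the families of inclusions
  of open covers. Maps are extensional, i.e. \<open>undefined\<close> outside their domain.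
\<close>

definition open_set_site ::
  "(nat \<Rightarrow> (nat \<Rightarrow> 'r) topology) \<Rightarrow> (nat \<Rightarrow> (nat \<Rightarrow> 'r) set \<Rightarrow> ((nat \<Rightarrow> 'r) \<Rightarrow> 'r) set) \<Rightarrow>
    (nat \<times> (nat \<Rightarrow> 'r) set, (nat \<Rightarrow> 'r) \<Rightarrow> (nat \<Rightarrow> 'r)) presite" where
  "open_set_site T F =
    \<lparr>Obj = {(k, A). openin (T k) A},
     Hom = (\<lambda>(k, A) (l, B). {f \<in> A \<rightarrow>\<^sub>E B. \<forall>j<l. (\<lambda>x\<in>A. f x j) \<in> F k A}),
     Ident = (\<lambda>(k, A). (\<lambda>x\<in>A. x)),
     Cmp = (\<lambda>(k, A) b c g f. compose A g f),
     Cov = (\<lambda>(k, A). {(\<lambda>B. ((k, B), (\<lambda>x\<in>B. x))) ` \<B> |\<B>.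
              (\<forall>B\<in>\<B>. openin (T k) B) \<and> \<Union>\<B> = A})\<rparr>"


section \<open>Smooth functions on open subsets of Euclidean space\<close>

text \<open>Points of \<open>\<real>\<^sup>k\<close> are those of \<^const>\<open>Euclidean_space\<close>, i.e. functions \<open>nat \<Rightarrow> real\<close>
  that vanish from index \<open>k\<close> on.\<close>

definition partial :: "nat \<Rightarrow> ((nat \<Rightarrow> real) \<Rightarrow> real) \<Rightarrow> (nat \<Rightarrow> real) \<Rightarrow> real" where
  "partial i g = (\<lambda>x. deriv (\<lambda>t. g (x(i := t))) (x i))"

text \<open>\<open>C\<^sup>\<infinity>\<close> on an open set: all iterated partial derivatives exist and are continuous.\<close>

definition smooth_on :: "nat \<Rightarrow> (nat \<Rightarrow> real) set \<Rightarrow> ((nat \<Rightarrow> real) \<Rightarrow> real) \<Rightarrow> bool" where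
  "smooth_on k V g \<longleftrightarrow>
     (\<forall>is. set is \<subseteq> {..<k} \<longrightarrow>
        continuous_map (subtopology (Euclidean_space k) V) euclideanreal (foldr partial is g) \<and>
        (\<forall>x\<in>V. \<forall>i<k. (\<lambda>t. foldr partial is g (x(i := t))) field_differentiable at (x i)))"

definition EucOp :: "(nat \<times> (nat \<Rightarrow> real) set, (nat \<Rightarrow> real) \<Rightarrow> (nat \<Rightarrow> real)) presite" where
  "EucOp = open_set_site Euclidean_space (\<lambda>k A. {f \<in> extensional A. smooth_on k A f})"


section \<open>Hyperreal and asymptotic numbers\<close>

text \<open>A property holds almost everywhere iff it holds \<^const>\<open>eventually\<close> for the ultrafilter.\<close>

definition free_ultrafilter :: "nat filter \<Rightarrow> bool" where
  "free_ultrafilter \<U> \<longleftrightarrow> \<U> \<noteq> bot \<and>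
     (\<forall>P. eventually P \<U> \<or> eventually (\<lambda>n. \<not> P n) \<U>) \<and>
     (\<forall>m. eventually (\<lambda>n. n \<noteq> m) \<U>)"

type_synonym hyp = "(nat \<Rightarrow> real) set"

definition ae_eq :: "nat filter \<Rightarrow> ((nat \<Rightarrow> real) \<times> (nat \<Rightarrow> real)) set" where
  "ae_eq \<U> = {(x, y). \<forall>\<^sub>F n in \<U>. x n = y n}"

definition hyperreals :: "nat filter \<Rightarrow> hyp set" where
  "hyperreals \<U> = UNIV // ae_eq \<U>"

definition hclass :: "nat filter \<Rightarrow> (nat \<Rightarrow> real) \<Rightarrow> hyp" where
  "hclass \<U> x = ae_eq \<U> `` {x}"

definition hypernats :: "nat filter \<Rightarrow> hyp set" where
  "hypernats \<U> = {hclass \<U> (\<lambda>n. real (c n)) |c :: nat \<Rightarrow> nat. True}"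

definition hmap :: "nat filter \<Rightarrow> (real \<Rightarrow> real) \<Rightarrow> hyp \<Rightarrow> hyp" where
  "hmap \<U> f a = (\<Union>x\<in>a. hclass \<U> (\<lambda>n. f (x n)))"

definition hmap2 :: "nat filter \<Rightarrow> (real \<Rightarrow> real \<Rightarrow> real) \<Rightarrow> hyp \<Rightarrow> hyp \<Rightarrow> hyp" where
  "hmap2 \<U> f a b = (\<Union>x\<in>a. \<Union>y\<in>b. hclass \<U> (\<lambda>n. f (x n) (y n)))"

definition hle :: "nat filter \<Rightarrow> hyp \<Rightarrow> hyp \<Rightarrow> bool" where
  "hle \<U> a b \<longleftrightarrow> (\<exists>x\<in>a. \<exists>y\<in>b. \<forall>\<^sub>F n in \<U>. x n \<le> y n)"

definition rho_pow :: "nat filter \<Rightarrow> hyp \<Rightarrow> hyp" where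
  "rho_pow \<U> c = hmap2 \<U> (powr) (hclass \<U> (\<lambda>n. 1 / real n)) c"

text \<open>The exponents range over the hypernaturals, not just over the standard naturals.\<close>

definition rho_moderate :: "nat filter \<Rightarrow> hyp set" where
  "rho_moderate \<U> = {x \<in> hyperreals \<U>.
     \<exists>c\<in>hypernats \<U>. hle \<U> (hmap \<U> abs x) (rho_pow \<U> (hmap \<U> uminus c))}"

definition rho_negligible :: "nat filter \<Rightarrow> hyp set" where
  "rho_negligible \<U> = {x \<in> hyperreals \<U>.
     \<forall>d\<in>hypernats \<U>. hle \<U> (hmap \<U> abs x) (rho_pow \<U> d)}"

definition rho_eq :: "nat filter \<Rightarrow> (hyp \<times> hyp) set" where
  "rho_eq \<U> = {(x, y). x \<in> rho_moderate \<U> \<and> y \<in> rho_moderate \<U> \<and>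
     hmap2 \<U> (-) x y \<in> rho_negligible \<U>}"

definition rho_reals :: "nat filter \<Rightarrow> hyp set set" where
  "rho_reals \<U> = rho_moderate \<U> // rho_eq \<U>"

definition rho_proj :: "nat filter \<Rightarrow> hyp \<Rightarrow> hyp set" where
  "rho_proj \<U> x = rho_eq \<U> `` {x}"

definition rho_moderate_nets :: "nat filter \<Rightarrow> (nat \<Rightarrow> real) set" where
  "rho_moderate_nets \<U> = {x. \<exists>c :: nat \<Rightarrow> nat. \<forall>\<^sub>F n in \<U>. \<bar>x n\<bar> \<le> real n ^ c n}"


section \<open>Generalized Euclidean spaces\<close>

text \<open>
  A point of the \<open>k\<close>-th power of the hyperreals (or of the asymptotic numbers) is an
  extensional function on \<open>{..<k}\<close>. The parameter \<open>M\<close> is the set of scalar nets allowed as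
  components: all nets in case \<open>*\<close>, the moderate ones in case \<open>\<rho>\<close>.
\<close>

definition nets :: "(nat \<Rightarrow> real) set \<Rightarrow> nat \<Rightarrow> (nat \<Rightarrow> (nat \<Rightarrow> real) set) \<Rightarrow> (nat \<Rightarrow> nat \<Rightarrow> real) set" where
  "nets M k V = {x. (\<forall>n. x n \<in> V n) \<and> (\<forall>i<k. (\<lambda>n. x n i) \<in> M)}"

definition hvec :: "nat filter \<Rightarrow> nat \<Rightarrow> (nat \<Rightarrow> nat \<Rightarrow> real) \<Rightarrow> nat \<Rightarrow> hyp" where
  "hvec \<U> k x = (\<lambda>i\<in>{..<k}. hclass \<U> (\<lambda>n. x n i))"

definition hbox ::
  "nat filter \<Rightarrow> (nat \<Rightarrow> real) set \<Rightarrow> nat \<Rightarrow> (nat \<Rightarrow> (nat \<Rightarrow> real) set) \<Rightarrow> (nat \<Rightarrow> hyp) set" where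
  "hbox \<U> M k V = hvec \<U> k ` nets M k V"

definition rho_proj_vec :: "nat filter \<Rightarrow> nat \<Rightarrow> (nat \<Rightarrow> hyp) \<Rightarrow> nat \<Rightarrow> hyp set" where
  "rho_proj_vec \<U> k x = (\<lambda>i\<in>{..<k}. rho_proj \<U> (x i))"

definition star_topology :: "nat filter \<Rightarrow> nat \<Rightarrow> (nat \<Rightarrow> hyp) topology" where
  "star_topology \<U> k = topology (arbitrary union_of (\<lambda>B. \<exists>V.
     (\<forall>n. openin (Euclidean_space k) (V n)) \<and> B = hbox \<U> UNIV k V))"

definition rho_topology :: "nat filter \<Rightarrow> nat \<Rightarrow> (nat \<Rightarrow> hyp set) topology" where
  "rho_topology \<U> k = topology (arbitrary union_of (\<lambda>B. \<exists>V.
     (\<forall>n. openin (Euclidean_space k) (V n)) \<and>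
     B = rho_proj_vec \<U> k ` hbox \<U> (rho_moderate_nets \<U>) k V))"


section \<open>Smooth functions with hyperreal values\<close>

definition local_rep ::
  "nat filter \<Rightarrow> (nat \<Rightarrow> real) set \<Rightarrow> nat \<Rightarrow> (nat \<Rightarrow> hyp) set \<Rightarrow> ((nat \<Rightarrow> hyp) \<Rightarrow> hyp) \<Rightarrow>
    (nat \<Rightarrow> (nat \<Rightarrow> real) set) \<Rightarrow> (nat \<Rightarrow> (nat \<Rightarrow> real) \<Rightarrow> real) \<Rightarrow> bool" where
  "local_rep \<U> M k W f V g \<longleftrightarrow>
     (\<forall>n. openin (Euclidean_space k) (V n)) \<and> hbox \<U> M k V \<subseteq> W \<and>
     (\<forall>n. smooth_on k (V n) (g n)) \<and>
     (\<forall>y\<in>nets M k V. f (hvec \<U> k y) = hclass \<U> (\<lambda>n. g n (y n)))"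

definition hsmooth ::
  "nat filter \<Rightarrow> (nat \<Rightarrow> real) set \<Rightarrow> nat \<Rightarrow> (nat \<Rightarrow> hyp) set \<Rightarrow> ((nat \<Rightarrow> hyp) \<Rightarrow> hyp) set" where
  "hsmooth \<U> M k W = {f \<in> W \<rightarrow>\<^sub>E hyperreals \<U>.
     \<forall>x\<in>W. \<exists>V g. x \<in> hbox \<U> M k V \<and> local_rep \<U> M k W f V g}"

text \<open>The value is independent of the local representation, so \<open>THE\<close> is meaningful.\<close>

definition hpartial ::
  "nat filter \<Rightarrow> (nat \<Rightarrow> real) set \<Rightarrow> nat \<Rightarrow> (nat \<Rightarrow> hyp) set \<Rightarrow> nat \<Rightarrow>
    ((nat \<Rightarrow> hyp) \<Rightarrow> hyp) \<Rightarrow> (nat \<Rightarrow> hyp) \<Rightarrow> hyp" where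
  "hpartial \<U> M k W i f = (\<lambda>x\<in>W. THE v. \<exists>V g y. local_rep \<U> M k W f V g \<and>
     y \<in> nets M k V \<and> hvec \<U> k y = x \<and> v = hclass \<U> (\<lambda>n. partial i (g n) (y n)))"

definition hderiv ::
  "nat filter \<Rightarrow> (nat \<Rightarrow> real) set \<Rightarrow> nat \<Rightarrow> (nat \<Rightarrow> hyp) set \<Rightarrow> (nat \<Rightarrow> nat) \<Rightarrow>
    ((nat \<Rightarrow> hyp) \<Rightarrow> hyp) \<Rightarrow> (nat \<Rightarrow> hyp) \<Rightarrow> hyp" where
  "hderiv \<U> M k W \<alpha> f = foldr (\<lambda>i. hpartial \<U> M k W i ^^ \<alpha> i) [0..<k] f"

definition star_smooth ::
  "nat filter \<Rightarrow> nat \<Rightarrow> (nat \<Rightarrow> hyp) set \<Rightarrow> ((nat \<Rightarrow> hyp) \<Rightarrow> hyp) set" where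
  "star_smooth \<U> k W = hsmooth \<U> UNIV k W"


section \<open>Smooth functions of asymptotic numbers\<close>

definition rho_preimage :: "nat filter \<Rightarrow> nat \<Rightarrow> (nat \<Rightarrow> hyp set) set \<Rightarrow> (nat \<Rightarrow> hyp) set" where
  "rho_preimage \<U> k W = {y \<in> {..<k} \<rightarrow>\<^sub>E rho_moderate \<U>. rho_proj_vec \<U> k y \<in> W}"

text \<open>With \<open>L\<close> the moderate or the negligible numbers, this gives the moderate or the
  negligible smooth functions on the preimage \<open>W'\<close>.\<close>

definition rho_bounded ::
  "nat filter \<Rightarrow> hyp set \<Rightarrow> nat \<Rightarrow> (nat \<Rightarrow> hyp) set \<Rightarrow> ((nat \<Rightarrow> hyp) \<Rightarrow> hyp) set" where
  "rho_bounded \<U> L k W' = {\<phi> \<in> hsmooth \<U> (rho_moderate_nets \<U>) k W'.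
     \<forall>\<alpha>. \<forall>y\<in>W'. hderiv \<U> (rho_moderate_nets \<U>) k W' \<alpha> \<phi> y \<in> L}"

definition rho_fun_eq ::
  "nat filter \<Rightarrow> nat \<Rightarrow> (nat \<Rightarrow> hyp) set \<Rightarrow> (((nat \<Rightarrow> hyp) \<Rightarrow> hyp) \<times> ((nat \<Rightarrow> hyp) \<Rightarrow> hyp)) set" where
  "rho_fun_eq \<U> k W' = {(\<phi>, \<psi>).
     \<phi> \<in> rho_bounded \<U> (rho_moderate \<U>) k W' \<and> \<psi> \<in> rho_bounded \<U> (rho_moderate \<U>) k W' \<and>
     (\<lambda>y\<in>W'. hmap2 \<U> (-) (\<phi> y) (\<psi> y)) \<in> rho_bounded \<U> (rho_negligible \<U>) k W'}"

definition rho_fun_of_class ::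
  "nat filter \<Rightarrow> nat \<Rightarrow> (nat \<Rightarrow> hyp set) set \<Rightarrow> ((nat \<Rightarrow> hyp) \<Rightarrow> hyp) set \<Rightarrow>
    (nat \<Rightarrow> hyp set) \<Rightarrow> hyp set" where
  "rho_fun_of_class \<U> k W \<Phi> = (\<lambda>x\<in>W. THE r.
     \<exists>\<phi>\<in>\<Phi>. \<exists>y\<in>rho_preimage \<U> k W. rho_proj_vec \<U> k y = x \<and> r = rho_proj \<U> (\<phi> y))"

definition rho_smooth ::
  "nat filter \<Rightarrow> nat \<Rightarrow> (nat \<Rightarrow> hyp set) set \<Rightarrow> ((nat \<Rightarrow> hyp set) \<Rightarrow> hyp set) set" where
  "rho_smooth \<U> k W = rho_fun_of_class \<U> k W `
     (rho_bounded \<U> (rho_moderate \<U>) k (rho_preimage \<U> k W) //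
      rho_fun_eq \<U> k (rho_preimage \<U> k W))"


section \<open>The generalized sites\<close>

definition star_EucOp ::
  "nat filter \<Rightarrow> (nat \<times> (nat \<Rightarrow> hyp) set, (nat \<Rightarrow> hyp) \<Rightarrow> (nat \<Rightarrow> hyp)) presite" where
  "star_EucOp \<U> = open_set_site (star_topology \<U>) (star_smooth \<U>)"

definition rho_EucOp ::
  "nat filter \<Rightarrow> (nat \<times> (nat \<Rightarrow> hyp set) set, (nat \<Rightarrow> hyp set) \<Rightarrow> (nat \<Rightarrow> hyp set)) presite" where
  "rho_EucOp \<U> = open_set_site (rho_topology \<U>) (rho_smooth \<U>)"

end

theory Submission
  imports Defs
begin

text \<open>
  An open set of a space of \<open>k\<close>-tuples over any ring of numbers, with the maps whose components
  are "smooth" for some notion of smoothness, gives an object of a concrete site as soon as that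
  notion contains the coordinates, is stable under substitution, implies continuity, is local,
  and gives the one-point space all constants: substitution makes a category, continuity pulls
  open covers back, locality glues compatible families (so representable presheaves are sheaves),
  and constants identify the points of an open set with the arrows out of the terminal object.
  This is \<open>concrete_site_open_set_site\<close>, and what remains is to verify these five properties.

  For the hyperreals, points, open sets and smooth functions are given by sequences, and each of
  the three notions can be tested almost everywhere: \<open>W\<close> is a neighbourhood of the class of a net
  \<open>y\<close> iff there are open \<open>V n\<close>, containing \<open>y n\<close> for almost all \<open>n\<close>, such that every net that
  is almost everywhere in \<open>V\<close> has its class in \<open>W\<close>; and similarly for smoothness. The five
  properties then follow index by index from real calculus (\<open>smooth_spaces_star\<close>). The only
  substantial ingredient is that composites of \<open>C\<^sup>\<infinity>\<close> maps are \<open>C\<^sup>\<infinity>\<close>, when smoothness is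
  defined by iterated partial derivatives (\<open>smooth_on_compose\<close>).

  The asymptotic numbers need no new analysis, because the exponents in their definition range
  over all hypernaturals. For each net \<open>x\<close> there is a sequence \<open>c\<close> of naturals with
  \<open>\<bar>x n\<bar> \<le> n ^ c n\<close> for all \<open>n \<ge> 2\<close>, so every hyperreal is moderate; the same argument for
  \<open>1 / x\<close> shows that only zero is negligible. Hence the projection to the asymptotic numbers is
  \<open>x \<mapsto> {x}\<close>. The derivatives of a smooth function are again hyperreal-valued, hence moderate,
  and so the site of case \<open>\<rho>\<close> is the site of case \<open>*\<close> transported along this bijection
  (\<open>smooth_spaces_transport_rho\<close>).

  The functor cannot be \<open>A \<mapsto> *A\<close>: the intervals \<open>(-m, m)\<close> cover the real line, but their
  extensions contain no infinite number. Instead \<open>A\<close> is sent to the set \<open>near_standard k A\<close> of the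
  classes of those nets that converge along the ultrafilter to a point of \<open>A\<close>. This set is open because
  bounded closed boxes are compact, so a net in a small box around a point of \<open>A\<close> has a limit in
  \<open>A\<close> (\<open>star_open_near_standard\<close>). A smooth map preserves convergence, hence acts on such
  classes, and it is recovered from its action on constant nets. Covers are preserved because
  the limit of a net lies in some member of the cover, which then contains almost all terms of
  the net (\<open>near_standard_Union\<close>).
\<close>


section \<open>When open sets form a concrete site\<close>

definition maps_between ::
  "(nat \<Rightarrow> (nat \<Rightarrow> 'r) set \<Rightarrow> ((nat \<Rightarrow> 'r) \<Rightarrow> 'r) set) \<Rightarrow>
    nat \<Rightarrow> (nat \<Rightarrow> 'r) set \<Rightarrow> nat \<Rightarrow> (nat \<Rightarrow> 'r) set \<Rightarrow> ((nat \<Rightarrow> 'r) \<Rightarrow> (nat \<Rightarrow> 'r)) set" where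
  "maps_between F k A l B = {f \<in> A \<rightarrow>\<^sub>E B. \<forall>j<l. (\<lambda>x\<in>A. f x j) \<in> F k A}"

lemma open_set_site_simps:
  "(k, A) \<in> Obj (open_set_site T F) \<longleftrightarrow> openin (T k) A"
  "Hom (open_set_site T F) (k, A) (l, B) = maps_between F k A l B"
  "Ident (open_set_site T F) (k, A) = (\<lambda>x\<in>A. x)"
  "Cmp (open_set_site T F) (k, A) b c g f = compose A g f"
  "Cov (open_set_site T F) (k, A) = {(\<lambda>B. ((k, B), (\<lambda>x\<in>B. x))) ` \<B> |\<B>.
      (\<forall>B\<in>\<B>. openin (T k) B) \<and> \<Union>\<B> = A}"
  by (simp_all add: open_set_site_def maps_between_def)

text \<open>
  Coordinates give the identities and inclusions, and \<open>pullback\<close> gives the composites, of a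
  category of open sets and componentwise smooth maps.
\<close>

locale smooth_maps =
  fixes T :: "nat \<Rightarrow> (nat \<Rightarrow> 'r) topology"
    and F :: "nat \<Rightarrow> (nat \<Rightarrow> 'r) set \<Rightarrow> ((nat \<Rightarrow> 'r) \<Rightarrow> 'r) set"
  assumes coordinate: "\<lbrakk>openin (T k) A; i < k\<rbrakk> \<Longrightarrow> (\<lambda>x\<in>A. x i) \<in> F k A"
    and pullback: "\<lbrakk>openin (T k) A; openin (T l) B; f \<in> maps_between F k A l B; \<phi> \<in> F l B\<rbrakk>
      \<Longrightarrow> (\<lambda>x\<in>A. \<phi> (f x)) \<in> F k A"
begin

lemma inclusion_in_maps:
  assumes "openin (T k) A" "A \<subseteq> B"
  shows "(\<lambda>x\<in>A. x) \<in> maps_between F k A k B"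
proof -
  have "(\<lambda>x\<in>A. (\<lambda>x\<in>A. x) x j) = (\<lambda>x\<in>A. x j)" for j by auto
  then show ?thesis
    using assms coordinate by (auto simp: maps_between_def)
qed

lemma restrict_mem:
  assumes "openin (T k) A" "\<phi> \<in> F k A"
  shows "restrict \<phi> A \<in> F k A"
proof -
  have "(\<lambda>x\<in>A. \<phi> ((\<lambda>x\<in>A. x) x)) \<in> F k A"
    by (rule pullback[OF assms(1,1) inclusion_in_maps[OF assms(1) subset_refl] assms(2)])
  moreover have "(\<lambda>x\<in>A. \<phi> ((\<lambda>x\<in>A. x) x)) = restrict \<phi> A" by auto
  ultimately show ?thesis by simp
qed

lemma compose_in_maps:
  assumes "openin (T k) A" "openin (T l) B" "f \<in> maps_between F k A l B" "g \<in> maps_between F l B m C"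
  shows "compose A g f \<in> maps_between F k A m C"
proof -
  have "(\<lambda>x\<in>A. compose A g f x j) \<in> F k A" if "j < m" for j
  proof -
    have "(\<lambda>x\<in>A. (\<lambda>y\<in>B. g y j) (f x)) \<in> F k A"
      using pullback[OF assms(1-3), of "\<lambda>y\<in>B. g y j"] assms(4) that by (auto simp: maps_between_def)
    also have "(\<lambda>x\<in>A. (\<lambda>y\<in>B. g y j) (f x)) = (\<lambda>x\<in>A. compose A g f x j)"
      using assms(3) by (auto simp: maps_between_def compose_def PiE_iff)
    finally show ?thesis .
  qed
  then show ?thesis
    using assms(3,4) by (auto simp: maps_between_def compose_def PiE_iff)
qed

lemma restrict_in_maps:
  assumes "openin (T k) A" "openin (T k) A'" "A' \<subseteq> A" "f \<in> maps_between F k A l B"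
  shows "restrict f A' \<in> maps_between F k A' l B"
proof -
  have "compose A' f (\<lambda>x\<in>A'. x) = restrict f A'"
    by (auto simp: compose_def)
  then show ?thesis
    using compose_in_maps[OF assms(2,1) inclusion_in_maps[OF assms(2,3)] assms(4)] by simp
qed

lemma category_open_set_site: "category (open_set_site T F)"
proof (unfold_locales, goal_cases)
  case (1 a)
  then show ?case by (cases a) (auto simp: open_set_site_simps intro: inclusion_in_maps)
next
  case (2 a b c f g)
  then show ?case by (cases a; cases b; cases c) (auto simp: open_set_site_simps intro: compose_in_maps)
next
  case (3 a b f)
  then show ?case
    by (cases a; cases b)
      (auto simp: open_set_site_simps maps_between_def compose_def PiE_iff extensional_def restrict_def
        fun_eq_iff)
next
  case (4 a b f)
  then show ?case
    by (cases a; cases b)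
      (auto simp: open_set_site_simps maps_between_def compose_def PiE_iff extensional_def restrict_def)
next
  case (5 a b c d f g h)
  then show ?case
    by (cases a; cases b; cases c; cases d)
      (auto simp: open_set_site_simps maps_between_def compose_def PiE_iff)
qed

end

text \<open>
  The additional conditions for a concrete site: \<open>continuous\<close> pulls covers back, \<open>glue\<close> gives the
  sheaf property, and \<open>point\<close> and \<open>constant_map\<close> turn points into arrows out of a terminal object.
\<close>

locale smooth_spaces = smooth_maps T F
  for T :: "nat \<Rightarrow> (nat \<Rightarrow> 'r) topology"
    and F :: "nat \<Rightarrow> (nat \<Rightarrow> 'r) set \<Rightarrow> ((nat \<Rightarrow> 'r) \<Rightarrow> 'r) set" +
  assumes continuous: "\<lbrakk>openin (T k) A; openin (T l) B; f \<in> maps_between F k A l B; openin (T l) C\<rbrakk>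
      \<Longrightarrow> openin (T k) {x \<in> A. f x \<in> C}"
    and glue: "\<lbrakk>\<And>B. B \<in> \<B> \<Longrightarrow> openin (T k) B; \<And>B. B \<in> \<B> \<Longrightarrow> (\<lambda>x\<in>B. \<phi> x) \<in> F k B\<rbrakk>
      \<Longrightarrow> (\<lambda>x\<in>\<Union>\<B>. \<phi> x) \<in> F k (\<Union>\<B>)"
    and point: "\<exists>p. topspace (T 0) = {p}"
    and constant_map: "\<lbrakk>x \<in> topspace (T k); j < k\<rbrakk>
      \<Longrightarrow> (\<lambda>_\<in>topspace (T 0). x j) \<in> F 0 (topspace (T 0))"
begin

text \<open>
  A cover is pulled back along \<open>g\<close> to the preimages of its members; the arrow into the member \<open>B\<close>
  is the restriction of \<open>g\<close> to the preimage of \<open>B\<close>.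
\<close>

lemma site_open_set_site: "site (open_set_site T F)"
proof -
  let ?C = "open_set_site T F"
  interpret category ?C by (rule category_open_set_site)
  show ?thesis
  proof
    fix d S e f
    assume "d \<in> Obj ?C" "S \<in> Cov ?C d" "(e, f) \<in> S"
    then show "e \<in> Obj ?C \<and> f \<in> Hom ?C e d"
      by (cases d) (auto simp: open_set_site_simps intro!: inclusion_in_maps)
  next
    fix d S c g
    assume *: "d \<in> Obj ?C" "S \<in> Cov ?C d" "c \<in> Obj ?C" "g \<in> Hom ?C c d"
    obtain k A where d: "d = (k, A)" by force
    obtain l D where c: "c = (l, D)" by force
    obtain \<B> where \<B>: "\<forall>B\<in>\<B>. openin (T k) B" "\<Union>\<B> = A"
      and S: "S = (\<lambda>B. ((k, B), (\<lambda>x\<in>B. x))) ` \<B>"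
      using *(2) unfolding d open_set_site_simps by auto
    have A: "openin (T k) A" and D: "openin (T l) D" and g: "g \<in> maps_between F l D k A"
      using * by (auto simp: c d open_set_site_simps)
    define P where "P B = {x \<in> D. g x \<in> B}" for B
    have P: "openin (T l) (P B)" if "B \<in> \<B>" for B
      unfolding P_def using continuous[OF D A g] \<B>(1) that by auto
    have "\<Union>(P ` \<B>) = D"
      using g \<B>(2) by (auto simp: P_def maps_between_def)
    then have "(\<lambda>B. ((l, B), (\<lambda>x\<in>B. x))) ` P ` \<B> \<in> Cov ?C c"
      using P by (auto simp: c open_set_site_simps intro!: exI[of _ "P ` \<B>"])
    moreover have "\<exists>(e, f)\<in>S. \<exists>h\<in>Hom ?C (l, P B) e.
        Cmp ?C (l, P B) c d g (\<lambda>x\<in>P B. x) = Cmp ?C (l, P B) e d f h" if "B \<in> \<B>" for B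
    proof -
      have "restrict g (P B) \<in> maps_between F l (P B) k A"
        by (rule restrict_in_maps[OF D P[OF that] _ g]) (auto simp: P_def)
      then have "restrict g (P B) \<in> Hom ?C (l, P B) (k, B)"
        by (auto simp: open_set_site_simps maps_between_def P_def)
      moreover have "compose (P B) g (\<lambda>x\<in>P B. x) = compose (P B) (\<lambda>x\<in>B. x) (restrict g (P B))"
        by (auto simp: compose_def P_def)
      ultimately show ?thesis
        using that by (auto simp: S open_set_site_simps intro!: bexI[of _ B] bexI[of _ "restrict g (P B)"])
    qed
    ultimately show "\<exists>T\<in>Cov ?C c. \<forall>(b, h)\<in>T. \<exists>(e, f)\<in>S. \<exists>k\<in>Hom ?C b e.
        Cmp ?C b c d g h = Cmp ?C b e d f k"
      by (intro bexI[of _ "(\<lambda>B. ((l, B), (\<lambda>x\<in>B. x))) ` P ` \<B>"]) auto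
  qed
qed

text \<open>
  Maps into \<open>x\<close> on the members of an open cover that agree as arrows from the pairwise
  intersections are the restrictions of one function on the union, which is smooth by \<open>glue\<close>.
\<close>

lemma subcanonical_open_set_site: "subcanonical (open_set_site T F)"
  unfolding subcanonical_def is_sheaf_def
proof (intro ballI allI impI)
  let ?C = "open_set_site T F"
  fix x d S \<phi>
  assume x: "x \<in> Obj ?C" and d0: "d \<in> Obj ?C" and S0: "S \<in> Cov ?C d"
    and comp: "compatible_family ?C (\<lambda>d. Hom ?C d x) (\<lambda>e d f h. Cmp ?C e d x h f) d S \<phi>"
  obtain k A where d: "d = (k, A)" by force
  obtain l D where xx: "x = (l, D)" by force
  obtain \<B> where \<B>: "\<forall>B\<in>\<B>. openin (T k) B" "\<Union>\<B> = A"
    and S: "S = (\<lambda>B. ((k, B), (\<lambda>x\<in>B. x))) ` \<B>"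
    using S0 unfolding d open_set_site_simps by auto
  define \<psi> where "\<psi> B = \<phi> ((k, B), (\<lambda>x\<in>B. x))" for B
  have \<psi>: "\<psi> B \<in> maps_between F k B l D" if "B \<in> \<B>" for B
    using comp that unfolding compatible_family_def S \<psi>_def xx by (auto simp: open_set_site_simps)
  have agree: "\<psi> B y = \<psi> B' y" if "B \<in> \<B>" "B' \<in> \<B>" "y \<in> B" "y \<in> B'" for B B' y
  proof -
    let ?I = "B \<inter> B'"
    have I: "openin (T k) ?I" using \<B>(1) that by auto
    have comp': "\<And>e f e' f' c g g'. \<lbrakk>(e, f) \<in> S; (e', f') \<in> S; c \<in> Obj ?C; g \<in> Hom ?C c e;
        g' \<in> Hom ?C c e'; Cmp ?C c e d f g = Cmp ?C c e' d f' g'\<rbrakk>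
        \<Longrightarrow> Cmp ?C c e x (\<phi> (e, f)) g = Cmp ?C c e' x (\<phi> (e', f')) g'"
      using comp unfolding compatible_family_def by blast
    have "Cmp ?C (k, ?I) (k, B) x (\<psi> B) (\<lambda>x\<in>?I. x) = Cmp ?C (k, ?I) (k, B') x (\<psi> B') (\<lambda>x\<in>?I. x)"
      unfolding \<psi>_def
    proof (rule comp')
      show "(\<lambda>x\<in>?I. x) \<in> Hom ?C (k, ?I) (k, B)" "(\<lambda>x\<in>?I. x) \<in> Hom ?C (k, ?I) (k, B')"
        using I by (auto simp: open_set_site_simps intro: inclusion_in_maps)
    qed (use that I in \<open>auto simp: S open_set_site_simps compose_def restrict_def\<close>)
    then have "compose ?I (\<psi> B) (\<lambda>x\<in>?I. x) y = compose ?I (\<psi> B') (\<lambda>x\<in>?I. x) y"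
      by (simp add: open_set_site_simps)
    then show ?thesis using that by (simp add: compose_def)
  qed
  define s where "s = (\<lambda>y\<in>A. \<psi> (SOME B. B \<in> \<B> \<and> y \<in> B) y)"
  have s: "s y = \<psi> B y" if "B \<in> \<B>" "y \<in> B" for B y
  proof -
    have "y \<in> A" using that \<B>(2) by auto
    moreover have "(SOME B. B \<in> \<B> \<and> y \<in> B) \<in> \<B> \<and> y \<in> (SOME B. B \<in> \<B> \<and> y \<in> B)"
      by (rule someI[of _ B]) (use that in auto)
    ultimately show ?thesis using agree[OF _ that(1) _ that(2)] by (simp add: s_def)
  qed
  have "s \<in> A \<rightarrow>\<^sub>E D"
  proof (rule PiE_I)
    fix y assume "y \<in> A"
    then obtain B where B: "B \<in> \<B>" "y \<in> B" using \<B>(2) by blast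
    then show "s y \<in> D" using s[OF B] \<psi>[OF B(1)] by (auto simp: maps_between_def)
  qed (auto simp: s_def)
  moreover have "(\<lambda>y\<in>A. s y j) \<in> F k A" if "j < l" for j
  proof -
    have "(\<lambda>y\<in>\<Union>\<B>. s y j) \<in> F k (\<Union>\<B>)"
    proof (rule glue)
      fix B assume B: "B \<in> \<B>"
      have "(\<lambda>y\<in>B. s y j) = (\<lambda>y\<in>B. \<psi> B y j)" using s[OF B] by auto
      then show "(\<lambda>y\<in>B. s y j) \<in> F k B" using \<psi>[OF B] that by (auto simp: maps_between_def)
    qed (use \<B> in auto)
    then show ?thesis by (simp add: \<B>(2))
  qed
  ultimately have s_map: "s \<in> maps_between F k A l D" by (simp add: maps_between_def)
  have restr: "compose B s (\<lambda>x\<in>B. x) = \<psi> B" if "B \<in> \<B>" for B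
    using s[OF that] \<psi>[OF that] by (auto simp: compose_def fun_eq_iff maps_between_def PiE_iff extensional_def)
  show "\<exists>!s. s \<in> Hom ?C d x \<and> (\<forall>(e, f)\<in>S. Cmp ?C e d x s f = \<phi> (e, f))"
  proof (rule ex1I[of _ s])
    show "s \<in> Hom ?C d x \<and> (\<forall>(e, f)\<in>S. Cmp ?C e d x s f = \<phi> (e, f))"
      using s_map restr by (auto simp: d xx S open_set_site_simps \<psi>_def)
  next
    fix s' assume s': "s' \<in> Hom ?C d x \<and> (\<forall>(e, f)\<in>S. Cmp ?C e d x s' f = \<phi> (e, f))"
    then have ext: "s' \<in> extensional A"
      by (auto simp: d xx open_set_site_simps maps_between_def PiE_iff)
    have "s' y = s y" if y: "y \<in> A" for y
    proof -
      obtain B where B: "B \<in> \<B>" "y \<in> B" using y \<B>(2) by auto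
      have "compose B s' (\<lambda>x\<in>B. x) = \<psi> B"
        using s' B(1) by (auto simp: S open_set_site_simps \<psi>_def)
      then have "compose B s' (\<lambda>x\<in>B. x) y = compose B s (\<lambda>x\<in>B. x) y"
        using restr[OF B(1)] by simp
      then show ?thesis using B(2) by (simp add: compose_def)
    qed
    then show "s' = s"
      using ext by (auto simp: s_def extensional_def fun_eq_iff)
  qed
qed

text \<open>
  The one-point space is terminal, and each point \<open>x\<close> of an open set is the value of a constant
  arrow from it. Thus the functor of points is the underlying set, which determines maps and is
  exhausted by the members of a cover.
\<close>

theorem concrete_site_open_set_site: "concrete_site (open_set_site T F)"
proof -
  let ?C = "open_set_site T F"
  obtain p where p: "topspace (T 0) = {p}" using point by blast
  define t :: "nat \<times> (nat \<Rightarrow> 'r) set" where "t = (0, {p})"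
  have t: "t \<in> Obj ?C" unfolding t_def open_set_site_simps by (metis openin_topspace p)
  have "\<exists>!f. f \<in> Hom ?C a t" if "a \<in> Obj ?C" for a
  proof (cases a)
    case (Pair k A)
    show ?thesis
      unfolding Pair t_def open_set_site_simps maps_between_def
      by (rule ex1I[of _ "\<lambda>x\<in>A. p"]) (auto simp: PiE_iff extensional_def fun_eq_iff)
  qed
  then have terminal: "terminal_object ?C t" using t by (simp add: terminal_object_def)
  have const: "(\<lambda>y\<in>{p}. x) \<in> Hom ?C t (k, A)" if "openin (T k) A" "x \<in> A" for k A x
  proof -
    have "(\<lambda>y\<in>{p}. (\<lambda>y\<in>{p}. x) y j) \<in> F 0 {p}" if j: "j < k" for j
    proof -
      have "x \<in> topspace (T k)" using openin_subset[OF \<open>openin (T k) A\<close>] \<open>x \<in> A\<close> by auto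
      moreover have "(\<lambda>y\<in>{p}. (\<lambda>y\<in>{p}. x) y j) = (\<lambda>_\<in>{p}. x j)" by auto
      ultimately show ?thesis using constant_map j p by metis
    qed
    then show ?thesis using that by (auto simp: t_def open_set_site_simps maps_between_def)
  qed
  have "f = g" if "a \<in> Obj ?C" "b \<in> Obj ?C" "f \<in> Hom ?C a b" "g \<in> Hom ?C a b"
    and eq: "\<forall>q\<in>Hom ?C t a. Cmp ?C t a b f q = Cmp ?C t a b g q" for a b f g
  proof -
    obtain k A where a: "a = (k, A)" by force
    obtain l B where b: "b = (l, B)" by force
    have "f x = g x" if "x \<in> A" for x
    proof -
      have "Cmp ?C t a b f (\<lambda>y\<in>{p}. x) = Cmp ?C t a b g (\<lambda>y\<in>{p}. x)"
        using const that \<open>a \<in> Obj ?C\<close> eq by (auto simp: a open_set_site_simps)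
      then have "compose {p} f (\<lambda>y\<in>{p}. x) p = compose {p} g (\<lambda>y\<in>{p}. x) p"
        by (simp add: t_def open_set_site_simps)
      then show ?thesis by (simp add: compose_def)
    qed
    moreover have "f \<in> A \<rightarrow>\<^sub>E B" "g \<in> A \<rightarrow>\<^sub>E B"
      using that(3,4) by (simp_all add: a b open_set_site_simps maps_between_def)
    ultimately show ?thesis by (metis PiE_ext)
  qed
  moreover have "(\<Union>(e, f)\<in>S. Cmp ?C t e d f ` Hom ?C t e) = Hom ?C t d"
    if d_S: "d \<in> Obj ?C" "S \<in> Cov ?C d" for d S
  proof -
    interpret site ?C by (rule site_open_set_site)
    obtain k A where d: "d = (k, A)" by force
    obtain \<B> where \<B>: "\<forall>B\<in>\<B>. openin (T k) B" "\<Union>\<B> = A"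
      and S: "S = (\<lambda>B. ((k, B), (\<lambda>x\<in>B. x))) ` \<B>"
      using d_S(2) unfolding d open_set_site_simps by auto
    have "Cmp ?C t e d f q \<in> Hom ?C t d" if "(e, f) \<in> S" "q \<in> Hom ?C t e" for e f q
      using Cmp_in[OF t _ d_S(1) that(2)] Cov_arrows[OF d_S(1) d_S(2) that(1)]
      by blast
    moreover have "q \<in> (\<Union>(e, f)\<in>S. Cmp ?C t e d f ` Hom ?C t e)" if q: "q \<in> Hom ?C t d" for q
    proof -
      have qA: "q \<in> {p} \<rightarrow>\<^sub>E A" using q by (simp add: t_def d open_set_site_simps maps_between_def)
      then obtain B where B: "B \<in> \<B>" "q p \<in> B" using \<B>(2) by auto
      have "(\<lambda>y\<in>{p}. q p) \<in> Hom ?C t (k, B)" using const B \<B>(1) by blast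
      moreover have "q = Cmp ?C t (k, B) d (\<lambda>x\<in>B. x) (\<lambda>y\<in>{p}. q p)"
        unfolding t_def open_set_site_simps
        by (rule extensionalityI[of _ "{p}"]) (use qA B(2) in \<open>auto simp: PiE_iff compose_def\<close>)
      ultimately show ?thesis
        using B(1) unfolding S by auto
    qed
    ultimately show ?thesis by auto
  qed
  ultimately show ?thesis
    unfolding concrete_site_def
    using site_open_set_site subcanonical_open_set_site terminal by blast
qed

end

section \<open>Composite functors and transport of structure\<close>

lemma faithful_functor_compose:
  assumes "faithful_functor C D FO FA" "faithful_functor D E GO GA"
  shows "faithful_functor C E (GO \<circ> FO) (\<lambda>a b f. GA (FO a) (FO b) (FA a b f))"
proof -
  interpret F: category_functor C D FO FA using assms(1) by (simp add: faithful_functor_def)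
  interpret G: category_functor D E GO GA using assms(2) by (simp add: faithful_functor_def)
  have "category_functor C E (GO \<circ> FO) (\<lambda>a b f. GA (FO a) (FO b) (FA a b f))"
    by unfold_locales
      (auto simp: F.FO_in G.FO_in F.FA_in G.FA_in F.FA_Ident G.FA_Ident F.FA_Cmp G.FA_Cmp)
  moreover have "inj_on (\<lambda>f. GA (FO a) (FO b) (FA a b f)) (Hom C a b)"
    if "a \<in> Obj C" "b \<in> Obj C" for a b
  proof -
    have "inj_on (GA (FO a) (FO b)) (FA a b ` Hom C a b)"
      using assms(2) F.FO_in[OF that(1)] F.FO_in[OF that(2)] F.FA_in[OF that]
      unfolding faithful_functor_def by (meson image_subsetI inj_on_subset)
    with assms(1) that show ?thesis
      unfolding faithful_functor_def using comp_inj_on[of "FA a b" _ "GA (FO a) (FO b)"]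
      by (simp add: o_def)
  qed
  ultimately show ?thesis by (simp add: faithful_functor_def)
qed

lemma preserves_coverings_compose:
  assumes "category_functor C D FO FA" "preserves_coverings C D FO FA" "preserves_coverings D E GO GA"
  shows "preserves_coverings C E (GO \<circ> FO) (\<lambda>a b f. GA (FO a) (FO b) (FA a b f))"
  unfolding preserves_coverings_def
proof (intro ballI)
  interpret F: category_functor C D FO FA by fact
  fix d S assume dS: "d \<in> Obj C" "S \<in> Cov C d"
  let ?S = "(\<lambda>(e, f). (FO e, FA e d f)) ` S"
  have "?S \<in> Cov D (FO d)" using assms(2) dS by (auto simp: preserves_coverings_def)
  then have "(\<lambda>(e, f). (GO e, GA e (FO d) f)) ` ?S \<in> Cov E (GO (FO d))"
    using assms(3) F.FO_in[OF dS(1)] unfolding preserves_coverings_def by blast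
  then show "(\<lambda>(e, f). ((GO \<circ> FO) e, GA (FO e) (FO d) (FA e d f))) ` S \<in> Cov E ((GO \<circ> FO) d)"
    by (simp add: image_image case_prod_unfold)
qed

text \<open>
  Spaces over other numbers whose points, open sets and smooth functions all correspond to given
  ones under an injection \<open>e\<close> of the numbers. The map \<open>E k\<close> on \<open>k\<close>-tuples agrees with the
  coordinatewise action of \<open>e\<close> only below \<open>k\<close>, since tuples have default values elsewhere.
\<close>

locale smooth_spaces_transport = smooth_spaces T F
  for T :: "nat \<Rightarrow> (nat \<Rightarrow> 'r) topology"
    and F :: "nat \<Rightarrow> (nat \<Rightarrow> 'r) set \<Rightarrow> ((nat \<Rightarrow> 'r) \<Rightarrow> 'r) set" +
  fixes T' :: "nat \<Rightarrow> (nat \<Rightarrow> 's) topology"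
    and F' :: "nat \<Rightarrow> (nat \<Rightarrow> 's) set \<Rightarrow> ((nat \<Rightarrow> 's) \<Rightarrow> 's) set"
    and e :: "'r \<Rightarrow> 's"
    and E :: "nat \<Rightarrow> (nat \<Rightarrow> 'r) \<Rightarrow> (nat \<Rightarrow> 's)"
  assumes inj_e: "inj e"
    and E_nth: "\<lbrakk>x \<in> topspace (T k); i < k\<rbrakk> \<Longrightarrow> E k x i = e (x i)"
    and inj_E: "inj_on (E k) (topspace (T k))"
    and open_image: "openin (T' k) W \<longleftrightarrow> (\<exists>A. openin (T k) A \<and> W = E k ` A)"
    and smooth_image: "openin (T k) A \<Longrightarrow> \<psi> \<in> F' k (E k ` A) \<longleftrightarrow>
      \<psi> \<in> extensional (E k ` A) \<and> (\<exists>\<phi>\<in>F k A. \<forall>x\<in>A. \<psi> (E k x) = e (\<phi> x))"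
begin

lemma topspace_image: "topspace (T' k) = E k ` topspace (T k)"
proof
  have "openin (T' k) (E k ` topspace (T k))" using open_image by blast
  then show "E k ` topspace (T k) \<subseteq> topspace (T' k)" by (rule openin_subset)
  obtain A where "openin (T k) A" "topspace (T' k) = E k ` A"
    using open_image[of k "topspace (T' k)"] by auto
  then show "topspace (T' k) \<subseteq> E k ` topspace (T k)" using openin_subset by blast
qed

lemma E_eq_iff:
  "\<lbrakk>openin (T k) A; openin (T k) B; x \<in> A; y \<in> B\<rbrakk> \<Longrightarrow> E k x = E k y \<longleftrightarrow> x = y"
  using inj_E[of k] openin_subset[of "T k"] by (meson inj_on_eq_iff subsetD)

lemma E_mem_iff:
  "\<lbrakk>openin (T k) A; openin (T k) B; x \<in> A\<rbrakk> \<Longrightarrow> E k x \<in> E k ` B \<longleftrightarrow> x \<in> B"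
  using E_eq_iff by blast

lemma E_nth_open: "\<lbrakk>openin (T k) A; x \<in> A; i < k\<rbrakk> \<Longrightarrow> E k x i = e (x i)"
  using E_nth openin_subset by blast

text \<open>
  The maps between transported open sets are the conjugates by \<open>E\<close> of the original ones; this
  reduces every property of the transported spaces to the original spaces.
\<close>

lemma maps_between_transport:
  assumes A: "openin (T k) A" and B: "openin (T l) B"
  shows "f' \<in> maps_between F' k (E k ` A) l (E l ` B) \<longleftrightarrow>
    f' \<in> extensional (E k ` A) \<and>
    (\<exists>f\<in>maps_between F k A l B. \<forall>x\<in>A. f' (E k x) = E l (f x))"
proof
  assume f': "f' \<in> maps_between F' k (E k ` A) l (E l ` B)"
  have ext: "f' \<in> extensional (E k ` A)"
    using f' by (simp add: maps_between_def PiE_iff)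
  have "\<exists>y\<in>B. f' (E k x) = E l y" if "x \<in> A" for x
    using f' that by (auto simp: maps_between_def PiE_iff)
  then obtain f where f: "\<And>x. x \<in> A \<Longrightarrow> f x \<in> B" "\<And>x. x \<in> A \<Longrightarrow> f' (E k x) = E l (f x)"
    by metis
  have "(\<lambda>x\<in>A. restrict f A x j) \<in> F k A" if j: "j < l" for j
  proof -
    obtain \<phi> where \<phi>: "\<phi> \<in> F k A" "\<forall>x\<in>A. f' (E k x) j = e (\<phi> x)"
      using f' j smooth_image[OF A, of "\<lambda>x\<in>E k ` A. f' x j"] by (auto simp: maps_between_def)
    have "f x j = \<phi> x" if "x \<in> A" for x
      using f[OF that] \<phi>(2) that E_nth_open[OF B, of "f x" j] j injD[OF inj_e, of "f x j" "\<phi> x"] by auto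
    then have "(\<lambda>x\<in>A. restrict f A x j) = (\<lambda>x\<in>A. \<phi> x)" by auto
    with restrict_mem[OF A \<phi>(1)] show ?thesis by simp
  qed
  then have "restrict f A \<in> maps_between F k A l B"
    using f(1) by (auto simp: maps_between_def)
  with ext show "f' \<in> extensional (E k ` A) \<and>
      (\<exists>f\<in>maps_between F k A l B. \<forall>x\<in>A. f' (E k x) = E l (f x))"
    using f(2) by (auto intro!: bexI[of _ "restrict f A"])
next
  assume "f' \<in> extensional (E k ` A) \<and>
      (\<exists>f\<in>maps_between F k A l B. \<forall>x\<in>A. f' (E k x) = E l (f x))"
  then obtain f where f: "f' \<in> extensional (E k ` A)" "f \<in> maps_between F k A l B"
      "\<And>x. x \<in> A \<Longrightarrow> f' (E k x) = E l (f x)" by blast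
  have fB: "f x \<in> B" if "x \<in> A" for x using f(2) that by (auto simp: maps_between_def)
  have "(\<lambda>x\<in>E k ` A. f' x j) \<in> F' k (E k ` A)" if "j < l" for j
    unfolding smooth_image[OF A]
    using f(2,3) that fB E_nth_open[OF B]
    by (auto simp: maps_between_def intro!: bexI[of _ "\<lambda>x\<in>A. f x j"])
  then show "f' \<in> maps_between F' k (E k ` A) l (E l ` B)"
    using f(1,3) fB by (auto simp: maps_between_def PiE_iff)
qed

lemma smooth_spaces_image: "smooth_spaces T' F'"
proof
  fix k A' i assume "openin (T' k) A'" "i < k"
  then obtain A where A: "openin (T k) A" "A' = E k ` A" using open_image by blast
  show "(\<lambda>x\<in>A'. x i) \<in> F' k A'"
    unfolding A(2) smooth_image[OF A(1)]
    using coordinate[OF A(1) \<open>i < k\<close>] E_nth_open[OF A(1) _ \<open>i < k\<close>]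
    by (auto intro!: bexI[of _ "\<lambda>x\<in>A. x i"])
next
  fix k A' l B' f' \<psi>
  assume "openin (T' k) A'" "openin (T' l) B'" and f': "f' \<in> maps_between F' k A' l B'"
    and \<psi>: "\<psi> \<in> F' l B'"
  then obtain A B where A: "openin (T k) A" "A' = E k ` A" and B: "openin (T l) B" "B' = E l ` B"
    using open_image by metis
  obtain f where f: "f \<in> maps_between F k A l B" "\<forall>x\<in>A. f' (E k x) = E l (f x)"
    using f' maps_between_transport[OF A(1) B(1)] A(2) B(2) by blast
  obtain \<phi> where \<phi>: "\<phi> \<in> F l B" "\<forall>y\<in>B. \<psi> (E l y) = e (\<phi> y)"
    using \<psi> smooth_image[OF B(1)] B(2) by blast
  have "f x \<in> B" if "x \<in> A" for x using f(1) that by (auto simp: maps_between_def)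
  then show "(\<lambda>x\<in>A'. \<psi> (f' x)) \<in> F' k A'"
    unfolding A(2) smooth_image[OF A(1)]
    using pullback[OF A(1) B(1) f(1) \<phi>(1)] f(2) \<phi>(2)
    by (auto intro!: bexI[of _ "\<lambda>x\<in>A. \<phi> (f x)"])
next
  fix k A' l B' C' f'
  assume "openin (T' k) A'" "openin (T' l) B'" and f': "f' \<in> maps_between F' k A' l B'"
    and "openin (T' l) C'"
  then obtain A B C where A: "openin (T k) A" "A' = E k ` A" and B: "openin (T l) B" "B' = E l ` B"
    and C: "openin (T l) C" "C' = E l ` C"
    using open_image by metis
  obtain f where f: "f \<in> maps_between F k A l B" "\<forall>x\<in>A. f' (E k x) = E l (f x)"
    using f' maps_between_transport[OF A(1) B(1)] A(2) B(2) by blast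
  have "f' (E k x) \<in> C' \<longleftrightarrow> f x \<in> C" if "x \<in> A" for x
    using f that E_mem_iff[OF B(1) C(1)] by (auto simp: maps_between_def C(2))
  then have "{x \<in> A'. f' x \<in> C'} = E k ` {x \<in> A. f x \<in> C}"
    unfolding A(2) by blast
  with continuous[OF A(1) B(1) f(1) C(1)] show "openin (T' k) {x \<in> A'. f' x \<in> C'}"
    using open_image by blast
next
  fix \<B>' k \<psi>
  assume o: "\<And>B. B \<in> \<B>' \<Longrightarrow> openin (T' k) B" and s: "\<And>B. B \<in> \<B>' \<Longrightarrow> (\<lambda>x\<in>B. \<psi> x) \<in> F' k B"
  define \<B> where "\<B> = {B. openin (T k) B \<and> E k ` B \<in> \<B>'}"
  have \<B>': "\<B>' = (`) (E k) ` \<B>" using o unfolding open_image \<B>_def by blast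
  have union: "openin (T k) (\<Union>\<B>)" by (auto simp: \<B>_def)
  have image: "\<Union>\<B>' = E k ` \<Union>\<B>" unfolding \<B>' by auto
  define \<phi> where "\<phi> x = inv e (\<psi> (E k x))" for x
  have \<phi>: "(\<lambda>x\<in>B. \<phi> x) \<in> F k B \<and> (\<forall>x\<in>B. \<psi> (E k x) = e (\<phi> x))" if "B \<in> \<B>" for B
  proof -
    have B: "openin (T k) B" "E k ` B \<in> \<B>'" using that by (auto simp: \<B>_def)
    from s[OF B(2)] obtain \<theta> where \<theta>: "\<theta> \<in> F k B" "\<forall>x\<in>B. \<psi> (E k x) = e (\<theta> x)"
      unfolding smooth_image[OF B(1)] by auto
    have eq: "\<phi> x = \<theta> x" if "x \<in> B" for x using \<theta>(2) that inj_e by (simp add: \<phi>_def)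
    then have "restrict \<phi> B = restrict \<theta> B" by auto
    then show ?thesis using restrict_mem[OF B(1) \<theta>(1)] \<theta>(2) eq by simp
  qed
  have "(\<lambda>x\<in>\<Union>\<B>. \<phi> x) \<in> F k (\<Union>\<B>)"
    by (rule glue) (use \<phi> in \<open>auto simp: \<B>_def\<close>)
  then show "(\<lambda>x\<in>\<Union>\<B>'. \<psi> x) \<in> F' k (\<Union>\<B>')"
    unfolding image smooth_image[OF union] using \<phi>
    by (intro conjI bexI[of _ "\<lambda>x\<in>\<Union>\<B>. \<phi> x"]) auto
next
  obtain p where "topspace (T 0) = {p}" using point by blast
  then show "\<exists>p. topspace (T' 0) = {p}" by (simp add: topspace_image)
next
  fix k j and x' :: "nat \<Rightarrow> 's" assume x': "x' \<in> topspace (T' k)" and j: "j < k"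
  then obtain x where x: "x \<in> topspace (T k)" "x' = E k x" by (auto simp: topspace_image)
  show "(\<lambda>_\<in>topspace (T' 0). x' j) \<in> F' 0 (topspace (T' 0))"
    unfolding topspace_image smooth_image[OF openin_topspace]
    using constant_map[OF x(1) j] E_nth[OF x(1) j] x(2)
    by (auto intro!: bexI[of _ "\<lambda>_\<in>topspace (T 0). x j"])
qed

abbreviation transport_obj :: "nat \<times> (nat \<Rightarrow> 'r) set \<Rightarrow> nat \<times> (nat \<Rightarrow> 's) set" where
  "transport_obj \<equiv> \<lambda>(k, A). (k, E k ` A)"

definition transport_map where
  "transport_map = (\<lambda>(k, A) (l, B) f. (\<lambda>x\<in>E k ` A. E l (f (inv_into A (E k) x))))"

lemma transport_map_E:
  assumes "openin (T k) A" "x \<in> A"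
  shows "transport_map (k, A) (l, B) f (E k x) = E l (f x)"
proof -
  have "inj_on (E k) A" using assms(1) inj_E inj_on_subset openin_subset by blast
  then show ?thesis using assms(2) by (simp add: transport_map_def inv_into_f_f)
qed

lemma transport_map_eqI:
  assumes A: "openin (T k) A" and "g \<in> extensional (E k ` A)" "\<And>x. x \<in> A \<Longrightarrow> g (E k x) = E l (f x)"
  shows "transport_map (k, A) (l, B) f = g"
proof (rule extensionalityI[of _ "E k ` A"])
  show "transport_map (k, A) (l, B) f \<in> extensional (E k ` A)" by (simp add: transport_map_def)
qed (use assms transport_map_E[OF A] in auto)

lemma transport_functor:
  "faithful_functor (open_set_site T F) (open_set_site T' F') transport_obj transport_map"
proof -
  interpret T': smooth_spaces T' F' by (rule smooth_spaces_image)
  let ?C = "open_set_site T F" and ?D = "open_set_site T' F'"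
  interpret C: category ?C by (rule category_open_set_site)
  interpret D: category ?D by (rule T'.category_open_set_site)
  have "category_functor ?C ?D transport_obj transport_map"
  proof (unfold_locales, goal_cases)
    case (1 a)
    then show ?case by (cases a) (auto simp: open_set_site_simps open_image)
  next
    case (2 a b f)
    obtain k A where a: "a = (k, A)" by force
    obtain l B where b: "b = (l, B)" by force
    have A: "openin (T k) A" and B: "openin (T l) B" and f: "f \<in> maps_between F k A l B"
      using 2 by (auto simp: a b open_set_site_simps)
    show ?case
      unfolding a b using f transport_map_E[OF A]
      by (auto simp: open_set_site_simps maps_between_transport[OF A B] transport_map_def)
  next
    case (3 a)
    then show ?case
      by (cases a) (auto simp: open_set_site_simps intro!: transport_map_eqI)
  next
    case (4 a b c f g)
    obtain k A where a: "a = (k, A)" by force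
    obtain l B where b: "b = (l, B)" by force
    obtain m C where c: "c = (m, C)" by force
    have A: "openin (T k) A" and B: "openin (T l) B" and f: "f \<in> maps_between F k A l B"
      using 4 by (auto simp: a b open_set_site_simps)
    have "f x \<in> B" if "x \<in> A" for x using f that by (auto simp: maps_between_def)
    then show ?case
      unfolding a b c
      by (auto simp: open_set_site_simps compose_def transport_map_E[OF A] transport_map_E[OF B]
          intro!: transport_map_eqI[OF A])
  qed
  moreover have "inj_on (transport_map a b) (Hom ?C a b)" if "a \<in> Obj ?C" "b \<in> Obj ?C" for a b
  proof (rule inj_onI)
    fix f g assume f: "f \<in> Hom ?C a b" and g: "g \<in> Hom ?C a b"
      and eq: "transport_map a b f = transport_map a b g"
    obtain k A where a: "a = (k, A)" by force
    obtain l B where b: "b = (l, B)" by force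
    have A: "openin (T k) A" and B: "openin (T l) B"
      and f: "f \<in> A \<rightarrow>\<^sub>E B" and g: "g \<in> A \<rightarrow>\<^sub>E B"
      using that f g by (auto simp: a b open_set_site_simps maps_between_def)
    show "f = g"
    proof (rule PiE_ext[OF f g])
      fix x assume x: "x \<in> A"
      then have "E l (f x) = E l (g x)"
        using transport_map_E[OF A x] eq by (metis a b)
      then show "f x = g x" using E_eq_iff[OF B B] f g x by (auto simp: PiE_iff)
    qed
  qed
  ultimately show ?thesis by (simp add: faithful_functor_def)
qed

lemma transport_coverings:
  "preserves_coverings (open_set_site T F) (open_set_site T' F') transport_obj transport_map"
  unfolding preserves_coverings_def
proof (intro ballI)
  let ?C = "open_set_site T F" and ?D = "open_set_site T' F'"
  fix d S assume "d \<in> Obj ?C" "S \<in> Cov ?C d"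
  moreover obtain k A where d: "d = (k, A)" by force
  ultimately obtain \<B> where \<B>: "\<forall>B\<in>\<B>. openin (T k) B" "\<Union>\<B> = A"
    and S: "S = (\<lambda>B. ((k, B), (\<lambda>x\<in>B. x))) ` \<B>"
    by (auto simp: open_set_site_simps)
  have "transport_map (k, B) (k, A) (\<lambda>x\<in>B. x) = (\<lambda>x\<in>E k ` B. x)" if "B \<in> \<B>" for B
    by (rule transport_map_eqI) (use \<B>(1) that in auto)
  then have "(\<lambda>(e, f). (transport_obj e, transport_map e d f)) ` S =
      (\<lambda>B. ((k, B), (\<lambda>x\<in>B. x))) ` ((`) (E k) ` \<B>)"
    unfolding S d image_image by (intro image_cong) auto
  moreover have "\<forall>B\<in>(`) (E k) ` \<B>. openin (T' k) B" using \<B>(1) open_image by blast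
  moreover have "\<Union>((`) (E k) ` \<B>) = E k ` A" using \<B>(2) by auto
  ultimately show "(\<lambda>(e, f). (transport_obj e, transport_map e d f)) ` S \<in> Cov ?D (transport_obj d)"
    unfolding d open_set_site_simps case_prod_conv by blast
qed

end

section \<open>Differential calculus on open sets of Euclidean spaces\<close>

lemma openin_Euclidean_space_box:
  assumes "openin (Euclidean_space k) V" "a \<in> V"
  obtains e where "e > 0"
    "\<And>x. \<lbrakk>x \<in> topspace (Euclidean_space k); \<forall>i<k. \<bar>x i - a i\<bar> < e\<rbrakk> \<Longrightarrow> x \<in> V"
proof -
  obtain S where S: "openin (powertop_real UNIV) S" and V: "V = S \<inter> {x. \<forall>i\<ge>k. x i = 0}"
    using assms(1) unfolding Euclidean_space_def openin_subtopology by auto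
  with assms(2) have "a \<in> S" by auto
  then obtain U where U: "finite {i. U i \<noteq> UNIV}" "\<And>i. open (U i)" "a \<in> PiE UNIV U" "PiE UNIV U \<subseteq> S"
    using S unfolding openin_product_topology_alt by force
  have "\<exists>d>0. \<forall>u. \<bar>u - a i\<bar> < d \<longrightarrow> u \<in> U i" for i
    using U(2)[of i] U(3) unfolding open_dist dist_real_def by auto
  then obtain d where d: "\<And>i. d i > 0" "\<And>i u. \<bar>u - a i\<bar> < d i \<Longrightarrow> u \<in> U i"
    by metis
  define e where "e = Min (insert 1 (d ` {..<k}))"
  have "e > 0" unfolding e_def by (subst Min_gr_iff) (use d(1) in auto)
  moreover have "e \<le> d i" if "i < k" for i
    unfolding e_def by (rule Min_le) (use that in auto)
  moreover have "x \<in> V" if x: "x \<in> topspace (Euclidean_space k)" "\<forall>i<k. \<bar>x i - a i\<bar> < d i" for x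
  proof -
    have "x i \<in> U i" for i
    proof (cases "i < k")
      case False
      then have "x i = 0" "a i = 0"
        using x(1) assms(2) V by (auto simp: topspace_Euclidean_space)
      then show ?thesis using U(3) by (metis PiE_mem UNIV_I)
    qed (use x(2) d(2) in auto)
    then show ?thesis using U(4) V x(1) by (auto simp: topspace_Euclidean_space)
  qed
  ultimately show ?thesis
    using that by (meson order_less_le_trans)
qed

text \<open>
  Open sets of Euclidean spaces enter all later arguments through coordinatewise convergence along
  a filter. The filter is a neighbourhood filter in the differential calculus, and the ultrafilter
  for near-standard points.
\<close>

lemma eventually_in_open_Euclidean:
  assumes "openin (Euclidean_space k) V" "a \<in> V"
    and "\<And>i. i < k \<Longrightarrow> ((\<lambda>s. x s i) \<longlongrightarrow> a i) F"
    and "\<forall>\<^sub>F s in F. x s \<in> topspace (Euclidean_space k)"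
  shows "\<forall>\<^sub>F s in F. x s \<in> V"
proof -
  obtain e where e: "e > 0"
    "\<And>x. \<lbrakk>x \<in> topspace (Euclidean_space k); \<forall>i<k. \<bar>x i - a i\<bar> < e\<rbrakk> \<Longrightarrow> x \<in> V"
    using openin_Euclidean_space_box[OF assms(1,2)] by metis
  have "\<forall>\<^sub>F s in F. \<forall>i\<in>{..<k}. \<bar>x s i - a i\<bar> < e"
    using assms(3) e(1) by (intro eventually_ball_finite) (auto simp: tendsto_iff dist_real_def)
  with assms(4) show ?thesis
    by eventually_elim (use e(2) in auto)
qed

lemma tendsto_continuous_Euclidean:
  assumes V: "openin (Euclidean_space k) V" "a \<in> V"
    and g: "continuous_map (subtopology (Euclidean_space k) V) euclideanreal g"
    and lim: "\<And>i. i < k \<Longrightarrow> ((\<lambda>s. x s i) \<longlongrightarrow> a i) F"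
    and x: "\<forall>\<^sub>F s in F. x s \<in> topspace (Euclidean_space k)"
  shows "((\<lambda>s. g (x s)) \<longlongrightarrow> g a) F"
proof (rule topological_tendstoI)
  fix S assume S: "open S" "g a \<in> S"
  have "openin (subtopology (Euclidean_space k) V) {y \<in> V. g y \<in> S}"
    using openin_continuous_map_preimage[OF g, of S] S V openin_subset[OF V(1)]
    by (simp add: inf_absorb2)
  then have "openin (Euclidean_space k) {y \<in> V. g y \<in> S}"
    using V(1) openin_trans_full by blast
  then have "\<forall>\<^sub>F s in F. x s \<in> {y \<in> V. g y \<in> S}"
    by (rule eventually_in_open_Euclidean) (use V S lim x in auto)
  then show "\<forall>\<^sub>F s in F. g (x s) \<in> S"
    by (rule eventually_mono) auto
qed

lemma open_Euclidean_coordinate_line: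
  assumes "openin (Euclidean_space k) V" "x \<in> V" "i < k"
  shows "\<forall>\<^sub>F t in nhds (x i). x(i := t) \<in> V"
proof (rule eventually_in_open_Euclidean[OF assms(1,2)])
  show "((\<lambda>t. (x(i := t)) j) \<longlongrightarrow> x j) (nhds (x i))" for j
    by (cases "j = i") (auto simp: filterlim_ident)
  have "x \<in> topspace (Euclidean_space k)"
    using assms openin_subset by blast
  then show "\<forall>\<^sub>F t in nhds (x i). x(i := t) \<in> topspace (Euclidean_space k)"
    using assms(3) by (auto simp: topspace_Euclidean_space)
qed

lemma has_field_derivative_cong_eventually_nhds:
  fixes f g :: "real \<Rightarrow> real"
  assumes "\<forall>\<^sub>F t in nhds a. f t = g t" "(f has_field_derivative d) (at a)"
  shows "(g has_field_derivative d) (at a)"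
  using DERIV_cong_ev[OF refl assms(1) refl] assms(2) by simp

lemma smooth_on_continuous:
  "smooth_on k V g \<Longrightarrow> continuous_map (subtopology (Euclidean_space k) V) euclideanreal g"
  unfolding smooth_on_def by (metis empty_set empty_subsetI foldr_Nil id_apply)

lemma smooth_on_has_partial:
  assumes "smooth_on k V g" "x \<in> V" "i < k"
  shows "((\<lambda>t. g (x(i := t))) has_field_derivative partial i g x) (at (x i))"
proof -
  have "(\<lambda>t. g (x(i := t))) field_differentiable at (x i)"
    using assms unfolding smooth_on_def by (metis empty_set empty_subsetI foldr_Nil id_apply)
  then show ?thesis
    unfolding partial_def by (simp add: DERIV_deriv_iff_field_differentiable)
qed

lemma smooth_on_partial:
  assumes "smooth_on k V g" "i < k"
  shows "smooth_on k V (partial i g)"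
  unfolding smooth_on_def
proof (intro allI impI)
  fix js assume "set js \<subseteq> {..<k}"
  then have "set (js @ [i]) \<subseteq> {..<k}" using assms(2) by auto
  with assms(1) have "continuous_map (subtopology (Euclidean_space k) V) euclideanreal
        (foldr partial (js @ [i]) g) \<and>
      (\<forall>x\<in>V. \<forall>j<k. (\<lambda>t. foldr partial (js @ [i]) g (x(j := t))) field_differentiable at (x j))"
    unfolding smooth_on_def by blast
  then show "continuous_map (subtopology (Euclidean_space k) V) euclideanreal
        (foldr partial js (partial i g)) \<and>
      (\<forall>x\<in>V. \<forall>j<k. (\<lambda>t. foldr partial js (partial i g) (x(j := t))) field_differentiable at (x j))"
    by simp
qed

text \<open>
  Smoothness is established without computing iterated derivatives: it suffices that \<open>g\<close>
  belongs to a class of continuous functions that is closed under partial derivatives.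
\<close>

lemma smooth_on_coinduct:
  assumes V: "openin (Euclidean_space k) V" and g: "P g"
    and step: "\<And>h. P h \<Longrightarrow> continuous_map (subtopology (Euclidean_space k) V) euclideanreal h \<and>
      (\<forall>i<k. \<exists>h'. P h' \<and>
        (\<forall>x\<in>V. ((\<lambda>t. h (x(i := t))) has_field_derivative h' x) (at (x i))))"
  shows "smooth_on k V g"
proof -
  have transfer: "((\<lambda>t. G (x(i := t))) has_field_derivative d) (at (x i))"
    if "((\<lambda>t. h (x(i := t))) has_field_derivative d) (at (x i))" "\<forall>x\<in>V. G x = h x" "x \<in> V" "i < k"
    for G h :: "(nat \<Rightarrow> real) \<Rightarrow> real" and x i d
  proof -
    have "\<forall>\<^sub>F t in nhds (x i). h (x(i := t)) = G (x(i := t))"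
      using open_Euclidean_coordinate_line[OF V that(3,4)] by eventually_elim (use that(2) in auto)
    then show ?thesis
      by (rule has_field_derivative_cong_eventually_nhds) (rule that(1))
  qed
  have *: "\<exists>h. P h \<and> (\<forall>x\<in>V. foldr partial js g x = h x)" if "set js \<subseteq> {..<k}" for js
    using that
  proof (induction js)
    case Nil
    then show ?case using g by auto
  next
    case (Cons i js)
    then obtain h where h: "P h" "\<forall>x\<in>V. foldr partial js g x = h x" by auto
    with step Cons.prems obtain h' where h': "P h'"
        "\<forall>x\<in>V. ((\<lambda>t. h (x(i := t))) has_field_derivative h' x) (at (x i))"
      by (metis insert_subset lessThan_iff list.simps(15))
    have "\<forall>x\<in>V. foldr partial (i # js) g x = h' x"
      using transfer[OF _ h(2)] h'(2) Cons.prems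
      by (auto simp: partial_def intro!: DERIV_imp_deriv)
    with h'(1) show ?case by blast
  qed
  show ?thesis
    unfolding smooth_on_def
  proof (intro allI impI)
    fix js assume "set js \<subseteq> {..<k}"
    then obtain h where h: "P h" "\<forall>x\<in>V. foldr partial js g x = h x" using * by blast
    have "continuous_map (subtopology (Euclidean_space k) V) euclideanreal (foldr partial js g)"
      by (rule continuous_map_eq[of _ _ h]) (use step[OF h(1)] h(2) in auto)
    moreover have "(\<lambda>t. foldr partial js g (x(i := t))) field_differentiable at (x i)"
      if "x \<in> V" "i < k" for x i
      using transfer[OF _ h(2) that] step[OF h(1)] that unfolding field_differentiable_def by blast
    ultimately show "continuous_map (subtopology (Euclidean_space k) V) euclideanreal (foldr partial js g) \<and>
      (\<forall>x\<in>V. \<forall>i<k. (\<lambda>t. foldr partial js g (x(i := t))) field_differentiable at (x i))"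
      by blast
  qed
qed

lemma smooth_on_const:
  assumes "openin (Euclidean_space k) V"
  shows "smooth_on k V (\<lambda>_. c)"
  by (rule smooth_on_coinduct[where P = "\<lambda>h. \<exists>c. h = (\<lambda>_. c)", OF assms])
    (auto intro!: exI[of _ "\<lambda>_. 0"])

lemma continuous_map_Euclidean_coordinate:
  "continuous_map (subtopology (Euclidean_space k) V) euclideanreal (\<lambda>x. x j)"
  unfolding Euclidean_space_def subtopology_subtopology
  by (intro continuous_map_from_subtopology continuous_map_product_coordinates) auto

lemma smooth_on_coordinate:
  assumes "openin (Euclidean_space k) V"
  shows "smooth_on k V (\<lambda>x. x j)"
\<comment> \<open>The partial derivatives of a coordinate are constants, which are smooth already.\<close>
proof (rule smooth_on_coinduct[where P = "\<lambda>h. smooth_on k V h \<or> h = (\<lambda>x. x j)", OF assms])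
  fix h :: "(nat \<Rightarrow> real) \<Rightarrow> real"
  assume h: "smooth_on k V h \<or> h = (\<lambda>x. x j)"
  have "\<exists>h'. smooth_on k V h' \<and>
        (\<forall>x\<in>V. ((\<lambda>t. h (x(i := t))) has_field_derivative h' x) (at (x i)))" if "i < k" for i
    using h
  proof
    assume "smooth_on k V h"
    then show ?thesis using smooth_on_partial smooth_on_has_partial that by blast
  next
    assume h: "h = (\<lambda>x. x j)"
    have "((\<lambda>t. (x(i := t)) j) has_field_derivative (if i = j then 1 else 0)) (at (x i))" for x :: "nat \<Rightarrow> real"
      by (cases "i = j") (auto intro!: derivative_eq_intros)
    then show ?thesis
      unfolding h by (intro exI[of _ "\<lambda>_. if i = j then 1 else 0"]) (auto simp: smooth_on_const assms)
  qed
  then show "continuous_map (subtopology (Euclidean_space k) V) euclideanreal h \<and>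
      (\<forall>i<k. \<exists>h'. (smooth_on k V h' \<or> h' = (\<lambda>x. x j)) \<and>
        (\<forall>x\<in>V. ((\<lambda>t. h (x(i := t))) has_field_derivative h' x) (at (x i))))"
    using h smooth_on_continuous continuous_map_Euclidean_coordinate by metis
qed auto

lemma smooth_on_cong:
  assumes "openin (Euclidean_space k) V" "smooth_on k V g" "\<And>x. x \<in> V \<Longrightarrow> h x = g x"
  shows "smooth_on k V h"
proof (rule smooth_on_coinduct[where P = "\<lambda>h. \<exists>g. smooth_on k V g \<and> (\<forall>x\<in>V. h x = g x)", OF assms(1)])
  fix h :: "(nat \<Rightarrow> real) \<Rightarrow> real" assume "\<exists>g. smooth_on k V g \<and> (\<forall>x\<in>V. h x = g x)"
  then obtain g where g: "smooth_on k V g" "\<forall>x\<in>V. h x = g x" by blast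
  have "((\<lambda>t. h (x(i := t))) has_field_derivative partial i g x) (at (x i))" if "x \<in> V" "i < k" for x i
  proof -
    have "\<forall>\<^sub>F t in nhds (x i). g (x(i := t)) = h (x(i := t))"
      using open_Euclidean_coordinate_line[OF assms(1) that] by eventually_elim (use g(2) in auto)
    then show ?thesis
      by (rule has_field_derivative_cong_eventually_nhds) (rule smooth_on_has_partial[OF g(1) that])
  qed
  moreover have "continuous_map (subtopology (Euclidean_space k) V) euclideanreal h"
    by (rule continuous_map_eq[OF smooth_on_continuous[OF g(1)]]) (use g(2) in auto)
  ultimately show "continuous_map (subtopology (Euclidean_space k) V) euclideanreal h \<and>
      (\<forall>i<k. \<exists>h'. (\<exists>g. smooth_on k V g \<and> (\<forall>x\<in>V. h' x = g x)) \<and>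
        (\<forall>x\<in>V. ((\<lambda>t. h (x(i := t))) has_field_derivative h' x) (at (x i))))"
    using smooth_on_partial[OF g(1)] by metis
qed (use assms in auto)

lemma smooth_on_subset:
  assumes "smooth_on k V g" "W \<subseteq> V"
  shows "smooth_on k W g"
  using assms unfolding smooth_on_def
  by (meson continuous_map_from_subtopology_mono subsetD)

text \<open>The mean value theorem for the interval between \<open>p\<close> and \<open>q\<close>, in whichever order they lie.\<close>

lemma mvt_between:
  fixes \<phi> \<phi>' :: "real \<Rightarrow> real"
  assumes "\<And>u. \<bar>u - p\<bar> \<le> \<bar>q - p\<bar> \<Longrightarrow> (\<phi> has_field_derivative \<phi>' u) (at u)"
  shows "\<exists>u. \<bar>u - p\<bar> \<le> \<bar>q - p\<bar> \<and> \<phi> q - \<phi> p = \<phi>' u * (q - p)"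
proof -
  consider "p < q" | "q < p" | "p = q" by linarith
  then show ?thesis
  proof cases
    case 1
    then obtain u where "p < u" "u < q" "\<phi> q - \<phi> p = (q - p) * \<phi>' u"
      using MVT2[of p q \<phi> \<phi>'] assms by force
    then show ?thesis by (intro exI[of _ u]) auto
  next
    case 2
    then obtain u where "q < u" "u < p" "\<phi> p - \<phi> q = (p - q) * \<phi>' u"
      using MVT2[of q p \<phi> \<phi>'] assms by force
    then show ?thesis by (intro exI[of _ u]) (auto simp: algebra_simps)
  qed auto
qed

text \<open>
  The chain rule along a curve. The curve is moved from its starting point one coordinate at a
  time: \<open>z m s\<close> has the first \<open>m\<close> coordinates of \<open>c s\<close> and the others of \<open>c t\<close>. Each such move
  is governed by the one-dimensional mean value theorem, and continuity of the partial
  derivatives turns the intermediate values into the values at \<open>c t\<close>.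
\<close>

lemma chain_rule_curve:
  assumes V: "openin (Euclidean_space l) V" and g: "smooth_on l V g" and ct: "c t \<in> V"
    and c: "\<forall>\<^sub>F s in at t. c s \<in> topspace (Euclidean_space l)"
    and deriv: "\<And>j. j < l \<Longrightarrow> ((\<lambda>s. c s j) has_field_derivative d j) (at t)"
  shows "((\<lambda>s. g (c s)) has_field_derivative (\<Sum>j<l. partial j g (c t) * d j)) (at (t::real))"
proof -
  define z where "z = (\<lambda>m s j. if j < m then c s j else c t j)"
  have ct_top: "c t \<in> topspace (Euclidean_space l)"
    using V ct openin_subset by blast
  obtain e where e: "e > 0"
    "\<And>x. \<lbrakk>x \<in> topspace (Euclidean_space l); \<forall>i<l. \<bar>x i - c t i\<bar> < e\<rbrakk> \<Longrightarrow> x \<in> V"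
    using openin_Euclidean_space_box[OF V ct] by metis
  have lim: "((\<lambda>s. c s j) \<longlongrightarrow> c t j) (at t)" if "j < l" for j
    using DERIV_isCont[OF deriv[OF that]] by (simp add: isCont_def)
  have close: "\<forall>\<^sub>F s in at t. \<forall>j\<in>{..<l}. \<bar>c s j - c t j\<bar> < e"
    using lim e(1) by (intro eventually_ball_finite) (auto simp: tendsto_iff dist_real_def)
  have "((\<lambda>s. g (z m s)) has_field_derivative (\<Sum>j<m. partial j g (c t) * d j)) (at t)"
    if "m \<le> l" for m
    using that
  proof (induction m)
    case 0
    then show ?case by (simp add: z_def)
  next
    case (Suc m)
    have m: "m < l" using Suc.prems by auto
    have zt: "z m t = c t" for m by (auto simp: z_def)
    have "\<forall>\<^sub>F s in at t. \<exists>u. \<bar>u - c t m\<bar> \<le> \<bar>c s m - c t m\<bar> \<and>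
        g (z (Suc m) s) - g (z m s) = partial m g ((z m s)(m := u)) * (c s m - c t m)"
      using c close
    proof eventually_elim
      case (elim s)
      have inV: "(z m s)(m := u) \<in> V" if "\<bar>u - c t m\<bar> \<le> \<bar>c s m - c t m\<bar>" for u
      proof (rule e(2))
        show "(z m s)(m := u) \<in> topspace (Euclidean_space l)"
          using elim(1) ct_top m by (auto simp: topspace_Euclidean_space z_def)
        have "\<bar>u - c t m\<bar> < e" using that elim(2) m by (meson lessThan_iff order_le_less_trans)
        then show "\<forall>i<l. \<bar>((z m s)(m := u)) i - c t i\<bar> < e"
          using elim(2) e(1) by (auto simp: z_def)
      qed
      have "((\<lambda>u. g ((z m s)(m := u))) has_field_derivative partial m g ((z m s)(m := u))) (at u)"
        if "\<bar>u - c t m\<bar> \<le> \<bar>c s m - c t m\<bar>" for u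
        using smooth_on_has_partial[OF g inV[OF that] m] by simp
      then have "\<exists>u. \<bar>u - c t m\<bar> \<le> \<bar>c s m - c t m\<bar> \<and>
          g ((z m s)(m := c s m)) - g ((z m s)(m := c t m)) =
          partial m g ((z m s)(m := u)) * (c s m - c t m)"
        by (rule mvt_between)
      moreover have "(z m s)(m := c s m) = z (Suc m) s" "(z m s)(m := c t m) = z m s"
        by (auto simp: z_def less_Suc_eq)
      ultimately show ?case by simp
    qed
    then obtain u where u: "\<forall>\<^sub>F s in at t. \<bar>u s - c t m\<bar> \<le> \<bar>c s m - c t m\<bar> \<and>
        g (z (Suc m) s) - g (z m s) = partial m g ((z m s)(m := u s)) * (c s m - c t m)"
      unfolding eventually_ex by blast
    have "((\<lambda>s. \<bar>c s m - c t m\<bar>) \<longlongrightarrow> 0) (at t)"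
      using tendsto_rabs_zero[OF LIM_zero[OF lim[OF m]]] .
    then have "((\<lambda>s. u s - c t m) \<longlongrightarrow> 0) (at t)"
      by (rule Lim_null_comparison[rotated]) (use u in \<open>auto elim!: eventually_mono\<close>)
    then have lim_u: "(u \<longlongrightarrow> c t m) (at t)" by (rule LIM_zero_cancel)
    have lim_partial: "((\<lambda>s. partial m g ((z m s)(m := u s))) \<longlongrightarrow> partial m g (c t)) (at t)"
    proof (rule tendsto_continuous_Euclidean[OF V ct smooth_on_continuous[OF smooth_on_partial[OF g m]]])
      show "((\<lambda>s. ((z m s)(m := u s)) i) \<longlongrightarrow> c t i) (at t)" if "i < l" for i
        by (cases "i = m"; cases "i < m") (use lim_u lim[OF that] in \<open>auto simp: z_def\<close>)
      show "\<forall>\<^sub>F s in at t. (z m s)(m := u s) \<in> topspace (Euclidean_space l)"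
        using c by eventually_elim (use ct_top m in \<open>auto simp: topspace_Euclidean_space z_def\<close>)
    qed
    have "((\<lambda>s. (c s m - c t m) / (s - t)) \<longlongrightarrow> d m) (at t)"
      using deriv[OF m] by (simp add: has_field_derivative_iff)
    from tendsto_mult[OF lim_partial this]
    have "((\<lambda>s. ((g (z (Suc m) s) - g (z m s)) - (g (z (Suc m) t) - g (z m t))) / (s - t))
        \<longlongrightarrow> partial m g (c t) * d m) (at t)"
      by (rule Lim_transform_eventually) (use u in \<open>auto elim!: eventually_mono simp: zt\<close>)
    then have "((\<lambda>s. g (z (Suc m) s) - g (z m s)) has_field_derivative partial m g (c t) * d m) (at t)"
      by (simp add: has_field_derivative_iff)
    from DERIV_add[OF Suc.IH[OF less_imp_le[OF m]] this] show ?case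
      by simp
  qed
  from this[of l]
  have "((\<lambda>s. g (z l s)) has_field_derivative (\<Sum>j<l. partial j g (c t) * d j)) (at t)" by simp
  moreover have "\<forall>\<^sub>F s in nhds t. g (z l s) = g (c s)"
  proof -
    have "\<forall>\<^sub>F s in at t. g (z l s) = g (c s)"
      using c
    proof eventually_elim
      case (elim s)
      have "z l s = c s"
        using elim ct_top by (auto simp: topspace_Euclidean_space z_def fun_eq_iff)
      then show ?case by simp
    qed
    moreover have "g (z l t) = g (c t)" by (simp add: z_def)
    ultimately show ?thesis by (simp add: eventually_nhds_conv_at)
  qed
  ultimately show ?thesis
    by (metis has_field_derivative_cong_eventually_nhds)
qed

text \<open>
  The class of functions to which \<open>smooth_on_coinduct\<close> is applied for a composite: by the
  chain rule and the product rule, it is closed under partial derivatives.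
\<close>

inductive_set pullback_algebra ::
    "nat \<Rightarrow> (nat \<Rightarrow> real) set \<Rightarrow> nat \<Rightarrow> (nat \<Rightarrow> real) set \<Rightarrow> ((nat \<Rightarrow> real) \<Rightarrow> nat \<Rightarrow> real) \<Rightarrow>
      ((nat \<Rightarrow> real) \<Rightarrow> real) set"
  for k V l W G where
  smooth: "smooth_on k V v \<Longrightarrow> v \<in> pullback_algebra k V l W G"
| pullback: "smooth_on l W u \<Longrightarrow> (\<lambda>x. u (G x)) \<in> pullback_algebra k V l W G"
| add: "\<lbrakk>p \<in> pullback_algebra k V l W G; q \<in> pullback_algebra k V l W G\<rbrakk>
    \<Longrightarrow> (\<lambda>x. p x + q x) \<in> pullback_algebra k V l W G"
| mult: "\<lbrakk>p \<in> pullback_algebra k V l W G; q \<in> pullback_algebra k V l W G\<rbrakk>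
    \<Longrightarrow> (\<lambda>x. p x * q x) \<in> pullback_algebra k V l W G"

lemma pullback_algebra_sum:
  fixes m :: nat
  assumes "openin (Euclidean_space k) V" "\<And>j. j < m \<Longrightarrow> p j \<in> pullback_algebra k V l W G"
  shows "(\<lambda>x. \<Sum>j<m. p j x) \<in> pullback_algebra k V l W G"
  using assms(2)
proof (induction m)
  case 0
  then show ?case using assms(1) by (simp add: smooth_on_const pullback_algebra.smooth)
next
  case (Suc m)
  then show ?case using pullback_algebra.add[of "\<lambda>x. \<Sum>j<m. p j x" k V l W G "p m"] by simp
qed

lemma continuous_map_into_Euclidean:
  assumes V: "openin (Euclidean_space k) V"
    and G: "\<And>x. x \<in> V \<Longrightarrow> G x \<in> topspace (Euclidean_space l)"
    and cont: "\<And>j. j < l \<Longrightarrow>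
      continuous_map (subtopology (Euclidean_space k) V) euclideanreal (\<lambda>x. G x j)"
  shows "continuous_map (subtopology (Euclidean_space k) V) (Euclidean_space l) G"
proof (rule continuous_map_eq)
  show "continuous_map (subtopology (Euclidean_space k) V) (Euclidean_space l)
      (\<lambda>x j. if j < l then G x j else 0)"
    unfolding continuous_map_componentwise_Euclidean_space using cont by simp
qed (use G in \<open>force simp: topspace_Euclidean_space\<close>)

lemma smooth_on_compose:
  assumes V: "openin (Euclidean_space k) V" and W: "openin (Euclidean_space l) W"
    and G: "\<And>x. x \<in> V \<Longrightarrow> G x \<in> W" and comp: "\<And>j. j < l \<Longrightarrow> smooth_on k V (\<lambda>x. G x j)"
    and u: "smooth_on l W u"
  shows "smooth_on k V (\<lambda>x. u (G x))"
proof (rule smooth_on_coinduct[where P = "\<lambda>h. h \<in> pullback_algebra k V l W G", OF V])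
  show "(\<lambda>x. u (G x)) \<in> pullback_algebra k V l W G"
    by (rule pullback_algebra.pullback[OF u])
next
  fix h assume "h \<in> pullback_algebra k V l W G"
  then show "continuous_map (subtopology (Euclidean_space k) V) euclideanreal h \<and>
      (\<forall>i<k. \<exists>h'. h' \<in> pullback_algebra k V l W G \<and>
        (\<forall>x\<in>V. ((\<lambda>t. h (x(i := t))) has_field_derivative h' x) (at (x i))))"
  proof induction
    case (smooth v)
    then show ?case
      using smooth_on_continuous smooth_on_partial smooth_on_has_partial pullback_algebra.smooth
      by blast
  next
    case (pullback u)
    have contG: "continuous_map (subtopology (Euclidean_space k) V) (subtopology (Euclidean_space l) W) G"
      unfolding continuous_map_in_subtopology
      using G openin_subset[OF W] smooth_on_continuous[OF comp]
      by (auto intro!: continuous_map_into_Euclidean[OF V])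
    have "continuous_map (subtopology (Euclidean_space k) V) euclideanreal (\<lambda>x. u (G x))"
      using continuous_map_compose[OF contG smooth_on_continuous[OF pullback]] by (simp add: o_def)
    moreover have "(\<lambda>x. \<Sum>j<l. partial j u (G x) * partial i (\<lambda>x. G x j) x) \<in> pullback_algebra k V l W G"
      if "i < k" for i
      by (intro pullback_algebra_sum[OF V] pullback_algebra.mult
          pullback_algebra.pullback[of l W "partial _ u"] pullback_algebra.smooth
          smooth_on_partial comp pullback that)
    moreover have "((\<lambda>t. u (G (x(i := t)))) has_field_derivative
        (\<Sum>j<l. partial j u (G x) * partial i (\<lambda>x. G x j) x)) (at (x i))" if "x \<in> V" "i < k" for x i
    proof -
      have "\<forall>\<^sub>F t in at (x i). x(i := t) \<in> V"
        using open_Euclidean_coordinate_line[OF V that] by (simp add: eventually_nhds_conv_at)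
      then have "\<forall>\<^sub>F t in at (x i). G (x(i := t)) \<in> topspace (Euclidean_space l)"
        by eventually_elim (use G openin_subset[OF W] in blast)
      then show ?thesis
        using chain_rule_curve[OF W pullback, of "\<lambda>t. G (x(i := t))" "x i"]
          smooth_on_has_partial[OF comp that] G[OF that(1)] by simp
    qed
    ultimately show ?case by blast
  next
    case (add p q)
    show ?case
    proof (intro conjI allI impI)
      show "continuous_map (subtopology (Euclidean_space k) V) euclideanreal (\<lambda>x. p x + q x)"
        using add.IH by (intro continuous_intros) auto
      fix i assume "i < k"
      with add.IH obtain p' q' where "p' \<in> pullback_algebra k V l W G" "q' \<in> pullback_algebra k V l W G"
        and "\<forall>x\<in>V. ((\<lambda>t. p (x(i := t))) has_field_derivative p' x) (at (x i))"
        and "\<forall>x\<in>V. ((\<lambda>t. q (x(i := t))) has_field_derivative q' x) (at (x i))"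
        by meson
      then show "\<exists>h'. h' \<in> pullback_algebra k V l W G \<and>
          (\<forall>x\<in>V. ((\<lambda>t. p (x(i := t)) + q (x(i := t))) has_field_derivative h' x) (at (x i)))"
        by (intro exI[of _ "\<lambda>x. p' x + q' x"]) (auto intro!: pullback_algebra.add DERIV_add)
    qed
  next
    case (mult p q)
    show ?case
    proof (intro conjI allI impI)
      show "continuous_map (subtopology (Euclidean_space k) V) euclideanreal (\<lambda>x. p x * q x)"
        using mult.IH by (intro continuous_intros) auto
      fix i assume "i < k"
      with mult.IH obtain p' q' where "p' \<in> pullback_algebra k V l W G" "q' \<in> pullback_algebra k V l W G"
        and p': "\<forall>x\<in>V. ((\<lambda>t. p (x(i := t))) has_field_derivative p' x) (at (x i))"
        and q': "\<forall>x\<in>V. ((\<lambda>t. q (x(i := t))) has_field_derivative q' x) (at (x i))"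
        by meson
      then have "(\<lambda>x. p' x * q x + q' x * p x) \<in> pullback_algebra k V l W G"
        by (intro pullback_algebra.add pullback_algebra.mult mult.hyps)
      moreover have "((\<lambda>t. p (x(i := t)) * q (x(i := t))) has_field_derivative
          p' x * q x + q' x * p x) (at (x i))" if "x \<in> V" for x
        using DERIV_mult[OF p'[rule_format, OF that] q'[rule_format, OF that]] by simp
      ultimately show "\<exists>h'. h' \<in> pullback_algebra k V l W G \<and>
          (\<forall>x\<in>V. ((\<lambda>t. p (x(i := t)) * q (x(i := t))) has_field_derivative h' x) (at (x i)))"
        by (intro exI[of _ "\<lambda>x. p' x * q x + q' x * p x"]) auto
    qed
  qed
qed

section \<open>Points and open sets of hyperreal spaces\<close>

definition euclid_nets :: "nat \<Rightarrow> (nat \<Rightarrow> nat \<Rightarrow> real) set" where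
  "euclid_nets k = {z. \<forall>n. z n \<in> topspace (Euclidean_space k)}"

lemma zero_in_Euclidean_space: "(\<lambda>_. 0) \<in> topspace (Euclidean_space k)"
  by (simp add: topspace_Euclidean_space)

lemma partial_cong:
  assumes "openin (Euclidean_space k) V" "x \<in> V" "i < k" "\<And>z. z \<in> V \<Longrightarrow> g z = h z"
  shows "partial i g x = partial i h x"
  unfolding partial_def
  by (rule deriv_cong_ev) (use open_Euclidean_coordinate_line[OF assms(1-3)] assms(4) in
    \<open>auto elim!: eventually_mono\<close>)

lemma openin_preimage_smooth:
  assumes "openin (Euclidean_space k) V" "openin (Euclidean_space l) W"
    and "\<And>j. j < l \<Longrightarrow> smooth_on k V (\<lambda>x. G x j)"
    and "\<And>x. x \<in> V \<Longrightarrow> G x \<in> topspace (Euclidean_space l)"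
  shows "openin (Euclidean_space k) {x \<in> V. G x \<in> W}"
proof -
  have "continuous_map (subtopology (Euclidean_space k) V) (Euclidean_space l) G"
    using assms(3,4) smooth_on_continuous by (intro continuous_map_into_Euclidean[OF assms(1)]) auto
  then have "openin (subtopology (Euclidean_space k) V) {x \<in> V. G x \<in> W}"
    using openin_continuous_map_preimage[OF _ assms(2)] openin_subset[OF assms(1)]
    by (fastforce simp: inf_absorb2)
  then show ?thesis using assms(1) openin_trans_full by blast
qed

locale ultrapower =
  fixes \<U> :: "nat filter"
  assumes free: "free_ultrafilter \<U>"
begin

lemma ultrafilter_nonbot: "\<U> \<noteq> bot"
  and ultrafilter_cases: "eventually P \<U> \<or> eventually (\<lambda>n. \<not> P n) \<U>"
  and ultrafilter_avoids: "eventually (\<lambda>n. n \<noteq> m) \<U>"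
  using free by (auto simp: free_ultrafilter_def)

lemma eventually_const_ultrafilter [simp]: "(\<forall>\<^sub>F n in \<U>. P) \<longleftrightarrow> P"
  using ultrafilter_nonbot by (auto simp: eventually_const)

lemma equiv_ae_eq: "equiv UNIV (ae_eq \<U>)"
proof (rule equivI)
  show "sym (ae_eq \<U>)" by (auto simp: sym_def ae_eq_def elim: eventually_mono)
  show "trans (ae_eq \<U>)"
    unfolding trans_def ae_eq_def
    by (auto elim: eventually_elim2)
qed (auto simp: refl_on_def ae_eq_def)

lemma hclass_eq_iff: "hclass \<U> x = hclass \<U> y \<longleftrightarrow> (\<forall>\<^sub>F n in \<U>. x n = y n)"
  unfolding hclass_def using eq_equiv_class_iff[OF equiv_ae_eq, of x y] by (simp add: ae_eq_def)

lemma hyperreals_eq_range: "hyperreals \<U> = range (hclass \<U>)"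
  by (auto simp: hyperreals_def hclass_def quotient_def)

lemma mem_hclass_iff: "y \<in> hclass \<U> x \<longleftrightarrow> (\<forall>\<^sub>F n in \<U>. x n = y n)"
  by (auto simp: hclass_def ae_eq_def)

lemma hvec_nth: "i < k \<Longrightarrow> hvec \<U> k x i = hclass \<U> (\<lambda>n. x n i)"
  by (simp add: hvec_def)

lemma hvec_eq_iff: "hvec \<U> k x = hvec \<U> k y \<longleftrightarrow> (\<forall>\<^sub>F n in \<U>. \<forall>i<k. x n i = y n i)"
proof -
  have "hvec \<U> k x = hvec \<U> k y \<longleftrightarrow> (\<forall>i\<in>{..<k}. \<forall>\<^sub>F n in \<U>. x n i = y n i)"
    by (auto simp: hvec_def fun_eq_iff restrict_def hclass_eq_iff)
  also have "\<dots> \<longleftrightarrow> (\<forall>\<^sub>F n in \<U>. \<forall>i\<in>{..<k}. x n i = y n i)"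
    by (subst eventually_ball_finite_distrib) auto
  finally show ?thesis by (simp add: Ball_def)
qed

lemma hvec_eqI: "\<forall>\<^sub>F n in \<U>. x n = y n \<Longrightarrow> hvec \<U> k x = hvec \<U> k y"
  unfolding hvec_eq_iff by (auto elim: eventually_mono)

lemma hvec_eqD:
  assumes "hvec \<U> k x = hvec \<U> k y"
    and "\<forall>\<^sub>F n in \<U>. x n \<in> topspace (Euclidean_space k)"
    and "\<forall>\<^sub>F n in \<U>. y n \<in> topspace (Euclidean_space k)"
  shows "\<forall>\<^sub>F n in \<U>. x n = y n"
  using assms(1)[unfolded hvec_eq_iff] assms(2,3)
proof eventually_elim
  case (elim n)
  show ?case
  proof
    show "x n i = y n i" for i using elim by (cases "i < k") (auto simp: topspace_Euclidean_space)
  qed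
qed

lemma euclid_nets_eqD:
  "\<lbrakk>hvec \<U> k x = hvec \<U> k y; x \<in> euclid_nets k; y \<in> euclid_nets k\<rbrakk> \<Longrightarrow> \<forall>\<^sub>F n in \<U>. x n = y n"
  by (rule hvec_eqD) (auto simp: euclid_nets_def)

lemma ae_euclid_netE:
  assumes "\<forall>\<^sub>F n in \<U>. x n \<in> topspace (Euclidean_space k)"
  obtains z where "z \<in> euclid_nets k" "\<forall>\<^sub>F n in \<U>. z n = x n"
proof
  let ?z = "\<lambda>n. if x n \<in> topspace (Euclidean_space k) then x n else (\<lambda>_. 0)"
  show "?z \<in> euclid_nets k" by (auto simp: euclid_nets_def zero_in_Euclidean_space)
  show "\<forall>\<^sub>F n in \<U>. ?z n = x n" using assms by eventually_elim auto
qed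

lemma hvec_euclid_nets: "hvec \<U> k ` euclid_nets k = {..<k} \<rightarrow>\<^sub>E hyperreals \<U>"
proof (intro equalityI subsetI)
  fix x assume x: "x \<in> {..<k} \<rightarrow>\<^sub>E hyperreals \<U>"
  then have "\<forall>i<k. \<exists>a. x i = hclass \<U> a" by (auto simp: hyperreals_eq_range PiE_iff)
  then obtain a where a: "\<And>i. i < k \<Longrightarrow> x i = hclass \<U> (a i)" by metis
  define z where "z = (\<lambda>n i. if i < k then a i n else 0)"
  have "z \<in> euclid_nets k" by (auto simp: z_def euclid_nets_def topspace_Euclidean_space)
  moreover have "x = hvec \<U> k z"
    by (rule extensionalityI[of _ "{..<k}"]) (use x a in \<open>auto simp: hvec_def z_def PiE_iff\<close>)
  ultimately show "x \<in> hvec \<U> k ` euclid_nets k" by blast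
qed (auto simp: hvec_def hyperreals_eq_range)

text \<open>
  A box around the class of \<open>y\<close>, up to changes on a null set of indices.
\<close>

definition surrounds :: "nat \<Rightarrow> (nat \<Rightarrow> (nat \<Rightarrow> real) set) \<Rightarrow> (nat \<Rightarrow> nat \<Rightarrow> real) \<Rightarrow> bool" where
  "surrounds k V y \<longleftrightarrow> (\<forall>n. openin (Euclidean_space k) (V n)) \<and> (\<forall>\<^sub>F n in \<U>. y n \<in> V n)"

definition star_open :: "nat \<Rightarrow> (nat \<Rightarrow> hyp) set \<Rightarrow> bool" where
  "star_open k W \<longleftrightarrow> W \<subseteq> hvec \<U> k ` euclid_nets k \<and>
    (\<forall>y\<in>euclid_nets k. hvec \<U> k y \<in> W \<longrightarrow>
      (\<exists>V. surrounds k V y \<and>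
        (\<forall>z\<in>euclid_nets k. (\<forall>\<^sub>F n in \<U>. z n \<in> V n) \<longrightarrow> hvec \<U> k z \<in> W)))"

lemma star_openD:
  assumes "star_open k W" "y \<in> euclid_nets k" "hvec \<U> k y \<in> W"
  obtains V where "surrounds k V y"
    "\<And>z. \<lbrakk>z \<in> euclid_nets k; \<forall>\<^sub>F n in \<U>. z n \<in> V n\<rbrakk> \<Longrightarrow> hvec \<U> k z \<in> W"
  using assms unfolding star_open_def by meson

lemma star_open_point:
  assumes "star_open k W" "x \<in> W"
  obtains y where "y \<in> euclid_nets k" "x = hvec \<U> k y"
  using assms unfolding star_open_def by blast

text \<open>
  A box is given by conditions at all indices, but points are determined almost everywhere only.
  Replacing the members of a net at exceptional indices passes between the two readings.
\<close>

lemma nets_subset_euclid_nets: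
  "\<lbrakk>\<forall>n. openin (Euclidean_space k) (V n); y \<in> nets UNIV k V\<rbrakk> \<Longrightarrow> y \<in> euclid_nets k"
  using openin_subset by (fastforce simp: nets_def euclid_nets_def)

lemma nets_adjust:
  assumes "y \<in> nets UNIV k V" "\<forall>\<^sub>F n in \<U>. z n \<in> V n"
  obtains z' where "z' \<in> nets UNIV k V" "\<forall>\<^sub>F n in \<U>. z' n = z n" "hvec \<U> k z' = hvec \<U> k z"
proof
  let ?z = "\<lambda>n. if z n \<in> V n then z n else y n"
  show "?z \<in> nets UNIV k V" using assms(1) by (auto simp: nets_def)
  show eq: "\<forall>\<^sub>F n in \<U>. ?z n = z n" using assms(2) by eventually_elim auto
  show "hvec \<U> k ?z = hvec \<U> k z" by (rule hvec_eqI[OF eq])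
qed

text \<open>
  The members of \<open>V\<close> at the exceptional indices, which do not contain \<open>y n\<close>, are replaced by the
  whole space, so that \<open>y\<close> becomes a net in the box at every index.
\<close>

definition enlarge ::
  "nat \<Rightarrow> (nat \<Rightarrow> (nat \<Rightarrow> real) set) \<Rightarrow> (nat \<Rightarrow> nat \<Rightarrow> real) \<Rightarrow> nat \<Rightarrow> (nat \<Rightarrow> real) set" where
  "enlarge k V y n = (if y n \<in> V n then V n else topspace (Euclidean_space k))"

lemma enlarge:
  assumes "surrounds k V y" "y \<in> euclid_nets k"
  shows "\<forall>n. openin (Euclidean_space k) (enlarge k V y n)" "y \<in> nets UNIV k (enlarge k V y)"
    "z \<in> nets UNIV k (enlarge k V y) \<Longrightarrow> z \<in> euclid_nets k \<and> (\<forall>\<^sub>F n in \<U>. z n \<in> V n)"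
proof -
  show o: "\<forall>n. openin (Euclidean_space k) (enlarge k V y n)"
    using assms(1) by (auto simp: enlarge_def surrounds_def)
  show "y \<in> nets UNIV k (enlarge k V y)"
    using assms(2) by (auto simp: enlarge_def nets_def euclid_nets_def)
  assume z: "z \<in> nets UNIV k (enlarge k V y)"
  have "\<forall>\<^sub>F n in \<U>. y n \<in> V n" using assms(1) by (simp add: surrounds_def)
  then have "\<forall>\<^sub>F n in \<U>. z n \<in> V n"
    by eventually_elim (use z in \<open>auto simp: nets_def enlarge_def split: if_splits\<close>)
  then show "z \<in> euclid_nets k \<and> (\<forall>\<^sub>F n in \<U>. z n \<in> V n)"
    using nets_subset_euclid_nets[OF o z] by simp
qed

text \<open>
  The topology generated by boxes, described almost everywhere. In this form, intersections of open
  sets cause no difficulty with indices at which \<open>V n \<inter> V' n\<close> is empty.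
\<close>

lemma union_of_boxes_iff_star_open:
  "(arbitrary union_of (\<lambda>B. \<exists>V. (\<forall>n. openin (Euclidean_space k) (V n)) \<and> B = hbox \<U> UNIV k V)) W
    \<longleftrightarrow> star_open k W"
proof -
  have "star_open k W"
    if W: "\<forall>x\<in>W. \<exists>B. (\<exists>V. (\<forall>n. openin (Euclidean_space k) (V n)) \<and> B = hbox \<U> UNIV k V) \<and> x \<in> B \<and> B \<subseteq> W"
    unfolding star_open_def
  proof (intro conjI ballI impI subsetI)
    fix x assume "x \<in> W"
    then obtain V where "\<forall>n. openin (Euclidean_space k) (V n)" "x \<in> hbox \<U> UNIV k V"
      using W by blast
    then show "x \<in> hvec \<U> k ` euclid_nets k"
      using nets_subset_euclid_nets unfolding hbox_def by blast
  next
    fix y assume y: "y \<in> euclid_nets k" "hvec \<U> k y \<in> W"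
    then obtain V where V: "\<forall>n. openin (Euclidean_space k) (V n)" "hvec \<U> k y \<in> hbox \<U> UNIV k V"
        "hbox \<U> UNIV k V \<subseteq> W"
      using W by blast
    then obtain y0 where y0: "y0 \<in> nets UNIV k V" "hvec \<U> k y = hvec \<U> k y0"
      unfolding hbox_def by blast
    have "\<forall>\<^sub>F n in \<U>. y n = y0 n"
      using euclid_nets_eqD[OF y0(2) y(1)] nets_subset_euclid_nets[OF V(1) y0(1)] by blast
    then have "\<forall>\<^sub>F n in \<U>. y n \<in> V n"
      by eventually_elim (use y0(1) in \<open>auto simp: nets_def\<close>)
    moreover have "hvec \<U> k z \<in> W" if "\<forall>\<^sub>F n in \<U>. z n \<in> V n" for z
      using nets_adjust[OF y0(1) that] V(3) unfolding hbox_def by (metis image_eqI subsetD)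
    ultimately show "\<exists>V. surrounds k V y \<and>
        (\<forall>z\<in>euclid_nets k. (\<forall>\<^sub>F n in \<U>. z n \<in> V n) \<longrightarrow> hvec \<U> k z \<in> W)"
      using V(1) by (intro exI[of _ V]) (auto simp: surrounds_def)
  qed
  moreover have "\<exists>B. (\<exists>V. (\<forall>n. openin (Euclidean_space k) (V n)) \<and> B = hbox \<U> UNIV k V) \<and> x \<in> B \<and> B \<subseteq> W"
    if W: "star_open k W" and x: "x \<in> W" for x
  proof -
    obtain y where y: "y \<in> euclid_nets k" "x = hvec \<U> k y" using star_open_point[OF W x] .
    then obtain V where V: "surrounds k V y"
        "\<And>z. \<lbrakk>z \<in> euclid_nets k; \<forall>\<^sub>F n in \<U>. z n \<in> V n\<rbrakk> \<Longrightarrow> hvec \<U> k z \<in> W"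
      using star_openD[OF W y(1)] x y(2) by metis
    show ?thesis
      using enlarge[OF V(1) y(1)] V(2) unfolding y(2) hbox_def
      by (intro exI[of _ "hvec \<U> k ` nets UNIV k (enlarge k V y)"] conjI
          exI[of _ "enlarge k V y"]) auto
  qed
  ultimately show ?thesis
    unfolding arbitrary_union_of_alt by blast
qed

lemma surrounds_Int:
  "\<lbrakk>surrounds k V y; surrounds k V' y\<rbrakk> \<Longrightarrow> surrounds k (\<lambda>n. V n \<inter> V' n) y"
  unfolding surrounds_def by (auto intro: eventually_conj)

lemma istopology_star_open: "istopology (star_open k)"
  unfolding istopology_def
proof (intro conjI allI impI)
  fix S T assume S: "star_open k S" and T: "star_open k T"
  show "star_open k (S \<inter> T)"
    unfolding star_open_def
  proof (intro conjI ballI impI)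
    show "S \<inter> T \<subseteq> hvec \<U> k ` euclid_nets k" using S by (auto simp: star_open_def)
    fix y assume y: "y \<in> euclid_nets k" "hvec \<U> k y \<in> S \<inter> T"
    then have yS: "hvec \<U> k y \<in> S" and yT: "hvec \<U> k y \<in> T" by auto
    obtain V where V: "surrounds k V y"
        "\<And>z. \<lbrakk>z \<in> euclid_nets k; \<forall>\<^sub>F n in \<U>. z n \<in> V n\<rbrakk> \<Longrightarrow> hvec \<U> k z \<in> S"
      by (rule star_openD[OF S y(1) yS]) blast
    obtain V' where V': "surrounds k V' y"
        "\<And>z. \<lbrakk>z \<in> euclid_nets k; \<forall>\<^sub>F n in \<U>. z n \<in> V' n\<rbrakk> \<Longrightarrow> hvec \<U> k z \<in> T"
      by (rule star_openD[OF T y(1) yT]) blast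
    show "\<exists>V. surrounds k V y \<and>
        (\<forall>z\<in>euclid_nets k. (\<forall>\<^sub>F n in \<U>. z n \<in> V n) \<longrightarrow> hvec \<U> k z \<in> S \<inter> T)"
      using surrounds_Int[OF V(1) V'(1)] V(2) V'(2)
      by (intro exI[of _ "\<lambda>n. V n \<inter> V' n"]) (auto simp: eventually_conj_iff)
  qed
next
  fix K assume K: "\<forall>S\<in>K. star_open k S"
  show "star_open k (\<Union>K)"
    unfolding star_open_def
  proof (intro conjI ballI impI)
    show "\<Union>K \<subseteq> hvec \<U> k ` euclid_nets k" using K unfolding star_open_def by blast
    fix y assume y: "y \<in> euclid_nets k" "hvec \<U> k y \<in> \<Union>K"
    then obtain S where "S \<in> K" "hvec \<U> k y \<in> S" by blast
    then show "\<exists>V. surrounds k V y \<and>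
        (\<forall>z\<in>euclid_nets k. (\<forall>\<^sub>F n in \<U>. z n \<in> V n) \<longrightarrow> hvec \<U> k z \<in> \<Union>K)"
      using K star_openD[of k S y] y(1) by (metis UnionI)
  qed
qed

lemma openin_star_topology: "openin (star_topology \<U> k) = star_open k"
proof -
  have "star_topology \<U> k = topology (star_open k)"
    unfolding star_topology_def using union_of_boxes_iff_star_open[of k] by presburger
  then show ?thesis by (simp add: topology_inverse' istopology_star_open)
qed

lemma star_open_whole: "star_open k (hvec \<U> k ` euclid_nets k)"
  unfolding star_open_def
proof (intro conjI ballI impI)
  fix y assume "y \<in> euclid_nets k"
  then show "\<exists>V. surrounds k V y \<and>
      (\<forall>z\<in>euclid_nets k. (\<forall>\<^sub>F n in \<U>. z n \<in> V n) \<longrightarrow> hvec \<U> k z \<in> hvec \<U> k ` euclid_nets k)"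
    by (intro exI[of _ "\<lambda>_. topspace (Euclidean_space k)"])
      (auto simp: surrounds_def euclid_nets_def)
qed auto

lemma topspace_star: "topspace (star_topology \<U> k) = {..<k} \<rightarrow>\<^sub>E hyperreals \<U>"
proof -
  have "topspace (star_topology \<U> k) = hvec \<U> k ` euclid_nets k"
  proof
    show "topspace (star_topology \<U> k) \<subseteq> hvec \<U> k ` euclid_nets k"
      using openin_topspace[of "star_topology \<U> k"] by (auto simp: openin_star_topology star_open_def)
    show "hvec \<U> k ` euclid_nets k \<subseteq> topspace (star_topology \<U> k)"
      by (rule openin_subset) (simp add: openin_star_topology star_open_whole)
  qed
  then show ?thesis by (simp add: hvec_euclid_nets)
qed

section \<open>Smooth functions on hyperreal spaces\<close>

text \<open>
  The relation \<open>local_rep\<close> with membership in the box required almost everywhere only, and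
  without the openness of \<open>V\<close>, which \<open>surrounds\<close> provides.
\<close>

definition star_rep where
  "star_rep k W f V g \<longleftrightarrow> (\<forall>n. smooth_on k (V n) (g n)) \<and>
    (\<forall>z\<in>euclid_nets k. (\<forall>\<^sub>F n in \<U>. z n \<in> V n) \<longrightarrow>
      hvec \<U> k z \<in> W \<and> f (hvec \<U> k z) = hclass \<U> (\<lambda>n. g n (z n)))"

lemma star_repD:
  assumes "star_rep k W f V g"
  shows "smooth_on k (V n) (g n)"
    and "\<lbrakk>z \<in> euclid_nets k; \<forall>\<^sub>F n in \<U>. z n \<in> V n\<rbrakk> \<Longrightarrow> hvec \<U> k z \<in> W"
    and "\<lbrakk>z \<in> euclid_nets k; \<forall>\<^sub>F n in \<U>. z n \<in> V n\<rbrakk> \<Longrightarrow> f (hvec \<U> k z) = hclass \<U> (\<lambda>n. g n (z n))"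
  using assms unfolding star_rep_def by auto

lemma local_rep_imp_star_rep:
  assumes rep: "local_rep \<U> UNIV k W f V g" and y: "y \<in> nets UNIV k V"
  shows "star_rep k W f V g"
  unfolding star_rep_def
proof (intro conjI ballI impI allI)
  show "smooth_on k (V n) (g n)" for n using rep by (simp add: local_rep_def)
  fix z assume "\<forall>\<^sub>F n in \<U>. z n \<in> V n"
  then obtain z' where z': "z' \<in> nets UNIV k V" "\<forall>\<^sub>F n in \<U>. z' n = z n" "hvec \<U> k z' = hvec \<U> k z"
    using nets_adjust[OF y] by blast
  show "hvec \<U> k z \<in> W" using rep z' unfolding local_rep_def hbox_def by (metis image_eqI subsetD)
  have "f (hvec \<U> k z) = hclass \<U> (\<lambda>n. g n (z' n))" using rep z' unfolding local_rep_def by metis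
  also have "\<dots> = hclass \<U> (\<lambda>n. g n (z n))"
    unfolding hclass_eq_iff using z'(2) by eventually_elim simp
  finally show "f (hvec \<U> k z) = hclass \<U> (\<lambda>n. g n (z n))" .
qed

lemma star_rep_imp_local_rep:
  assumes V: "surrounds k V y" and y: "y \<in> euclid_nets k" and rep: "star_rep k W f V g"
  shows "local_rep \<U> UNIV k W f (enlarge k V y) (\<lambda>n. if y n \<in> V n then g n else (\<lambda>_. 0))"
  unfolding local_rep_def
proof (intro conjI allI ballI)
  show "openin (Euclidean_space k) (enlarge k V y n)" for n using enlarge(1)[OF V y] by blast
  show "hbox \<U> UNIV k (enlarge k V y) \<subseteq> W"
    using enlarge(3)[OF V y] star_repD(2)[OF rep] by (auto simp: hbox_def)
  show "smooth_on k (enlarge k V y n) (if y n \<in> V n then g n else (\<lambda>_. 0))" for n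
    using star_repD(1)[OF rep] by (simp add: enlarge_def smooth_on_const)
  fix z assume "z \<in> nets UNIV k (enlarge k V y)"
  then have "f (hvec \<U> k z) = hclass \<U> (\<lambda>n. g n (z n))"
    using enlarge(3)[OF V y] star_repD(3)[OF rep] by auto
  also have "\<dots> = hclass \<U> (\<lambda>n. (if y n \<in> V n then g n else (\<lambda>_. 0)) (z n))"
    unfolding hclass_eq_iff using V unfolding surrounds_def by (auto elim: eventually_mono)
  finally show "f (hvec \<U> k z) = hclass \<U> (\<lambda>n. (if y n \<in> V n then g n else (\<lambda>_. 0)) (z n))" .
qed

lemma star_smooth_iff:
  assumes W: "star_open k W"
  shows "f \<in> star_smooth \<U> k W \<longleftrightarrow> f \<in> extensional W \<and>
    (\<forall>y\<in>euclid_nets k. hvec \<U> k y \<in> W \<longrightarrow> (\<exists>V g. surrounds k V y \<and> star_rep k W f V g))"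
proof
  assume f: "f \<in> star_smooth \<U> k W"
  have "\<exists>V g. surrounds k V y \<and> star_rep k W f V g" if y: "y \<in> euclid_nets k" "hvec \<U> k y \<in> W" for y
  proof -
    obtain V g where V: "hvec \<U> k y \<in> hbox \<U> UNIV k V" and rep: "local_rep \<U> UNIV k W f V g"
      using f y(2) unfolding star_smooth_def hsmooth_def by blast
    obtain y0 where y0: "y0 \<in> nets UNIV k V" "hvec \<U> k y = hvec \<U> k y0"
      using V unfolding hbox_def by blast
    have o: "\<forall>n. openin (Euclidean_space k) (V n)" using rep by (simp add: local_rep_def)
    have "\<forall>\<^sub>F n in \<U>. y n = y0 n"
      using euclid_nets_eqD[OF y0(2) y(1)] nets_subset_euclid_nets[OF o y0(1)] by blast
    then have "\<forall>\<^sub>F n in \<U>. y n \<in> V n"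
      by eventually_elim (use y0(1) in \<open>auto simp: nets_def\<close>)
    then show ?thesis
      using local_rep_imp_star_rep[OF rep y0(1)] o by (auto simp: surrounds_def)
  qed
  then show "f \<in> extensional W \<and>
    (\<forall>y\<in>euclid_nets k. hvec \<U> k y \<in> W \<longrightarrow> (\<exists>V g. surrounds k V y \<and> star_rep k W f V g))"
    using f by (auto simp: star_smooth_def hsmooth_def PiE_iff)
next
  assume f: "f \<in> extensional W \<and>
    (\<forall>y\<in>euclid_nets k. hvec \<U> k y \<in> W \<longrightarrow> (\<exists>V g. surrounds k V y \<and> star_rep k W f V g))"
  have local: "f x \<in> hyperreals \<U> \<and> (\<exists>V g. x \<in> hbox \<U> UNIV k V \<and> local_rep \<U> UNIV k W f V g)"
    if x: "x \<in> W" for x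
  proof -
    obtain y where y: "y \<in> euclid_nets k" "x = hvec \<U> k y" using star_open_point[OF W x] .
    then obtain V g where V: "surrounds k V y" and rep: "star_rep k W f V g" using f x by blast
    have "x \<in> hbox \<U> UNIV k (enlarge k V y)"
      using enlarge(2)[OF V y(1)] unfolding y(2) hbox_def by blast
    moreover have "f x = hclass \<U> (\<lambda>n. g n (y n))"
      unfolding y(2) using star_repD(3)[OF rep y(1)] V by (simp add: surrounds_def)
    ultimately show ?thesis
      using star_rep_imp_local_rep[OF V y(1) rep] by (auto simp: hyperreals_eq_range)
  qed
  then show "f \<in> star_smooth \<U> k W"
    using f by (auto simp: star_smooth_def hsmooth_def PiE_iff)
qed

text \<open>
  The finitely many components of a map have a common neighbourhood on which all of them are given
  by nets of functions, so that the map itself is given by a net of maps \<open>G n\<close>.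
\<close>

lemma star_map_rep:
  assumes A: "star_open k A" and B: "star_open l B"
    and f: "f \<in> maps_between (star_smooth \<U>) k A l B"
    and y: "y \<in> euclid_nets k" "hvec \<U> k y \<in> A"
  obtains V G where "surrounds k V y" "\<And>n j. j < l \<Longrightarrow> smooth_on k (V n) (\<lambda>x. G n x j)"
    "\<And>n x. G n x \<in> topspace (Euclidean_space l)"
    "\<And>z. \<lbrakk>z \<in> euclid_nets k; \<forall>\<^sub>F n in \<U>. z n \<in> V n\<rbrakk>
      \<Longrightarrow> hvec \<U> k z \<in> A \<and> f (hvec \<U> k z) = hvec \<U> l (\<lambda>n. G n (z n))"
proof -
  obtain V0 where V0: "surrounds k V0 y"
      "\<And>z. \<lbrakk>z \<in> euclid_nets k; \<forall>\<^sub>F n in \<U>. z n \<in> V0 n\<rbrakk> \<Longrightarrow> hvec \<U> k z \<in> A"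
    using star_openD[OF A y] by metis
  have "\<exists>V g. surrounds k V y \<and> star_rep k A (\<lambda>x\<in>A. f x j) V g" if "j < l" for j
    using f that y unfolding maps_between_def by (auto simp: star_smooth_iff[OF A])
  then obtain V1 g where V1: "\<And>j. j < l \<Longrightarrow> surrounds k (V1 j) y"
      "\<And>j. j < l \<Longrightarrow> star_rep k A (\<lambda>x\<in>A. f x j) (V1 j) (g j)"
    by metis
  \<comment> \<open>The index \<open>l\<close> makes the intersection nonempty when \<open>l = 0\<close>.\<close>
  define V2 where "V2 j = (if j < l then V1 j else V0)" for j
  define V where "V n = (\<Inter>j\<in>{..l}. V2 j n)" for n
  define G where "G n x j = (if j < l then g j n x else 0)" for n x j
  have V2: "surrounds k (V2 j) y" for j using V0(1) V1(1) by (simp add: V2_def)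
  have "openin (Euclidean_space k) (V n)" for n
    unfolding V_def by (rule openin_Inter) (use V2 in \<open>auto simp: surrounds_def\<close>)
  moreover have "\<forall>\<^sub>F n in \<U>. y n \<in> V n"
    unfolding V_def INT_iff by (rule eventually_ball_finite) (use V2 in \<open>auto simp: surrounds_def\<close>)
  ultimately have "surrounds k V y" by (simp add: surrounds_def)
  moreover have "smooth_on k (V n) (\<lambda>x. G n x j)" if "j < l" for n j
  proof -
    have "V n \<subseteq> V1 j n" using that INF_lower[of j "{..l}" "\<lambda>j. V2 j n"] by (auto simp: V_def V2_def)
    then have "smooth_on k (V n) (g j n)" by (rule smooth_on_subset[OF star_repD(1)[OF V1(2)[OF that]]])
    then show ?thesis using that by (simp add: G_def)
  qed
  moreover have "G n x \<in> topspace (Euclidean_space l)" for n x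
    by (auto simp: G_def topspace_Euclidean_space)
  moreover have "hvec \<U> k z \<in> A \<and> f (hvec \<U> k z) = hvec \<U> l (\<lambda>n. G n (z n))"
    if z: "z \<in> euclid_nets k" "\<forall>\<^sub>F n in \<U>. z n \<in> V n" for z
  proof -
    have z2: "\<forall>\<^sub>F n in \<U>. z n \<in> V2 j n" if "j \<le> l" for j
      using z(2) by eventually_elim (use that in \<open>auto simp: V_def\<close>)
    have zA: "hvec \<U> k z \<in> A" using V0(2)[OF z(1)] z2[of l] by (simp add: V2_def)
    then have "f (hvec \<U> k z) \<in> B" using f by (auto simp: maps_between_def)
    then obtain b where b: "f (hvec \<U> k z) = hvec \<U> l b" using star_open_point[OF B] by metis
    have "f (hvec \<U> k z) = hvec \<U> l (\<lambda>n. G n (z n))"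
    proof (rule extensionalityI[of _ "{..<l}"])
      fix j assume "j \<in> {..<l}"
      then have j: "j < l" by simp
      have "(\<lambda>x\<in>A. f x j) (hvec \<U> k z) = hclass \<U> (\<lambda>n. g j n (z n))"
        by (rule star_repD(3)[OF V1(2)[OF j] z(1)]) (use z2[of j] j in \<open>simp add: V2_def\<close>)
      then show "f (hvec \<U> k z) j = hvec \<U> l (\<lambda>n. G n (z n)) j"
        using zA j by (simp add: hvec_def G_def)
    next
      show "f (hvec \<U> k z) \<in> extensional {..<l}" unfolding b by (simp add: hvec_def)
    qed (simp add: hvec_def)
    with zA show ?thesis by simp
  qed
  ultimately show ?thesis using that by blast
qed

text \<open>
  Continuity of the real maps \<open>G n\<close> provides the neighbourhoods for both the continuity of internal
  maps and the smoothness of their composites.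
\<close>

lemma surrounds_preimage:
  assumes V: "surrounds k V y" and y: "\<And>n j. j < l \<Longrightarrow> smooth_on k (V n) (\<lambda>x. G n x j)"
    "\<And>n x. G n x \<in> topspace (Euclidean_space l)" and W: "surrounds l W (\<lambda>n. G n (y n))"
  shows "surrounds k (\<lambda>n. {x \<in> V n. G n x \<in> W n}) y"
  using assms unfolding surrounds_def
  by (auto intro!: openin_preimage_smooth eventually_conj)

lemma smooth_spaces_star: "smooth_spaces (star_topology \<U>) (star_smooth \<U>)"
proof
  fix k A i assume "openin (star_topology \<U> k) A" and i: "i < k"
  then have A: "star_open k A" by (simp add: openin_star_topology)
  show "(\<lambda>x\<in>A. x i) \<in> star_smooth \<U> k A"
    unfolding star_smooth_iff[OF A]
  proof (intro conjI ballI impI)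
    fix y assume y: "y \<in> euclid_nets k" "hvec \<U> k y \<in> A"
    obtain V where V: "surrounds k V y"
        "\<And>z. \<lbrakk>z \<in> euclid_nets k; \<forall>\<^sub>F n in \<U>. z n \<in> V n\<rbrakk> \<Longrightarrow> hvec \<U> k z \<in> A"
      using star_openD[OF A y] by metis
    have "star_rep k A (\<lambda>x\<in>A. x i) V (\<lambda>_ x. x i)"
      using V i by (auto simp: star_rep_def surrounds_def smooth_on_coordinate hvec_nth)
    with V(1) show "\<exists>V g. surrounds k V y \<and> star_rep k A (\<lambda>x\<in>A. x i) V g" by blast
  qed auto
next
  fix k A l B f \<phi>
  assume "openin (star_topology \<U> k) A" "openin (star_topology \<U> l) B"
    and f: "f \<in> maps_between (star_smooth \<U>) k A l B" and \<phi>: "\<phi> \<in> star_smooth \<U> l B"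
  then have A: "star_open k A" and B: "star_open l B" by (simp_all add: openin_star_topology)
  show "(\<lambda>x\<in>A. \<phi> (f x)) \<in> star_smooth \<U> k A"
    unfolding star_smooth_iff[OF A]
  proof (intro conjI ballI impI)
    fix y assume y: "y \<in> euclid_nets k" "hvec \<U> k y \<in> A"
    obtain V G where V: "surrounds k V y" and G: "\<And>n j. j < l \<Longrightarrow> smooth_on k (V n) (\<lambda>x. G n x j)"
      "\<And>n x. G n x \<in> topspace (Euclidean_space l)"
      and rep: "\<And>z. \<lbrakk>z \<in> euclid_nets k; \<forall>\<^sub>F n in \<U>. z n \<in> V n\<rbrakk>
        \<Longrightarrow> hvec \<U> k z \<in> A \<and> f (hvec \<U> k z) = hvec \<U> l (\<lambda>n. G n (z n))"
      by (rule star_map_rep[OF A B f y]) blast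
    have Gnet: "(\<lambda>n. G n (z n)) \<in> euclid_nets l" for z using G(2) by (simp add: euclid_nets_def)
    have "f (hvec \<U> k y) = hvec \<U> l (\<lambda>n. G n (y n))"
      using rep[OF y(1)] V by (simp add: surrounds_def)
    moreover have "f (hvec \<U> k y) \<in> B" using f y(2) by (auto simp: maps_between_def)
    ultimately obtain W h where W: "surrounds l W (\<lambda>n. G n (y n))" and h: "star_rep l B \<phi> W h"
      using \<phi> Gnet[of y] unfolding star_smooth_iff[OF B] by metis
    let ?V = "\<lambda>n. {x \<in> V n. G n x \<in> W n}"
    have V': "surrounds k ?V y" by (rule surrounds_preimage[OF V G W])
    moreover have "star_rep k A (\<lambda>x\<in>A. \<phi> (f x)) ?V (\<lambda>n x. h n (G n x))"
      unfolding star_rep_def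
    proof (intro conjI allI ballI impI)
      fix n
      show "smooth_on k (?V n) (\<lambda>x. h n (G n x))"
      proof (rule smooth_on_compose[where G = "G n" and u = "h n"])
        show "openin (Euclidean_space k) (?V n)" using V' by (simp add: surrounds_def)
        show "openin (Euclidean_space l) (W n)" using W by (simp add: surrounds_def)
        show "smooth_on l (W n) (h n)" by (rule star_repD(1)[OF h])
        show "smooth_on k (?V n) (\<lambda>x. G n x j)" if "j < l" for j
          by (rule smooth_on_subset[OF G(1)[OF that]]) auto
      qed auto
    next
      fix z assume z: "z \<in> euclid_nets k" "\<forall>\<^sub>F n in \<U>. z n \<in> ?V n"
      then have "\<forall>\<^sub>F n in \<U>. z n \<in> V n" "\<forall>\<^sub>F n in \<U>. G n (z n) \<in> W n" by (auto elim: eventually_mono)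
      then show "hvec \<U> k z \<in> A"
        "(\<lambda>x\<in>A. \<phi> (f x)) (hvec \<U> k z) = hclass \<U> (\<lambda>n. h n (G n (z n)))"
        using rep[OF z(1)] star_repD(3)[OF h Gnet] by auto
    qed
    ultimately show "\<exists>V g. surrounds k V y \<and> star_rep k A (\<lambda>x\<in>A. \<phi> (f x)) V g" by blast
  qed auto
next
  fix k A l B f C
  assume "openin (star_topology \<U> k) A" "openin (star_topology \<U> l) B"
    and f: "f \<in> maps_between (star_smooth \<U>) k A l B" and "openin (star_topology \<U> l) C"
  then have A: "star_open k A" and B: "star_open l B" and C: "star_open l C"
    by (simp_all add: openin_star_topology)
  show "openin (star_topology \<U> k) {x \<in> A. f x \<in> C}"
    unfolding openin_star_topology star_open_def
  proof (intro conjI ballI impI)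
    show "{x \<in> A. f x \<in> C} \<subseteq> hvec \<U> k ` euclid_nets k" using A by (auto simp: star_open_def)
    fix y assume y: "y \<in> euclid_nets k" "hvec \<U> k y \<in> {x \<in> A. f x \<in> C}"
    then have yA: "hvec \<U> k y \<in> A" by simp
    obtain V G where V: "surrounds k V y" and G: "\<And>n j. j < l \<Longrightarrow> smooth_on k (V n) (\<lambda>x. G n x j)"
      "\<And>n x. G n x \<in> topspace (Euclidean_space l)"
      and rep: "\<And>z. \<lbrakk>z \<in> euclid_nets k; \<forall>\<^sub>F n in \<U>. z n \<in> V n\<rbrakk>
        \<Longrightarrow> hvec \<U> k z \<in> A \<and> f (hvec \<U> k z) = hvec \<U> l (\<lambda>n. G n (z n))"
      by (rule star_map_rep[OF A B f y(1) yA]) blast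
    have Gnet: "(\<lambda>n. G n (z n)) \<in> euclid_nets l" for z using G(2) by (simp add: euclid_nets_def)
    have "f (hvec \<U> k y) = hvec \<U> l (\<lambda>n. G n (y n))"
      using rep[OF y(1)] V by (simp add: surrounds_def)
    then have "hvec \<U> l (\<lambda>n. G n (y n)) \<in> C" using y(2) by simp
    then obtain W where W: "surrounds l W (\<lambda>n. G n (y n))"
        "\<And>z. \<lbrakk>z \<in> euclid_nets l; \<forall>\<^sub>F n in \<U>. z n \<in> W n\<rbrakk> \<Longrightarrow> hvec \<U> l z \<in> C"
      using star_openD[OF C Gnet] by metis
    have "hvec \<U> k z \<in> {x \<in> A. f x \<in> C}"
      if z: "z \<in> euclid_nets k" "\<forall>\<^sub>F n in \<U>. z n \<in> {x \<in> V n. G n x \<in> W n}" for z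
    proof -
      have "\<forall>\<^sub>F n in \<U>. z n \<in> V n" "\<forall>\<^sub>F n in \<U>. G n (z n) \<in> W n" using z(2) by (auto elim: eventually_mono)
      then show ?thesis using rep[OF z(1)] W(2)[OF Gnet] by auto
    qed
    then show "\<exists>V. surrounds k V y \<and> (\<forall>z\<in>euclid_nets k. (\<forall>\<^sub>F n in \<U>. z n \<in> V n) \<longrightarrow>
        hvec \<U> k z \<in> {x \<in> A. f x \<in> C})"
      using surrounds_preimage[OF V G W(1)] by blast
  qed
next
  fix \<B> k \<phi>
  assume o: "\<And>B. B \<in> \<B> \<Longrightarrow> openin (star_topology \<U> k) B"
    and s: "\<And>B. B \<in> \<B> \<Longrightarrow> (\<lambda>x\<in>B. \<phi> x) \<in> star_smooth \<U> k B"
  have union: "star_open k (\<Union>\<B>)" using o openin_Union unfolding openin_star_topology[symmetric] by blast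
  show "(\<lambda>x\<in>\<Union>\<B>. \<phi> x) \<in> star_smooth \<U> k (\<Union>\<B>)"
    unfolding star_smooth_iff[OF union]
  proof (intro conjI ballI impI)
    fix y assume y: "y \<in> euclid_nets k" "hvec \<U> k y \<in> \<Union>\<B>"
    then obtain B where B: "B \<in> \<B>" "hvec \<U> k y \<in> B" by blast
    have "star_open k B" using o[OF B(1)] by (simp add: openin_star_topology)
    then obtain V g where V: "surrounds k V y" "star_rep k B (\<lambda>x\<in>B. \<phi> x) V g"
      using s[OF B(1)] y(1) B(2) star_smooth_iff by metis
    then have "star_rep k (\<Union>\<B>) (\<lambda>x\<in>\<Union>\<B>. \<phi> x) V g"
      using B(1) unfolding star_rep_def by (metis UnionI restrict_apply')
    with V(1) show "\<exists>V g. surrounds k V y \<and> star_rep k (\<Union>\<B>) (\<lambda>x\<in>\<Union>\<B>. \<phi> x) V g" by blast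
  qed auto
next
  show "\<exists>p. topspace (star_topology \<U> 0) = {p}" by (simp add: topspace_star)
next
  fix x k j assume x: "x \<in> topspace (star_topology \<U> k)" and j: "j < (k::nat)"
  then obtain a where a: "x j = hclass \<U> a"
    by (auto simp: topspace_star PiE_iff hyperreals_eq_range)
  let ?P = "topspace (star_topology \<U> 0)"
  have P: "star_open 0 ?P" by (simp flip: openin_star_topology)
  show "(\<lambda>_\<in>?P. x j) \<in> star_smooth \<U> 0 ?P"
    unfolding star_smooth_iff[OF P]
  proof (intro conjI ballI impI)
    fix y assume y: "y \<in> euclid_nets 0" "hvec \<U> 0 y \<in> ?P"
    have "surrounds 0 (\<lambda>_. topspace (Euclidean_space 0)) y"
      using y(1) by (simp add: surrounds_def euclid_nets_def)
    moreover have "star_rep 0 ?P (\<lambda>_\<in>?P. x j) (\<lambda>_. topspace (Euclidean_space 0)) (\<lambda>n _. a n)"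
      unfolding star_rep_def using hvec_euclid_nets[of 0]
      by (auto simp: smooth_on_const a topspace_star)
    ultimately show "\<exists>V g. surrounds 0 V y \<and> star_rep 0 ?P (\<lambda>_\<in>?P. x j) V g" by blast
  qed auto
qed

end

section \<open>Near-standard points\<close>

definition euclid_smooth :: "nat \<Rightarrow> (nat \<Rightarrow> real) set \<Rightarrow> ((nat \<Rightarrow> real) \<Rightarrow> real) set" where
  "euclid_smooth k A = {f \<in> extensional A. smooth_on k A f}"

lemma EucOp_eq: "EucOp = open_set_site Euclidean_space euclid_smooth"
  unfolding EucOp_def euclid_smooth_def ..

lemma euclid_maps_smooth:
  assumes "openin (Euclidean_space k) A" "f \<in> maps_between euclid_smooth k A l B" "j < l"
  shows "smooth_on k A (\<lambda>x. f x j)"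
  by (rule smooth_on_cong[OF assms(1), of "\<lambda>x\<in>A. f x j"])
    (use assms(2,3) in \<open>auto simp: maps_between_def euclid_smooth_def\<close>)

interpretation euclid: smooth_maps Euclidean_space euclid_smooth
proof
  fix k A i assume "openin (Euclidean_space k) A" "i < k"
  then show "(\<lambda>x\<in>A. x i) \<in> euclid_smooth k A"
    using smooth_on_cong[OF _ smooth_on_coordinate, of k A "\<lambda>x\<in>A. x i" i]
    by (simp add: euclid_smooth_def)
next
  fix k A l B f \<phi>
  assume A: "openin (Euclidean_space k) A" and B: "openin (Euclidean_space l) B"
    and f: "f \<in> maps_between euclid_smooth k A l B" and \<phi>: "\<phi> \<in> euclid_smooth l B"
  have "smooth_on k A (\<lambda>x. \<phi> (f x))"
    by (rule smooth_on_compose[OF A B, where G = f])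
      (use f \<phi> euclid_maps_smooth[OF A f] in \<open>auto simp: maps_between_def euclid_smooth_def\<close>)
  then have "smooth_on k A (\<lambda>x\<in>A. \<phi> (f x))"
    by (rule smooth_on_cong[OF A]) auto
  then show "(\<lambda>x\<in>A. \<phi> (f x)) \<in> euclid_smooth k A"
    by (simp add: euclid_smooth_def)
qed

context ultrapower
begin

text \<open>
  By compactness of the interval, the image of the ultrafilter has a cluster point in it, and an
  ultrafilter converges to each of its cluster points.
\<close>

lemma bounded_ultrafilter_limit:
  fixes s :: "nat \<Rightarrow> real"
  assumes "\<forall>\<^sub>F n in \<U>. \<bar>s n - c\<bar> \<le> e"
  obtains b where "(s \<longlongrightarrow> b) \<U>" "\<bar>b - c\<bar> \<le> e"
proof -
  have "\<forall>\<^sub>F n in \<U>. s n \<in> {c - e..c + e}"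
    using assms by eventually_elim (auto simp: abs_le_iff)
  then have "\<forall>\<^sub>F x in filtermap s \<U>. x \<in> {c - e..c + e}"
    by (simp add: eventually_filtermap)
  moreover have "filtermap s \<U> \<noteq> bot"
    using ultrafilter_nonbot by (simp add: filtermap_bot_iff)
  ultimately obtain b where b: "b \<in> {c - e..c + e}" "inf (nhds b) (filtermap s \<U>) \<noteq> bot"
    using compact_Icc[of "c - e" "c + e"] unfolding compact_filter le_principal by blast
  have "(s \<longlongrightarrow> b) \<U>"
  proof (rule topological_tendstoI, rule ccontr)
    fix S assume S: "open S" "b \<in> S" and "\<not> (\<forall>\<^sub>F n in \<U>. s n \<in> S)"
    then have "\<forall>\<^sub>F n in \<U>. s n \<notin> S" using ultrafilter_cases by blast
    then have "\<forall>\<^sub>F x in filtermap s \<U>. x \<notin> S" by (simp add: eventually_filtermap)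
    moreover have "\<forall>\<^sub>F x in nhds b. x \<in> S" using S by (rule eventually_nhds_in_open)
    ultimately have "\<forall>\<^sub>F x in inf (nhds b) (filtermap s \<U>). False"
      unfolding eventually_inf by blast
    with b(2) show False by (simp add: trivial_limit_def)
  qed
  with b(1) show ?thesis using that by (auto simp: abs_le_iff)
qed

text \<open>
  Membership in \<open>A\<close> is required almost everywhere only, although convergence implies it for open
  \<open>A\<close> and nets in Euclidean space: this makes \<open>near_in\<close> invariant under changes on a null set, and
  stable under application of maps that are meaningful on \<open>A\<close> only.
\<close>

definition near_in :: "nat \<Rightarrow> (nat \<Rightarrow> real) set \<Rightarrow> (nat \<Rightarrow> nat \<Rightarrow> real) \<Rightarrow> bool" where
  "near_in k A y \<longleftrightarrow> (\<exists>a\<in>A. \<forall>i<k. ((\<lambda>n. y n i) \<longlongrightarrow> a i) \<U>) \<and> (\<forall>\<^sub>F n in \<U>. y n \<in> A)"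

definition near_standard :: "nat \<Rightarrow> (nat \<Rightarrow> real) set \<Rightarrow> (nat \<Rightarrow> hyp) set" where
  "near_standard k A = hvec \<U> k ` {y. near_in k A y}"

lemma near_in_cong:
  assumes "near_in k A y" "\<forall>\<^sub>F n in \<U>. y n = z n"
  shows "near_in k A z"
proof -
  have "((\<lambda>n. y n i) \<longlongrightarrow> b) \<U> \<longleftrightarrow> ((\<lambda>n. z n i) \<longlongrightarrow> b) \<U>" for i b
    by (rule tendsto_cong) (use assms(2) in \<open>auto elim: eventually_mono\<close>)
  moreover have "\<forall>\<^sub>F n in \<U>. z n \<in> A" if "\<forall>\<^sub>F n in \<U>. y n \<in> A"
    using that assms(2) by eventually_elim auto
  ultimately show ?thesis using assms(1) unfolding near_in_def by simp
qed

lemma near_in_euclid: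
  assumes "openin (Euclidean_space k) A" "near_in k A y"
  shows "\<forall>\<^sub>F n in \<U>. y n \<in> topspace (Euclidean_space k)"
proof -
  have "\<forall>\<^sub>F n in \<U>. y n \<in> A" using assms(2) by (simp add: near_in_def)
  then show ?thesis by eventually_elim (use openin_subset[OF assms(1)] in blast)
qed

lemma near_standardD:
  assumes A: "openin (Euclidean_space k) A" and "hvec \<U> k z \<in> near_standard k A"
    and z: "\<forall>\<^sub>F n in \<U>. z n \<in> topspace (Euclidean_space k)"
  shows "near_in k A z"
proof -
  obtain y where y: "near_in k A y" "hvec \<U> k y = hvec \<U> k z"
    using assms(2) unfolding near_standard_def by auto
  show ?thesis
    by (rule near_in_cong[OF y(1) hvec_eqD[OF y(2) near_in_euclid[OF A y(1)] z]])
qed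

lemma near_inI_open:
  assumes B: "openin (Euclidean_space k) B" and "b \<in> B"
    and "\<And>i. i < k \<Longrightarrow> ((\<lambda>n. y n i) \<longlongrightarrow> b i) \<U>"
    and "\<forall>\<^sub>F n in \<U>. y n \<in> topspace (Euclidean_space k)"
  shows "near_in k B y"
  using assms eventually_in_open_Euclidean[OF assms] unfolding near_in_def by blast

text \<open>
  Around a point \<open>a\<close> of \<open>A\<close>, the open box of half-width \<open>e / 2\<close> is a witness: nets in it are
  bounded, hence converge along the ultrafilter, and the limit stays in the box of half-width \<open>e\<close>,
  which is contained in \<open>A\<close>.
\<close>

lemma star_open_near_standard:
  assumes A: "openin (Euclidean_space k) A"
  shows "star_open k (near_standard k A)"
  unfolding star_open_def
proof (intro conjI subsetI ballI impI)
  fix x assume "x \<in> near_standard k A"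
  then obtain y where y: "near_in k A y" "x = hvec \<U> k y" unfolding near_standard_def by auto
  obtain z where "z \<in> euclid_nets k" "\<forall>\<^sub>F n in \<U>. z n = y n"
    using ae_euclid_netE[OF near_in_euclid[OF A y(1)]] .
  then show "x \<in> hvec \<U> k ` euclid_nets k" using hvec_eqI[of z y k] y(2) by (metis image_eqI)
next
  fix y assume y: "y \<in> euclid_nets k" "hvec \<U> k y \<in> near_standard k A"
  then have "near_in k A y" by (intro near_standardD[OF A]) (auto simp: euclid_nets_def)
  then obtain a where a: "a \<in> A" "\<And>i. i < k \<Longrightarrow> ((\<lambda>n. y n i) \<longlongrightarrow> a i) \<U>"
    unfolding near_in_def by blast
  have a_top: "a \<in> topspace (Euclidean_space k)" using a(1) openin_subset[OF A] by blast
  obtain e where e: "e > 0"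
    "\<And>x. \<lbrakk>x \<in> topspace (Euclidean_space k); \<forall>i<k. \<bar>x i - a i\<bar> < e\<rbrakk> \<Longrightarrow> x \<in> A"
    using openin_Euclidean_space_box[OF A a(1)] by metis
  define V where "V = topspace (Euclidean_space k) \<inter> {x. \<forall>i\<in>{..<k}. a i - e / 2 < x i \<and> x i < a i + e / 2}"
  have V: "openin (Euclidean_space k) V"
  proof -
    have "openin (Euclidean_space k) {x \<in> topspace (Euclidean_space k). x i \<in> {a i - e / 2<..<a i + e / 2}}" for i
      by (rule openin_continuous_map_preimage[of _ euclideanreal])
        (use continuous_map_Euclidean_coordinate[of k "topspace (Euclidean_space k)"] in auto)
    then have "openin (Euclidean_space k) ((\<Inter>i\<in>{..<k}. {x \<in> topspace (Euclidean_space k). x i \<in> {a i - e / 2<..<a i + e / 2}})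
        \<inter> topspace (Euclidean_space k))"
      by (intro openin_INT) auto
    also have "(\<Inter>i\<in>{..<k}. {x \<in> topspace (Euclidean_space k). x i \<in> {a i - e / 2<..<a i + e / 2}})
        \<inter> topspace (Euclidean_space k) = V"
      by (auto simp: V_def)
    finally show ?thesis .
  qed
  have "a \<in> V" using a_top e(1) by (simp add: V_def)
  then have "surrounds k (\<lambda>_. V) y"
    using V eventually_in_open_Euclidean[OF V _ a(2)] y(1) by (simp add: surrounds_def euclid_nets_def)
  moreover have "hvec \<U> k z \<in> near_standard k A"
    if z: "z \<in> euclid_nets k" "\<forall>\<^sub>F n in \<U>. z n \<in> V" for z
  proof -
    have "\<exists>b. ((\<lambda>n. z n i) \<longlongrightarrow> b) \<U> \<and> \<bar>b - a i\<bar> \<le> e / 2" if "i < k" for i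
    proof -
      have "\<forall>\<^sub>F n in \<U>. \<bar>z n i - a i\<bar> \<le> e / 2"
        using z(2)
      proof eventually_elim
        case (elim n)
        then have "a i - e / 2 < z n i" "z n i < a i + e / 2" using that by (auto simp: V_def)
        then show ?case by linarith
      qed
      then show ?thesis using bounded_ultrafilter_limit by metis
    qed
    then obtain b where b: "\<And>i. i < k \<Longrightarrow> ((\<lambda>n. z n i) \<longlongrightarrow> b i) \<U> \<and> \<bar>b i - a i\<bar> \<le> e / 2"
      by metis
    define b' where "b' i = (if i < k then b i else 0)" for i
    have "b' \<in> A"
    proof (rule e(2))
      show "b' \<in> topspace (Euclidean_space k)" by (simp add: topspace_Euclidean_space b'_def)
      show "\<forall>i<k. \<bar>b' i - a i\<bar> < e" using b e(1) by (fastforce simp: b'_def)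
    qed
    then have "near_in k A z"
      using near_inI_open[OF A, of b' z] b z(1) by (simp add: b'_def euclid_nets_def)
    then show ?thesis by (auto simp: near_standard_def)
  qed
  ultimately show "\<exists>V. surrounds k V y \<and> (\<forall>z\<in>euclid_nets k. (\<forall>\<^sub>F n in \<U>. z n \<in> V n) \<longrightarrow>
      hvec \<U> k z \<in> near_standard k A)"
    by (intro exI[of _ "\<lambda>_. V"]) auto
qed

abbreviation star_obj :: "nat \<times> (nat \<Rightarrow> real) set \<Rightarrow> nat \<times> (nat \<Rightarrow> hyp) set" where
  "star_obj \<equiv> \<lambda>(k, A). (k, near_standard k A)"

text \<open>
  The action on classes of nets: \<open>[y n]\<close> is sent to \<open>[f (y n)]\<close>. The choice of the representing
  net is immaterial by \<open>star_map_hvec\<close>.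
\<close>

definition star_map ::
  "nat \<times> (nat \<Rightarrow> real) set \<Rightarrow> nat \<times> (nat \<Rightarrow> real) set \<Rightarrow> ((nat \<Rightarrow> real) \<Rightarrow> (nat \<Rightarrow> real)) \<Rightarrow>
    (nat \<Rightarrow> hyp) \<Rightarrow> (nat \<Rightarrow> hyp)" where
  "star_map = (\<lambda>(k, A) (l, B) f. (\<lambda>x\<in>near_standard k A.
     hvec \<U> l (\<lambda>n. f ((SOME y. near_in k A y \<and> hvec \<U> k y = x) n))))"

lemma star_map_hvec:
  assumes A: "openin (Euclidean_space k) A" and y: "near_in k A y"
  shows "star_map (k, A) (l, B) f (hvec \<U> k y) = hvec \<U> l (\<lambda>n. f (y n))"
proof -
  define z where "z = (SOME z. near_in k A z \<and> hvec \<U> k z = hvec \<U> k y)"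
  have z: "near_in k A z \<and> hvec \<U> k z = hvec \<U> k y"
    unfolding z_def by (rule someI[of _ y]) (use y in simp)
  then have "\<forall>\<^sub>F n in \<U>. z n = y n"
    using hvec_eqD near_in_euclid[OF A] y by blast
  then have "hvec \<U> l (\<lambda>n. f (z n)) = hvec \<U> l (\<lambda>n. f (y n))"
    by (intro hvec_eqI) (auto elim: eventually_mono)
  then show ?thesis
    using y unfolding star_map_def z_def by (auto simp: near_standard_def)
qed

lemma star_map_eqI:
  assumes A: "openin (Euclidean_space k) A" and "g \<in> extensional (near_standard k A)"
    and "\<And>y. near_in k A y \<Longrightarrow> g (hvec \<U> k y) = hvec \<U> l (\<lambda>n. f (y n))"
  shows "star_map (k, A) (l, B) f = g"
proof (rule extensionalityI[of _ "near_standard k A"])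
  show "star_map (k, A) (l, B) f \<in> extensional (near_standard k A)" by (simp add: star_map_def)
qed (use assms star_map_hvec[OF A] in \<open>auto simp: near_standard_def\<close>)

lemma star_map_inclusion:
  assumes B: "openin (Euclidean_space k) B"
  shows "star_map (k, B) (k, A) (\<lambda>x\<in>B. x) = (\<lambda>x\<in>near_standard k B. x)"
proof (rule star_map_eqI[OF B])
  fix y assume y: "near_in k B y"
  have "\<forall>\<^sub>F n in \<U>. y n = (\<lambda>x\<in>B. x) (y n)"
    using y by (auto simp: near_in_def elim: eventually_mono)
  then have "hvec \<U> k y = hvec \<U> k (\<lambda>n. (\<lambda>x\<in>B. x) (y n))"
    by (rule hvec_eqI)
  moreover have "hvec \<U> k y \<in> near_standard k B" using y by (simp add: near_standard_def)
  ultimately show "(\<lambda>x\<in>near_standard k B. x) (hvec \<U> k y) = hvec \<U> k (\<lambda>n. (\<lambda>x\<in>B. x) (y n))"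
    by (simp only: restrict_apply if_True)
qed auto

lemma near_in_map:
  assumes A: "openin (Euclidean_space k) A" and B: "openin (Euclidean_space l) B"
    and f: "f \<in> maps_between euclid_smooth k A l B" and y: "near_in k A y"
  shows "near_in l B (\<lambda>n. f (y n))"
proof -
  obtain a where a: "a \<in> A" "\<And>i. i < k \<Longrightarrow> ((\<lambda>n. y n i) \<longlongrightarrow> a i) \<U>" and yA: "\<forall>\<^sub>F n in \<U>. y n \<in> A"
    using y unfolding near_in_def by blast
  have "((\<lambda>n. f (y n) j) \<longlongrightarrow> f a j) \<U>" if "j < l" for j
    by (rule tendsto_continuous_Euclidean[OF A a(1)
        smooth_on_continuous[OF euclid_maps_smooth[OF A f that]] a(2) near_in_euclid[OF A y]])
  moreover have "f x \<in> B" if "x \<in> A" for x using f that by (auto simp: maps_between_def)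
  moreover from this have "\<forall>\<^sub>F n in \<U>. f (y n) \<in> B" using yA by (auto elim: eventually_mono)
  ultimately show ?thesis using a(1) unfolding near_in_def by blast
qed

text \<open>
  Near any net, the map is represented by the constant net of functions \<open>f\<close>, restricted to a
  neighbourhood on which all points are near-standard.
\<close>

lemma star_map_in_maps:
  assumes A: "openin (Euclidean_space k) A" and B: "openin (Euclidean_space l) B"
    and f: "f \<in> maps_between euclid_smooth k A l B"
  shows "star_map (k, A) (l, B) f \<in>
    maps_between (star_smooth \<U>) k (near_standard k A) l (near_standard l B)"
proof -
  let ?f = "star_map (k, A) (l, B) f" and ?A = "near_standard k A"
  have oA: "star_open k ?A" by (rule star_open_near_standard[OF A])
  have "?f x \<in> near_standard l B" if "x \<in> ?A" for x
    using that near_in_map[OF A B f] star_map_hvec[OF A] by (auto simp: near_standard_def)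
  moreover have "(\<lambda>x\<in>?A. ?f x j) \<in> star_smooth \<U> k ?A" if j: "j < l" for j
    unfolding star_smooth_iff[OF oA]
  proof (intro conjI ballI impI)
    fix y assume y: "y \<in> euclid_nets k" "hvec \<U> k y \<in> ?A"
    then have near: "near_in k A y" by (intro near_standardD[OF A]) (auto simp: euclid_nets_def)
    obtain V where V: "surrounds k V y"
        "\<And>z. \<lbrakk>z \<in> euclid_nets k; \<forall>\<^sub>F n in \<U>. z n \<in> V n\<rbrakk> \<Longrightarrow> hvec \<U> k z \<in> ?A"
      using star_openD[OF oA y] by metis
    have "surrounds k (\<lambda>_. A) y" using A near by (simp add: surrounds_def near_in_def)
    then have VA: "surrounds k (\<lambda>n. V n \<inter> A) y" by (rule surrounds_Int[OF V(1)])
    have "star_rep k ?A (\<lambda>x\<in>?A. ?f x j) (\<lambda>n. V n \<inter> A) (\<lambda>_ x. f x j)"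
      unfolding star_rep_def
    proof (intro conjI ballI impI allI)
      show "smooth_on k (V n \<inter> A) (\<lambda>x. f x j)" for n
        by (rule smooth_on_subset[OF euclid_maps_smooth[OF A f j]]) auto
      fix z assume z: "z \<in> euclid_nets k" "\<forall>\<^sub>F n in \<U>. z n \<in> V n \<inter> A"
      then show zA: "hvec \<U> k z \<in> ?A" using V(2) by (auto simp: eventually_conj_iff)
      then have "near_in k A z"
        using z(1) by (intro near_standardD[OF A]) (auto simp: euclid_nets_def)
      then show "(\<lambda>x\<in>?A. ?f x j) (hvec \<U> k z) = hclass \<U> (\<lambda>n. f (z n) j)"
        using zA star_map_hvec[OF A] j by (simp add: hvec_nth)
    qed
    with VA show "\<exists>V g. surrounds k V y \<and> star_rep k ?A (\<lambda>x\<in>?A. ?f x j) V g" by blast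
  qed auto
  moreover have "?f \<in> extensional ?A" by (simp add: star_map_def)
  ultimately show ?thesis by (auto simp: maps_between_def PiE_iff)
qed

lemma near_in_constant:
  assumes "a \<in> A"
  shows "near_in k A (\<lambda>_. a)"
  using assms by (auto simp: near_in_def)

lemma star_faithful_functor: "faithful_functor EucOp (star_EucOp \<U>) star_obj star_map"
proof -
  let ?C = "open_set_site Euclidean_space euclid_smooth"
  let ?D = "open_set_site (star_topology \<U>) (star_smooth \<U>)"
  interpret star: smooth_spaces "star_topology \<U>" "star_smooth \<U>" by (rule smooth_spaces_star)
  interpret C: category ?C by (rule euclid.category_open_set_site)
  interpret D: category ?D by (rule star.category_open_set_site)
  have "category_functor ?C ?D star_obj star_map"
  proof (unfold_locales, goal_cases)
    case (1 a)
    then show ?case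
      by (cases a) (auto simp: open_set_site_simps openin_star_topology star_open_near_standard)
  next
    case (2 a b f)
    then show ?case
      by (cases a; cases b) (auto simp: open_set_site_simps intro: star_map_in_maps)
  next
    case (3 a)
    obtain k A where a: "a = (k, A)" by force
    then have A: "openin (Euclidean_space k) A" using 3 by (simp add: open_set_site_simps)
    show ?case
      using star_map_inclusion[OF A] by (simp add: a open_set_site_simps)
  next
    case (4 a b c f g)
    obtain k A where a: "a = (k, A)" by force
    obtain l B where b: "b = (l, B)" by force
    obtain m C where c: "c = (m, C)" by force
    have A: "openin (Euclidean_space k) A" and B: "openin (Euclidean_space l) B"
      and f: "f \<in> maps_between euclid_smooth k A l B"
      using 4 by (auto simp: a b open_set_site_simps)
    have "compose (near_standard k A) (star_map (l, B) (m, C) g) (star_map (k, A) (l, B) f) (hvec \<U> k y)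
        = hvec \<U> m (\<lambda>n. compose A g f (y n))" if y: "near_in k A y" for y
    proof -
      have "hvec \<U> m (\<lambda>n. g (f (y n))) = hvec \<U> m (\<lambda>n. compose A g f (y n))"
        by (rule hvec_eqI) (use y in \<open>auto simp: near_in_def compose_def elim: eventually_mono\<close>)
      moreover have "hvec \<U> k y \<in> near_standard k A" using y by (auto simp: near_standard_def)
      ultimately show ?thesis
        by (simp add: compose_eq star_map_hvec[OF A y] star_map_hvec[OF B near_in_map[OF A B f y]])
    qed
    then show ?case
      unfolding a b c by (auto simp: open_set_site_simps intro!: star_map_eqI[OF A])
  qed
  moreover have "inj_on (star_map a b) (Hom ?C a b)" if "a \<in> Obj ?C" "b \<in> Obj ?C" for a b
  proof (rule inj_onI)
    fix f g assume fg: "f \<in> Hom ?C a b" "g \<in> Hom ?C a b" and eq: "star_map a b f = star_map a b g"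
    obtain k A where a: "a = (k, A)" by force
    obtain l B where b: "b = (l, B)" by force
    have A: "openin (Euclidean_space k) A" and B: "openin (Euclidean_space l) B"
      and f: "f \<in> A \<rightarrow>\<^sub>E B" and g: "g \<in> A \<rightarrow>\<^sub>E B"
      using that fg by (auto simp: a b open_set_site_simps maps_between_def)
    show "f = g"
    proof (rule PiE_ext[OF f g])
      fix x assume x: "x \<in> A"
      have "hvec \<U> l (\<lambda>_. f x) = hvec \<U> l (\<lambda>_. g x)"
        using star_map_hvec[OF A near_in_constant[OF x], of l B] eq a b by metis
      moreover have "f x \<in> topspace (Euclidean_space l)" "g x \<in> topspace (Euclidean_space l)"
        using f g x openin_subset[OF B] by (auto simp: PiE_iff)
      ultimately show "f x = g x" using hvec_eqD[of l "\<lambda>_. f x" "\<lambda>_. g x"] by simp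
    qed
  qed
  ultimately show ?thesis by (simp add: faithful_functor_def EucOp_eq star_EucOp_def)
qed

text \<open>
  The limit point lies in one member of the cover; this member is open, so it contains almost all
  terms of the net. For the sets of all nets in \<open>A\<close>, this can fail when the cover is infinite.
\<close>

lemma near_standard_Union:
  assumes "\<forall>B\<in>\<B>. openin (Euclidean_space k) B"
  shows "near_standard k (\<Union>\<B>) = (\<Union>B\<in>\<B>. near_standard k B)"
proof (intro equalityI subsetI)
  have o: "openin (Euclidean_space k) (\<Union>\<B>)" using assms by blast
  fix x assume "x \<in> near_standard k (\<Union>\<B>)"
  then obtain y where y: "near_in k (\<Union>\<B>) y" "x = hvec \<U> k y" unfolding near_standard_def by auto
  then obtain a B where a: "B \<in> \<B>" "a \<in> B" "\<And>i. i < k \<Longrightarrow> ((\<lambda>n. y n i) \<longlongrightarrow> a i) \<U>"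
    unfolding near_in_def by blast
  then have "near_in k B y"
    using near_inI_open assms near_in_euclid[OF o y(1)] by blast
  then show "x \<in> (\<Union>B\<in>\<B>. near_standard k B)" using a(1) y(2) by (auto simp: near_standard_def)
next
  fix x assume "x \<in> (\<Union>B\<in>\<B>. near_standard k B)"
  then obtain B y where "B \<in> \<B>" "near_in k B y" "x = hvec \<U> k y" unfolding near_standard_def by auto
  moreover from this have "near_in k (\<Union>\<B>) y" unfolding near_in_def by (auto elim: eventually_mono)
  ultimately show "x \<in> near_standard k (\<Union>\<B>)" unfolding near_standard_def by blast
qed

lemma star_preserves_coverings: "preserves_coverings EucOp (star_EucOp \<U>) star_obj star_map"
  unfolding preserves_coverings_def EucOp_eq star_EucOp_def
proof (intro ballI)
  let ?C = "open_set_site Euclidean_space euclid_smooth"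
  let ?D = "open_set_site (star_topology \<U>) (star_smooth \<U>)"
  fix d S assume "d \<in> Obj ?C" "S \<in> Cov ?C d"
  moreover obtain k A where d: "d = (k, A)" by force
  ultimately obtain \<B> where \<B>: "\<forall>B\<in>\<B>. openin (Euclidean_space k) B" "\<Union>\<B> = A"
    and S: "S = (\<lambda>B. ((k, B), (\<lambda>x\<in>B. x))) ` \<B>"
    by (auto simp: open_set_site_simps)
  have "star_map (k, B) (k, A) (\<lambda>x\<in>B. x) = (\<lambda>x\<in>near_standard k B. x)" if "B \<in> \<B>" for B
    using star_map_inclusion \<B>(1) that by blast
  then have "(\<lambda>(e, f). (star_obj e, star_map e d f)) ` S =
      (\<lambda>B. ((k, B), (\<lambda>x\<in>B. x))) ` (near_standard k ` \<B>)"
    unfolding S d image_image by (intro image_cong) auto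
  moreover have "\<forall>B\<in>near_standard k ` \<B>. openin (star_topology \<U> k) B"
    using \<B>(1) by (auto simp: openin_star_topology star_open_near_standard)
  moreover have "\<Union>(near_standard k ` \<B>) = near_standard k A"
    using near_standard_Union[OF \<B>(1)] \<B>(2) by simp
  ultimately show "(\<lambda>(e, f). (star_obj e, star_map e d f)) ` S \<in> Cov ?D (star_obj d)"
    unfolding d open_set_site_simps case_prod_conv by blast
qed

end

section \<open>Asymptotic numbers\<close>

context ultrapower
begin

lemma hmap_hclass: "hmap \<U> f (hclass \<U> x) = hclass \<U> (\<lambda>n. f (x n))"
proof -
  have "hclass \<U> (\<lambda>n. f (x' n)) = hclass \<U> (\<lambda>n. f (x n))" if "x' \<in> hclass \<U> x" for x'
    unfolding hclass_eq_iff using that[unfolded mem_hclass_iff] by eventually_elim simp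
  moreover have "x \<in> hclass \<U> x" by (simp add: mem_hclass_iff)
  ultimately show ?thesis unfolding hmap_def by blast
qed

lemma hmap2_hclass: "hmap2 \<U> f (hclass \<U> x) (hclass \<U> y) = hclass \<U> (\<lambda>n. f (x n) (y n))"
proof -
  have "hclass \<U> (\<lambda>n. f (x' n) (y' n)) = hclass \<U> (\<lambda>n. f (x n) (y n))"
    if "x' \<in> hclass \<U> x" "y' \<in> hclass \<U> y" for x' y'
    unfolding hclass_eq_iff
    using that[unfolded mem_hclass_iff] by eventually_elim simp
  moreover have "x \<in> hclass \<U> x" "y \<in> hclass \<U> y" by (simp_all add: mem_hclass_iff)
  ultimately show ?thesis unfolding hmap2_def by blast
qed

lemma hle_hclass: "hle \<U> (hclass \<U> x) (hclass \<U> y) \<longleftrightarrow> (\<forall>\<^sub>F n in \<U>. x n \<le> y n)"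
proof
  assume "hle \<U> (hclass \<U> x) (hclass \<U> y)"
  then obtain x' y' where "\<forall>\<^sub>F n in \<U>. x n = x' n" "\<forall>\<^sub>F n in \<U>. y n = y' n" "\<forall>\<^sub>F n in \<U>. x' n \<le> y' n"
    unfolding hle_def by (auto simp: mem_hclass_iff)
  then show "\<forall>\<^sub>F n in \<U>. x n \<le> y n" by eventually_elim simp
next
  assume "\<forall>\<^sub>F n in \<U>. x n \<le> y n"
  then show "hle \<U> (hclass \<U> x) (hclass \<U> y)"
    unfolding hle_def
    by (intro bexI[where A = "hclass \<U> x" and x = x] bexI[where A = "hclass \<U> y" and x = y])
      (simp_all add: mem_hclass_iff)
qed

lemma eventually_ge_2: "\<forall>\<^sub>F n in \<U>. n \<ge> 2"
proof -
  have "\<forall>\<^sub>F n in \<U>. n \<noteq> 0 \<and> n \<noteq> 1" by (intro eventually_conj ultrafilter_avoids)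
  then show ?thesis by eventually_elim auto
qed

lemma le_power_nat_ceiling:
  assumes "n \<ge> 2"
  shows "\<bar>x\<bar> \<le> real n ^ nat \<lceil>\<bar>x\<bar>\<rceil>"
proof -
  let ?c = "nat \<lceil>\<bar>x\<bar>\<rceil>"
  have "\<bar>x\<bar> \<le> real ?c" by linarith
  also have "real ?c \<le> 2 ^ ?c" by (metis less_exp of_nat_le_iff of_nat_numeral of_nat_power order_less_imp_le)
  also have "\<dots> \<le> real n ^ ?c" using assms by (intro power_mono) auto
  finally show ?thesis .
qed

text \<open>
  The exponent \<open>c\<close> may depend on the index, and growth of \<open>\<bar>x n\<bar>\<close> of any order is dominated by
  \<open>n ^ c n\<close> for a suitable \<open>c\<close>.
\<close>

lemma rho_moderate_eq: "rho_moderate \<U> = hyperreals \<U>"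
proof -
  have "\<exists>c\<in>hypernats \<U>. hle \<U> (hmap \<U> abs (hclass \<U> x)) (rho_pow \<U> (hmap \<U> uminus c))" for x
  proof
    let ?c = "\<lambda>n. nat \<lceil>\<bar>x n\<bar>\<rceil>"
    show "hclass \<U> (\<lambda>n. real (?c n)) \<in> hypernats \<U>" unfolding hypernats_def by (intro CollectI exI[of _ ?c]) simp
    have "\<forall>\<^sub>F n in \<U>. \<bar>x n\<bar> \<le> (1 / real n) powr - real (?c n)"
      using eventually_ge_2
    proof eventually_elim
      case (elim n)
      have "(1 / real n) powr - real m = real n ^ m" for m
        using elim by (simp add: powr_minus powr_divide powr_realpow)
      then show ?case using le_power_nat_ceiling[OF elim] by metis
    qed
    then show "hle \<U> (hmap \<U> abs (hclass \<U> x)) (rho_pow \<U> (hmap \<U> uminus (hclass \<U> (\<lambda>n. real (?c n)))))"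
      by (simp add: rho_pow_def hmap_hclass hmap2_hclass hle_hclass)
  qed
  then show ?thesis unfolding rho_moderate_def by (auto simp: hyperreals_eq_range)
qed

text \<open>
  A nonzero \<open>\<bar>x n\<bar>\<close> exceeds \<open>1 / n ^ d n\<close> for a suitable exponent depending on \<open>n\<close>, so a
  negligible net vanishes almost everywhere.
\<close>

lemma rho_negligible_eq: "rho_negligible \<U> = {hclass \<U> (\<lambda>_. 0)}"
proof -
  have zero: "hle \<U> (hmap \<U> abs (hclass \<U> (\<lambda>_. 0))) (rho_pow \<U> d)" if d: "d \<in> hypernats \<U>" for d
  proof -
    obtain c :: "nat \<Rightarrow> nat" where "d = hclass \<U> (\<lambda>n. real (c n))" using d by (auto simp: hypernats_def)
    then show ?thesis by (simp add: rho_pow_def hmap_hclass hmap2_hclass hle_hclass)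
  qed
  have "hclass \<U> x = hclass \<U> (\<lambda>_. 0)"
    if le: "\<forall>d\<in>hypernats \<U>. hle \<U> (hmap \<U> abs (hclass \<U> x)) (rho_pow \<U> d)" for x
  proof -
    \<comment> \<open>An exponent that makes the bound smaller than \<open>\<bar>x n\<bar>\<close> wherever \<open>x n \<noteq> 0\<close>.\<close>
    define d where "d n = nat \<lceil>\<bar>1 / x n\<bar>\<rceil> + 1" for n
    have "hclass \<U> (\<lambda>n. real (d n)) \<in> hypernats \<U>" unfolding hypernats_def by blast
    from le[rule_format, OF this] have "\<forall>\<^sub>F n in \<U>. \<bar>x n\<bar> \<le> (1 / real n) powr real (d n)"
      by (simp add: rho_pow_def hmap_hclass hmap2_hclass hle_hclass)
    with eventually_ge_2 have "\<forall>\<^sub>F n in \<U>. x n = 0"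
    proof eventually_elim
      case (elim n)
      show ?case
      proof (rule ccontr)
        assume x: "x n \<noteq> 0"
        have "(1 / real n) powr real (d n) = 1 / real n ^ d n"
          using elim(1) by (simp add: powr_divide powr_realpow)
        with elim(2) have "\<bar>x n\<bar> \<le> 1 / real n ^ d n" by simp
        then have "real n ^ d n \<le> \<bar>1 / x n\<bar>"
          using x elim(1) by (simp add: field_simps abs_divide)
        also have "\<dots> \<le> real n ^ nat \<lceil>\<bar>1 / x n\<bar>\<rceil>" by (rule le_power_nat_ceiling[OF elim(1)])
        also have "\<dots> < real n ^ d n" using elim(1) by (intro power_strict_increasing) (auto simp: d_def)
        finally show False by simp
      qed
    qed
    then show ?thesis by (simp add: hclass_eq_iff)
  qed
  with zero show ?thesis unfolding rho_negligible_def by (auto simp: hyperreals_eq_range)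
qed

lemma rho_moderate_nets_eq: "rho_moderate_nets \<U> = UNIV"
proof -
  have "x \<in> rho_moderate_nets \<U>" for x
  proof -
    have "\<forall>\<^sub>F n in \<U>. \<bar>x n\<bar> \<le> real n ^ nat \<lceil>\<bar>x n\<bar>\<rceil>"
      using eventually_ge_2 by eventually_elim (rule le_power_nat_ceiling)
    then show ?thesis
      unfolding rho_moderate_nets_def by (intro CollectI exI[of _ "\<lambda>n. nat \<lceil>\<bar>x n\<bar>\<rceil>"])
  qed
  then show ?thesis by blast
qed

lemma hdiff_eq_zero_iff:
  assumes "x \<in> hyperreals \<U>" "y \<in> hyperreals \<U>"
  shows "hmap2 \<U> (-) x y = hclass \<U> (\<lambda>_. 0) \<longleftrightarrow> x = y"
proof -
  obtain a b where "x = hclass \<U> a" "y = hclass \<U> b"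
    using assms by (auto simp: hyperreals_eq_range)
  then show ?thesis by (simp add: hmap2_hclass hclass_eq_iff)
qed

lemma rho_proj_eq: "x \<in> hyperreals \<U> \<Longrightarrow> rho_proj \<U> x = {x}"
  unfolding rho_proj_def rho_eq_def rho_moderate_eq rho_negligible_eq
  using hdiff_eq_zero_iff by auto

lemma rho_proj_vec_nth:
  "\<lbrakk>x \<in> {..<k} \<rightarrow>\<^sub>E hyperreals \<U>; i < k\<rbrakk> \<Longrightarrow> rho_proj_vec \<U> k x i = {x i}"
  by (auto simp: rho_proj_vec_def rho_proj_eq PiE_iff)

lemma inj_on_rho_proj_vec: "inj_on (rho_proj_vec \<U> k) ({..<k} \<rightarrow>\<^sub>E hyperreals \<U>)"
proof (rule inj_onI)
  fix x y assume x: "x \<in> {..<k} \<rightarrow>\<^sub>E hyperreals \<U>" and y: "y \<in> {..<k} \<rightarrow>\<^sub>E hyperreals \<U>"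
    and eq: "rho_proj_vec \<U> k x = rho_proj_vec \<U> k y"
  show "x = y"
  proof (rule PiE_ext[OF x y])
    fix i assume "i \<in> {..<k}"
    then have "{x i} = {y i}" using rho_proj_vec_nth[OF x] rho_proj_vec_nth[OF y] eq by (metis lessThan_iff)
    then show "x i = y i" by simp
  qed
qed

lemma star_open_subset: "star_open k A \<Longrightarrow> A \<subseteq> {..<k} \<rightarrow>\<^sub>E hyperreals \<U>"
  unfolding star_open_def hvec_euclid_nets by blast

text \<open>
  Taking images under the injective projection commutes with unions and intersections, so the
  images of the open sets are a topology, and it is the one generated by the images of the boxes.
\<close>

lemma openin_rho_topology:
  "openin (rho_topology \<U> k) W \<longleftrightarrow> (\<exists>A. star_open k A \<and> W = rho_proj_vec \<U> k ` A)"
proof -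
  let ?E = "rho_proj_vec \<U> k"
  let ?P = "\<lambda>B. \<exists>V. (\<forall>n. openin (Euclidean_space k) (V n)) \<and> B = hbox \<U> UNIV k V"
  let ?Q = "\<lambda>B. \<exists>V. (\<forall>n. openin (Euclidean_space k) (V n)) \<and> B = ?E ` hbox \<U> UNIV k V"
  define R where "R W \<longleftrightarrow> (\<exists>A. star_open k A \<and> W = ?E ` A)" for W
  have "(arbitrary union_of ?Q) W \<longleftrightarrow> R W" for W
  proof
    assume "(arbitrary union_of ?Q) W"
    then obtain K where K: "K \<subseteq> Collect ?Q" "\<Union>K = W" by (auto simp: union_of_def arbitrary_def)
    define L where "L = {B. ?P B \<and> ?E ` B \<in> K}"
    have "K = (`) ?E ` L" using K(1) unfolding L_def by blast
    then have "W = ?E ` \<Union>L" using K(2) by auto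
    moreover have "(arbitrary union_of ?P) (\<Union>L)"
      unfolding union_of_def arbitrary_def by (intro exI[of _ L]) (auto simp: L_def)
    ultimately show "R W" unfolding R_def union_of_boxes_iff_star_open by blast
  next
    assume "R W"
    then obtain A where A: "star_open k A" "W = ?E ` A" unfolding R_def by blast
    then have "(arbitrary union_of ?P) A" by (simp only: union_of_boxes_iff_star_open)
    then obtain L where L: "L \<subseteq> Collect ?P" "\<Union>L = A" by (auto simp: union_of_def arbitrary_def)
    have "(`) ?E ` L \<subseteq> Collect ?Q" using L(1) by blast
    moreover have "\<Union>((`) ?E ` L) = W" using A(2) L(2) by auto
    ultimately show "(arbitrary union_of ?Q) W" unfolding union_of_def arbitrary_def by blast
  qed
  then have "rho_topology \<U> k = topology R"
    unfolding rho_topology_def rho_moderate_nets_eq by presburger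
  moreover have "istopology R"
    unfolding istopology_def
  proof (intro conjI allI impI)
    fix S T assume "R S" "R T"
    then obtain A B where A: "star_open k A" "S = ?E ` A" and B: "star_open k B" "T = ?E ` B"
      unfolding R_def by blast
    have "S \<inter> T = ?E ` (A \<inter> B)"
      unfolding A(2) B(2)
      using inj_on_image_Int[OF inj_on_rho_proj_vec star_open_subset[OF A(1)] star_open_subset[OF B(1)]]
      by simp
    moreover have "star_open k (A \<inter> B)"
      using istopology_star_open[of k] A(1) B(1) by (simp add: istopology_def)
    ultimately show "R (S \<inter> T)" unfolding R_def by blast
  next
    fix K assume K: "\<forall>S\<in>K. R S"
    define L where "L = {A. star_open k A \<and> ?E ` A \<in> K}"
    have "K = (`) ?E ` L" using K by (auto simp: L_def R_def)
    then have "\<Union>K = ?E ` \<Union>L" by auto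
    moreover have "star_open k (\<Union>L)"
      using istopology_star_open[of k] by (auto simp: istopology_def L_def)
    ultimately show "R (\<Union>K)" unfolding R_def by blast
  qed
  ultimately show ?thesis by (simp add: topology_inverse' R_def)
qed

text \<open>
  Two representing nets of functions agree on \<open>V n \<inter> V' n\<close> for almost all \<open>n\<close>. Otherwise, by the
  ultrafilter property, there is for almost all \<open>n\<close> a point at which they differ, and these points
  form a net at whose class \<open>f\<close> would have two values. On open sets, agreement implies equality of
  the partial derivatives.
\<close>

lemma star_rep_partial_unique:
  assumes V: "surrounds k V y" and V': "surrounds k V' y" and y: "y \<in> euclid_nets k"
    and rep: "star_rep k W f V g" and rep': "star_rep k W f V' g'" and i: "i < k"
  shows "\<forall>\<^sub>F n in \<U>. partial i (g n) (y n) = partial i (g' n) (y n)"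
proof -
  have eq: "\<forall>\<^sub>F n in \<U>. \<forall>x\<in>V n \<inter> V' n. g n x = g' n x"
  proof (rule ccontr)
    assume "\<not> (\<forall>\<^sub>F n in \<U>. \<forall>x\<in>V n \<inter> V' n. g n x = g' n x)"
    then have "\<forall>\<^sub>F n in \<U>. \<exists>x. x \<in> V n \<inter> V' n \<and> g n x \<noteq> g' n x"
      using ultrafilter_cases[of "\<lambda>n. \<forall>x\<in>V n \<inter> V' n. g n x = g' n x"] by (auto elim: eventually_mono)
    then obtain x where x: "\<forall>\<^sub>F n in \<U>. x n \<in> V n \<inter> V' n \<and> g n (x n) \<noteq> g' n (x n)"
      unfolding eventually_ex by blast
    then have "\<forall>\<^sub>F n in \<U>. x n \<in> topspace (Euclidean_space k)"
    proof eventually_elim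
      case (elim n)
      have "V n \<subseteq> topspace (Euclidean_space k)" using V openin_subset by (auto simp: surrounds_def)
      then show ?case using elim by blast
    qed
    then obtain z where z: "z \<in> euclid_nets k" "\<forall>\<^sub>F n in \<U>. z n = x n"
      by (rule ae_euclid_netE)
    have zV: "\<forall>\<^sub>F n in \<U>. z n \<in> V n \<and> z n \<in> V' n \<and> g n (z n) \<noteq> g' n (z n)"
      using z(2) x by eventually_elim auto
    then have "hclass \<U> (\<lambda>n. g n (z n)) = hclass \<U> (\<lambda>n. g' n (z n))"
      using star_repD(3)[OF rep z(1)] star_repD(3)[OF rep' z(1)] by (simp add: eventually_conj_iff)
    then have "\<forall>\<^sub>F n in \<U>. g n (z n) = g' n (z n)" by (simp add: hclass_eq_iff)
    with zV have "\<forall>\<^sub>F n in \<U>. False" by eventually_elim auto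
    then show False by simp
  qed
  have "surrounds k (\<lambda>n. V n \<inter> V' n) y" by (rule surrounds_Int[OF V V'])
  then have o: "\<And>n. openin (Euclidean_space k) (V n \<inter> V' n)" and yV: "\<forall>\<^sub>F n in \<U>. y n \<in> V n \<inter> V' n"
    by (simp_all add: surrounds_def)
  from eq yV show ?thesis
  proof eventually_elim
    case (elim n)
    then show ?case by (intro partial_cong[OF o _ i]) auto
  qed
qed

text \<open>
  All local representations at a point give the same value, so the description in the definition
  of \<open>hpartial\<close> has exactly one solution.
\<close>

lemma hpartial_hvec:
  assumes rep: "local_rep \<U> UNIV k W f V g" and y: "y \<in> nets UNIV k V" and i: "i < k"
  shows "hpartial \<U> UNIV k W i f (hvec \<U> k y) = hclass \<U> (\<lambda>n. partial i (g n) (y n))"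
proof -
  have yW: "hvec \<U> k y \<in> W" using rep y unfolding local_rep_def hbox_def by blast
  have "v = hclass \<U> (\<lambda>n. partial i (g n) (y n))"
    if rep': "local_rep \<U> UNIV k W f V' g'" and z: "z \<in> nets UNIV k V'" "hvec \<U> k z = hvec \<U> k y"
      and v: "v = hclass \<U> (\<lambda>n. partial i (g' n) (z n))" for v V' g' z
  proof -
    have o: "\<forall>n. openin (Euclidean_space k) (V n)" "\<forall>n. openin (Euclidean_space k) (V' n)"
      using rep rep' by (auto simp: local_rep_def)
    have ynet: "y \<in> euclid_nets k" and znet: "z \<in> euclid_nets k"
      using nets_subset_euclid_nets o y z(1) by blast+
    have eq: "\<forall>\<^sub>F n in \<U>. z n = y n" by (rule euclid_nets_eqD[OF z(2) znet ynet])
    have "surrounds k V y" using o(1) y by (auto simp: surrounds_def nets_def)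
    moreover have "surrounds k V' y"
      unfolding surrounds_def
    proof
      show "\<forall>\<^sub>F n in \<U>. y n \<in> V' n"
        using eq
      proof eventually_elim
        case (elim n)
        have "z n \<in> V' n" using z(1) by (simp add: nets_def)
        then show ?case by (simp add: elim)
      qed
    qed (rule o(2))
    ultimately have "\<forall>\<^sub>F n in \<U>. partial i (g n) (y n) = partial i (g' n) (y n)"
      by (rule star_rep_partial_unique[OF _ _ ynet local_rep_imp_star_rep[OF rep y]
            local_rep_imp_star_rep[OF rep' z(1)] i])
    with eq have "\<forall>\<^sub>F n in \<U>. partial i (g' n) (z n) = partial i (g n) (y n)"
      by eventually_elim simp
    then show ?thesis by (simp add: v hclass_eq_iff)
  qed
  then have "(THE v. \<exists>V g z. local_rep \<U> UNIV k W f V g \<and> z \<in> nets UNIV k V \<and>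
      hvec \<U> k z = hvec \<U> k y \<and> v = hclass \<U> (\<lambda>n. partial i (g n) (z n))) =
      hclass \<U> (\<lambda>n. partial i (g n) (y n))"
    by (intro the_equality) (use rep y in blast)+
  with yW show ?thesis by (simp add: hpartial_def)
qed

lemma hpartial_in_star_smooth:
  assumes f: "f \<in> star_smooth \<U> k W" and i: "i < k"
  shows "hpartial \<U> UNIV k W i f \<in> star_smooth \<U> k W"
proof -
  have "hpartial \<U> UNIV k W i f x \<in> hyperreals \<U> \<and>
      (\<exists>V g. x \<in> hbox \<U> UNIV k V \<and> local_rep \<U> UNIV k W (hpartial \<U> UNIV k W i f) V g)"
    if "x \<in> W" for x
  proof -
    have "\<exists>V g. x \<in> hbox \<U> UNIV k V \<and> local_rep \<U> UNIV k W f V g"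
      using f that by (simp add: star_smooth_def hsmooth_def)
    then obtain V g where V: "x \<in> hbox \<U> UNIV k V" and rep: "local_rep \<U> UNIV k W f V g"
      by blast
    have "local_rep \<U> UNIV k W (hpartial \<U> UNIV k W i f) V (\<lambda>n. partial i (g n))"
      using rep hpartial_hvec[OF rep _ i] unfolding local_rep_def by (simp add: smooth_on_partial i)
    moreover have "hpartial \<U> UNIV k W i f x \<in> hyperreals \<U>"
      using V hpartial_hvec[OF rep _ i] unfolding hbox_def by (auto simp: hyperreals_eq_range)
    ultimately show ?thesis using V by blast
  qed
  then show ?thesis
    unfolding star_smooth_def hsmooth_def by (auto simp: hpartial_def PiE_iff)
qed

lemma hderiv_induct:
  assumes "P f" "\<And>h i. \<lbrakk>P h; i < k\<rbrakk> \<Longrightarrow> P (hpartial \<U> M k W i h)"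
  shows "P (hderiv \<U> M k W \<alpha> f)"
proof -
  have pow: "P ((hpartial \<U> M k W i ^^ m) h)" if "P h" "i < k" for h i m
    by (induction m) (use that assms(2) in auto)
  have "P (foldr (\<lambda>i. hpartial \<U> M k W i ^^ \<alpha> i) js f)" if "set js \<subseteq> {..<k}" for js
    using that by (induction js) (auto simp: assms(1) pow)
  from this[of "[0..<k]"] show ?thesis unfolding hderiv_def by (simp add: atLeast0LessThan)
qed

lemma hderiv_zero: "hderiv \<U> M k W (\<lambda>_. 0) f = f"
proof -
  have "foldr (\<lambda>i. hpartial \<U> M k W i ^^ 0) js f = f" for js by (induction js) auto
  then show ?thesis by (simp add: hderiv_def)
qed

lemma star_smooth_values: "\<lbrakk>f \<in> star_smooth \<U> k A; x \<in> A\<rbrakk> \<Longrightarrow> f x \<in> hyperreals \<U>"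
  by (auto simp: star_smooth_def hsmooth_def)

text \<open>
  Since every hyperreal is moderate, the condition on the derivatives only requires them to be
  hyperreal-valued, and they are, being smooth themselves.
\<close>

lemma rho_bounded_moderate_eq: "rho_bounded \<U> (rho_moderate \<U>) k A = star_smooth \<U> k A"
proof -
  have "hderiv \<U> UNIV k A \<alpha> f \<in> star_smooth \<U> k A" if "f \<in> star_smooth \<U> k A" for \<alpha> f
    by (rule hderiv_induct) (use that hpartial_in_star_smooth in auto)
  then show ?thesis
    unfolding rho_bounded_def rho_moderate_nets_eq rho_moderate_eq
    using star_smooth_values unfolding star_smooth_def by blast
qed

lemma zero_rho_bounded:
  assumes A: "star_open k A"
  shows "(\<lambda>x\<in>A. hclass \<U> (\<lambda>_. 0)) \<in> rho_bounded \<U> (rho_negligible \<U>) k A"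
proof -
  let ?z = "\<lambda>x\<in>A. hclass \<U> (\<lambda>_. 0)"
  have rep: "\<exists>V. surrounds k V y \<and> star_rep k A ?z V (\<lambda>_ _. 0)"
    if y: "y \<in> euclid_nets k" "hvec \<U> k y \<in> A" for y
  proof -
    obtain V where V: "surrounds k V y"
        "\<And>z. \<lbrakk>z \<in> euclid_nets k; \<forall>\<^sub>F n in \<U>. z n \<in> V n\<rbrakk> \<Longrightarrow> hvec \<U> k z \<in> A"
      using star_openD[OF A y] by metis
    have "star_rep k A ?z V (\<lambda>_ _. 0)"
      using V by (auto simp: star_rep_def surrounds_def smooth_on_const)
    with V(1) show ?thesis by blast
  qed
  then have "?z \<in> star_smooth \<U> k A" unfolding star_smooth_iff[OF A] by blast
  moreover have "hderiv \<U> UNIV k A \<alpha> ?z = ?z" for \<alpha>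
  proof (rule hderiv_induct)
    fix h i assume h: "h = ?z" and i: "i < k"
    show "hpartial \<U> UNIV k A i h = ?z"
    proof (rule extensionalityI[of _ A])
      fix x assume x: "x \<in> A"
      obtain y where y: "y \<in> euclid_nets k" "x = hvec \<U> k y" using star_open_point[OF A x] .
      then obtain V where V: "surrounds k V y" "star_rep k A ?z V (\<lambda>_ _. 0)" using rep x by blast
      have "local_rep \<U> UNIV k A ?z (enlarge k V y) (\<lambda>_ _. 0)"
        using star_rep_imp_local_rep[OF V(1) y(1) V(2)] by simp
      from hpartial_hvec[OF this enlarge(2)[OF V(1) y(1)] i]
      show "hpartial \<U> UNIV k A i h x = ?z x" using x by (simp add: h y(2) partial_def)
    qed (auto simp: hpartial_def)
  qed simp
  ultimately show ?thesis
    unfolding rho_bounded_def rho_moderate_nets_eq rho_negligible_eq by (auto simp: star_smooth_def)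
qed

text \<open>
  The derivative of order zero of a negligible function is the function itself, so the
  equivalence is equality. The converse needs that the zero function has vanishing derivatives of
  all orders.
\<close>

lemma rho_fun_eq_iff:
  assumes A: "star_open k A"
  shows "(\<phi>, \<psi>) \<in> rho_fun_eq \<U> k A \<longleftrightarrow> \<phi> \<in> star_smooth \<U> k A \<and> \<psi> = \<phi>"
proof
  assume "(\<phi>, \<psi>) \<in> rho_fun_eq \<U> k A"
  then have \<phi>: "\<phi> \<in> star_smooth \<U> k A" and \<psi>: "\<psi> \<in> star_smooth \<U> k A"
    and d: "(\<lambda>y\<in>A. hmap2 \<U> (-) (\<phi> y) (\<psi> y)) \<in> rho_bounded \<U> (rho_negligible \<U>) k A"
    unfolding rho_fun_eq_def rho_bounded_moderate_eq by auto
  have "\<psi> x = \<phi> x" if x: "x \<in> A" for x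
  proof -
    have "hderiv \<U> (rho_moderate_nets \<U>) k A (\<lambda>_. 0) (\<lambda>y\<in>A. hmap2 \<U> (-) (\<phi> y) (\<psi> y)) x \<in> rho_negligible \<U>"
      using d x unfolding rho_bounded_def by blast
    then have "hmap2 \<U> (-) (\<phi> x) (\<psi> x) = hclass \<U> (\<lambda>_. 0)"
      using x by (simp add: hderiv_zero rho_negligible_eq)
    then show ?thesis
      using hdiff_eq_zero_iff star_smooth_values[OF \<phi> x] star_smooth_values[OF \<psi> x] by simp
  qed
  moreover have "\<phi> \<in> extensional A" "\<psi> \<in> extensional A"
    using \<phi> \<psi> by (auto simp: star_smooth_iff[OF A])
  ultimately show "\<phi> \<in> star_smooth \<U> k A \<and> \<psi> = \<phi>"
    using \<phi> extensionalityI by metis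
next
  assume \<phi>: "\<phi> \<in> star_smooth \<U> k A \<and> \<psi> = \<phi>"
  then have "\<phi> y \<in> hyperreals \<U>" if "y \<in> A" for y using that star_smooth_values by blast
  then have "(\<lambda>y\<in>A. hmap2 \<U> (-) (\<phi> y) (\<psi> y)) = (\<lambda>x\<in>A. hclass \<U> (\<lambda>_. 0))"
    by (intro restrict_ext) (simp add: \<phi> hdiff_eq_zero_iff)
  then show "(\<phi>, \<psi>) \<in> rho_fun_eq \<U> k A"
    using \<phi> zero_rho_bounded[OF A] unfolding rho_fun_eq_def rho_bounded_moderate_eq by simp
qed

lemma rho_preimage_eq:
  assumes A: "star_open k A"
  shows "rho_preimage \<U> k (rho_proj_vec \<U> k ` A) = A"
  unfolding rho_preimage_def rho_moderate_eq
  using star_open_subset[OF A] inj_on_image_mem_iff[OF inj_on_rho_proj_vec _ star_open_subset[OF A]]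
  by blast

lemma rho_fun_of_class_singleton:
  assumes A: "star_open k A" and \<phi>: "\<phi> \<in> star_smooth \<U> k A" and x: "x \<in> A"
  shows "rho_fun_of_class \<U> k (rho_proj_vec \<U> k ` A) {\<phi>} (rho_proj_vec \<U> k x) = {\<phi> x}"
proof -
  have "y = x" if "y \<in> A" "rho_proj_vec \<U> k y = rho_proj_vec \<U> k x" for y
    using inj_on_subset[OF inj_on_rho_proj_vec star_open_subset[OF A]] that x by (auto dest: inj_onD)
  moreover have "rho_proj \<U> (\<phi> x) = {\<phi> x}"
    by (rule rho_proj_eq[OF star_smooth_values[OF \<phi> x]])
  ultimately show ?thesis
    unfolding rho_fun_of_class_def rho_preimage_eq[OF A] using x
    by (simp, intro the_equality) auto
qed

text \<open>
  Classes of functions modulo negligible ones are singletons, so a smooth function of asymptotic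
  numbers is a smooth function of hyperreals followed by \<open>x \<mapsto> {x}\<close>.
\<close>

lemma rho_smooth_iff:
  assumes A: "star_open k A"
  shows "\<psi> \<in> rho_smooth \<U> k (rho_proj_vec \<U> k ` A) \<longleftrightarrow>
    \<psi> \<in> extensional (rho_proj_vec \<U> k ` A) \<and>
    (\<exists>\<phi>\<in>star_smooth \<U> k A. \<forall>x\<in>A. \<psi> (rho_proj_vec \<U> k x) = {\<phi> x})"
proof -
  let ?W = "rho_proj_vec \<U> k ` A"
  have "rho_fun_eq \<U> k A `` {\<phi>} = {\<phi>}" if "\<phi> \<in> star_smooth \<U> k A" for \<phi>
    using that by (auto simp: rho_fun_eq_iff[OF A])
  then have "star_smooth \<U> k A // rho_fun_eq \<U> k A = (\<lambda>\<phi>. {\<phi>}) ` star_smooth \<U> k A"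
    by (auto simp: quotient_def)
  then have eq: "rho_smooth \<U> k ?W = (\<lambda>\<phi>. rho_fun_of_class \<U> k ?W {\<phi>}) ` star_smooth \<U> k A"
    unfolding rho_smooth_def rho_preimage_eq[OF A] rho_bounded_moderate_eq by (simp add: image_image)
  have "\<psi> = rho_fun_of_class \<U> k ?W {\<phi>} \<longleftrightarrow>
      \<psi> \<in> extensional ?W \<and> (\<forall>x\<in>A. \<psi> (rho_proj_vec \<U> k x) = {\<phi> x})"
    if \<phi>: "\<phi> \<in> star_smooth \<U> k A" for \<phi>
  proof
    assume "\<psi> = rho_fun_of_class \<U> k ?W {\<phi>}"
    then show "\<psi> \<in> extensional ?W \<and> (\<forall>x\<in>A. \<psi> (rho_proj_vec \<U> k x) = {\<phi> x})"
      using rho_fun_of_class_singleton[OF A \<phi>] by (simp add: rho_fun_of_class_def)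
  next
    assume \<psi>: "\<psi> \<in> extensional ?W \<and> (\<forall>x\<in>A. \<psi> (rho_proj_vec \<U> k x) = {\<phi> x})"
    show "\<psi> = rho_fun_of_class \<U> k ?W {\<phi>}"
    proof (rule extensionalityI[of _ ?W])
      show "rho_fun_of_class \<U> k ?W {\<phi>} \<in> extensional ?W" by (simp add: rho_fun_of_class_def)
    qed (use \<psi> rho_fun_of_class_singleton[OF A \<phi>] in auto)
  qed
  then show ?thesis
    unfolding eq image_iff by (simp cong: bex_cong)
qed

lemma smooth_spaces_transport_rho:
  "smooth_spaces_transport (star_topology \<U>) (star_smooth \<U>) (rho_topology \<U>) (rho_smooth \<U>)
    (\<lambda>x. {x}) (rho_proj_vec \<U>)"
proof -
  interpret smooth_spaces "star_topology \<U>" "star_smooth \<U>" by (rule smooth_spaces_star)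
  show ?thesis
  proof
    show "inj (\<lambda>x::hyp. {x})" by (auto intro: injI)
    show "rho_proj_vec \<U> k x i = {x i}" if "x \<in> topspace (star_topology \<U> k)" "i < k" for k x i
      using that by (simp add: topspace_star rho_proj_vec_nth)
    show "inj_on (rho_proj_vec \<U> k) (topspace (star_topology \<U> k))" for k
      by (simp add: topspace_star inj_on_rho_proj_vec)
  qed (simp_all add: openin_rho_topology openin_star_topology rho_smooth_iff)
qed

end

theorem theorem3p13:
  fixes \<U> :: "nat filter"
  assumes "free_ultrafilter \<U>"
  shows "(concrete_site (star_EucOp \<U>) \<and>
          (\<exists>FO FA. faithful_functor EucOp (star_EucOp \<U>) FO FA \<and>
                   preserves_coverings EucOp (star_EucOp \<U>) FO FA)) \<and>
         (concrete_site (rho_EucOp \<U>) \<and>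
          (\<exists>FO FA. faithful_functor EucOp (rho_EucOp \<U>) FO FA \<and>
                   preserves_coverings EucOp (rho_EucOp \<U>) FO FA))"
proof -
  interpret ultrapower \<U> by unfold_locales (rule assms)
  interpret star: smooth_spaces "star_topology \<U>" "star_smooth \<U>" by (rule smooth_spaces_star)
  interpret rho: smooth_spaces_transport "star_topology \<U>" "star_smooth \<U>" "rho_topology \<U>"
    "rho_smooth \<U>" "\<lambda>x. {x}" "rho_proj_vec \<U>"
    by (rule smooth_spaces_transport_rho)
  have star: "concrete_site (star_EucOp \<U>)"
    unfolding star_EucOp_def by (rule star.concrete_site_open_set_site)
  have rho: "concrete_site (rho_EucOp \<U>)"
    unfolding rho_EucOp_def
    by (rule smooth_spaces.concrete_site_open_set_site[OF rho.smooth_spaces_image])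
  have "faithful_functor (star_EucOp \<U>) (rho_EucOp \<U>) rho.transport_obj rho.transport_map"
    "preserves_coverings (star_EucOp \<U>) (rho_EucOp \<U>) rho.transport_obj rho.transport_map"
    unfolding star_EucOp_def rho_EucOp_def by (rule rho.transport_functor rho.transport_coverings)+
  then have "\<exists>FO FA. faithful_functor EucOp (rho_EucOp \<U>) FO FA \<and> preserves_coverings EucOp (rho_EucOp \<U>) FO FA"
    using faithful_functor_compose[OF star_faithful_functor]
      preserves_coverings_compose[OF _ star_preserves_coverings] star_faithful_functor
    unfolding faithful_functor_def by blast
  with star rho star_faithful_functor star_preserves_coverings show ?thesis by blast
qed

end
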